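(* Let $p_\bullet,p_\circ\in(0,1)$ and consider the random walk $(X_n)_{n\ge0}$ on the simple symmetric exclusion process with density $\rho$. If $p_\bullet=1-p_\circ$ and $\rho=1/2$, then $X_n/n\to0$ as $n\to\infty$, $\mathbb{P}^\rho$-almost surely.
   Context: Simple symmetric exclusion process with density $\rho\in(0,1)$ and fixed rate $\gamma>0$: $\eta^\rho=(\eta^\rho_t(x);x\in\mathbb{Z})_{t\ge0}$, where $\eta^\rho_0(x)$, $x\in\mathbb{Z}$, are i.i.d. Bernoulli with mean $\rho$; independently, each edge $\{x,x+1\}$ of $\mathbb{Z}$ carries an independent Poisson point process of rate $\gamma$, and at each arrival time of the process on $\{x,x+1\}$ the occupation values of $x$ and $x+1$ are exchanged. Random walker: given $\eta^\rho=\eta$, $(X_n)_{n\ge0}$ is the walk on $\mathbb{Z}$ with $X_0=0$ such that, at step $n$, if $\eta_n(X_n)>0$ then $X_{n+1}=X_n+1$ with probability $p_\bullet$ and $X_{n+1}=X_n-1$ with probability $1-p_\bullet$; if $\eta_n(X_n)=0$ then $X_{n+1}=X_n+1$ with probability $p_\circ$ and $X_{n+1}=X_n-1$ with probability $1-p_\circ$. $\mathbb{P}^\rho$ is the annealed law (joint law of environment and walk). *)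

theory Defs
  imports "HOL-Probability.Probability"
begin

text \<open>
  A Poisson point process on \<open>(0, \<infinity>)\<close> with intensity \<open>\<gamma>\<close> times Lebesgue measure, as a random
  locally finite set of points. The Poisson mass function is written out because
  \<open>poisson_pmf\<close> excludes the parameter \<open>0\<close>, which occurs for Lebesgue null sets.
\<close>

definition (in prob_space) poisson_point_process :: "real \<Rightarrow> ('a \<Rightarrow> real set) \<Rightarrow> bool" where
  "poisson_point_process \<gamma> T \<longleftrightarrow>
    (\<forall>\<omega>\<in>space M. T \<omega> \<subseteq> {0<..} \<and> (\<forall>t. finite (T \<omega> \<inter> {..t}))) \<and>
    (\<forall>B\<in>sets borel. bounded B \<longrightarrow>
      (\<lambda>\<omega>. card (T \<omega> \<inter> B)) \<in> measurable M (count_space UNIV)) \<and>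
    (\<forall>B\<in>sets borel. bounded B \<longrightarrow> B \<subseteq> {0<..} \<longrightarrow>
      (\<forall>k. prob {\<omega>\<in>space M. card (T \<omega> \<inter> B) = k} =
        (\<gamma> * measure lborel B) ^ k / fact k * exp (- (\<gamma> * measure lborel B)))) \<and>
    (\<forall>(n::nat) B. (\<forall>i<n. B i \<in> sets borel \<and> bounded (B i) \<and> B i \<subseteq> {0<..}) \<longrightarrow>
      disjoint_family_on B {..<n} \<longrightarrow>
      indep_vars (\<lambda>_. count_space UNIV) (\<lambda>i \<omega>. card (T \<omega> \<inter> B i)) {..<n})"

text \<open>
  The counting function \<open>t \<mapsto> card (T \<inter> (0, t])\<close>. The random set \<open>T\<close> is regarded as a random
  element through it: the counts of all bounded Borel sets are measurable functions of it.
\<close>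

definition counting_path :: "real set \<Rightarrow> real \<Rightarrow> nat" where
  "counting_path S = (\<lambda>t\<in>{0..}. card (S \<inter> {0<..t}))"

abbreviation counting_space :: "(real \<Rightarrow> nat) measure" where
  "counting_space \<equiv> (\<Pi>\<^sub>M t\<in>{0..}. count_space UNIV)"

text \<open>
  Pathwise exchange dynamics on \<open>\<int>\<close>: \<open>T x\<close> is the set of arrival times on the edge
  \<open>{x, x + 1}\<close>, and \<open>\<xi> t x\<close> says whether \<open>x\<close> is occupied at time \<open>t\<close>. The value at \<open>x\<close> is constant
  while neither edge at \<open>x\<close> rings, and at an arrival on \<open>{x, x + 1}\<close> the values just before
  that time are exchanged. For locally finite
  \<open>T\<close>, this determines \<open>\<xi>\<close> from \<open>\<xi> 0\<close> whenever no two adjacent edges ring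
  simultaneously and, for every \<open>t\<close>, arbitrarily far to the left and to the right there are
  edges with no arrival up to time \<open>t\<close>; for Poisson clocks both hold almost surely.
\<close>

definition exchange_dynamics :: "(int \<Rightarrow> real set) \<Rightarrow> (real \<Rightarrow> int \<Rightarrow> bool) \<Rightarrow> bool" where
  "exchange_dynamics T \<xi> \<longleftrightarrow>
    (\<forall>x s t. 0 \<le> s \<longrightarrow> s \<le> t \<longrightarrow> (T (x - 1) \<union> T x) \<inter> {s<..t} = {} \<longrightarrow> \<xi> t x = \<xi> s x) \<and>
    (\<forall>x. \<forall>t\<in>T x. \<forall>\<^sub>F s in at_left t. \<xi> t x = \<xi> s (x + 1) \<and> \<xi> t (x + 1) = \<xi> s x)"

text \<open>
  The simple symmetric exclusion process with density \<open>\<rho>\<close> and rate \<open>\<gamma>\<close>, on an arbitrary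
  probability space: \<open>\<eta> t x \<omega>\<close> is the occupation of site \<open>x\<close> at time \<open>t \<ge> 0\<close> and \<open>T x\<close> the arrival
  process of the edge \<open>{x, x + 1}\<close>.
\<close>

locale ssep = prob_space M for M :: "'a measure" +
  fixes \<rho> \<gamma> :: real
    and T :: "int \<Rightarrow> 'a \<Rightarrow> real set"
    and \<eta> :: "real \<Rightarrow> int \<Rightarrow> 'a \<Rightarrow> bool"
  assumes density: "0 < \<rho>" "\<rho> < 1"
    and rate: "0 < \<gamma>"
    and measurable_eta: "\<And>t x. 0 \<le> t \<Longrightarrow> \<eta> t x \<in> measurable M (count_space UNIV)"
    and initial_law: "\<And>x. distr M (count_space UNIV) (\<eta> 0 x) = measure_pmf (bernoulli_pmf \<rho>)"
    and initial_indep: "indep_vars (\<lambda>_. count_space UNIV) (\<eta> 0) UNIV"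
    and clocks: "\<And>x. poisson_point_process \<gamma> (T x)"
    and clocks_indep: "indep_vars (\<lambda>_. counting_space) (\<lambda>x \<omega>. counting_path (T x \<omega>)) UNIV"
    and initial_clocks_indep:
      "indep_set
         (sets (vimage_algebra (space M) (\<lambda>\<omega> x. \<eta> 0 x \<omega>) (\<Pi>\<^sub>M x\<in>UNIV. count_space UNIV)))
         (sets (vimage_algebra (space M) (\<lambda>\<omega> x. counting_path (T x \<omega>)) (\<Pi>\<^sub>M x\<in>UNIV. counting_space)))"
    and dynamics: "AE \<omega> in M. exchange_dynamics (\<lambda>x. T x \<omega>) (\<lambda>t x. \<eta> t x \<omega>)"

text \<open>
  The sigma-algebra generated by the whole environment process (at all times) and by
  \<open>X 0, \<dots>, X n\<close>.
\<close>

definition (in ssep) history :: "(nat \<Rightarrow> 'a \<Rightarrow> int) \<Rightarrow> nat \<Rightarrow> 'a measure" where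
  "history X n = vimage_algebra (space M)
    (\<lambda>\<omega>. (\<lambda>(t, x)\<in>{0..} \<times> UNIV. \<eta> t x \<omega>, \<lambda>k\<in>{..n}. X k \<omega>))
    ((\<Pi>\<^sub>M i\<in>{0..} \<times> UNIV. count_space UNIV) \<Otimes>\<^sub>M (\<Pi>\<^sub>M k\<in>{..n}. count_space UNIV))"

text \<open>
  Conditioning the steps on \<open>history X n\<close>, which contains the environment at all times, makes
  them the steps of the walk given \<open>\<eta>\<close>; the law of the pair \<open>(\<eta>, X)\<close> under \<open>M\<close> is thus the
  annealed law.
\<close>

locale walk_on_ssep = ssep M \<rho> \<gamma> T \<eta>
  for M :: "'a measure" and \<rho> \<gamma> :: real
    and T :: "int \<Rightarrow> 'a \<Rightarrow> real set"
    and \<eta> :: "real \<Rightarrow> int \<Rightarrow> 'a \<Rightarrow> bool" +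
  fixes p_bullet p_circ :: real
    and X :: "nat \<Rightarrow> 'a \<Rightarrow> int"
  assumes measurable_X: "\<And>n. X n \<in> measurable M (count_space UNIV)"
    and start: "AE \<omega> in M. X 0 \<omega> = 0"
    and step_right: "\<And>n. AE \<omega> in M.
      real_cond_exp M (history X n) (indicator {\<omega>\<in>space M. X (Suc n) \<omega> = X n \<omega> + 1}) \<omega> =
        (if \<eta> (real n) (X n \<omega>) \<omega> then p_bullet else p_circ)"
    and step_left: "\<And>n. AE \<omega> in M.
      real_cond_exp M (history X n) (indicator {\<omega>\<in>space M. X (Suc n) \<omega> = X n \<omega> - 1}) \<omega> =
        (if \<eta> (real n) (X n \<omega>) \<omega> then 1 - p_bullet else 1 - p_circ)"

end

theory Submission
  imports Defs
begin

text \<open>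
  Put an arrow in every point of discrete space-time, pointing right iff the occupation there agrees
  with an independent coin of success probability \<open>p_bullet\<close>. As \<open>p_circ = 1 - p_bullet\<close>, the walk
  from the origin that follows the arrows has the law of \<open>X\<close>. The arrows define walks from all other
  points too, and two walks of the same parity cannot cross (\<open>walk_mono\<close>). At density \<open>1 / 2\<close> the law
  of the arrows is unchanged if space is reflected and particles and holes are exchanged, so that
  over any period a walk ends to the right of its starting point with probability at most \<open>1 / 2\<close>
  (\<open>walk_up_half\<close>).

  Call a walk fast at slope \<open>w\<close> if it moves by at least \<open>w L\<close> to the right within time \<open>L\<close>. Let a
  walk be fast at slope \<open>w - 1 / K\<close> over a period \<open>K L\<close> and cut the period into \<open>K\<close> blocks. Either two
  walks in distant columns of space are fast at slope \<open>w\<close> over single blocks, or the walk stays in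
  a tube of width \<open>O(L)\<close> around a line of slope \<open>w\<close>. In the second case a number proportional to \<open>K\<close>
  of walks with fixed starting points on top of the tube must all end to the right of their starting
  points (\<open>fast_walk_dichotomy\<close>). Columns of width \<open>O(L)\<close> at distance \<open>O(L)\<close> evolve almost
  independently, even during the whole period \<open>K L\<close>: the present occupation of a site is the initial
  occupation of another one, its origin, which is the end point of a random walk and thus at
  distance \<open>O(sqrt (K L))\<close> (\<open>Pr_escapes\<close>). So if single blocks are fast with probability at most \<open>\<delta>\<close>,
  then the long period is fast with probability \<open>O(K ^ 6 * \<delta> ^ 2)\<close> plus a term exponentially small in
  \<open>K\<close> (\<open>renormalisation_inequality\<close>). With \<open>\<delta> = K ^ (-8)\<close> this can be iterated. No walk has slope
  \<open>2\<close>, and each step lowers the slope by \<open>1 / K\<close>, down to an arbitrary positive slope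
  (\<open>slow_descent\<close>); after that the slope is kept and \<open>K\<close> is doubled in each step, which makes the
  probabilities summable over the scales (\<open>slow_scale\<close>, \<open>Pr_excursion\<close>). The Borel-Cantelli lemma
  concludes the proof.

  The estimates are carried out in a product space: a unit of time is divided into \<open>m\<close> cells, and
  each edge carries one Bernoulli variable for each cell, which says whether it rings. They are
  uniform in \<open>m\<close>. Within a finite window the exchange dynamics agrees with this discrete
  stirring with a probability that tends to \<open>1\<close> as \<open>m\<close> grows (\<open>environment_approximation\<close>), and so the
  probabilities of path events in the product space converge to those of \<open>X\<close> (\<open>path_limit\<close>).
\<close>

section \<open>Coalescing walks in a field of arrows\<close>

fun walk :: "(nat \<Rightarrow> int \<Rightarrow> bool) \<Rightarrow> nat \<Rightarrow> int \<Rightarrow> nat \<Rightarrow> int" where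
  "walk f t y 0 = y"
| "walk f t y (Suc k) = walk f t y k + (if f (t + k) (walk f t y k) then 1 else -1)"

lemma walk_add: "walk f t y (k + l) = walk f (t + k) (walk f t y k) l"
  by (induction l) (auto simp: add.assoc)

lemma walk_range: "\<bar>walk f t y k - y\<bar> \<le> int k"
  by (induction k) auto

lemma walk_parity: "even (walk f t y k - y - int k)"
  by (induction k) auto

text \<open>
  Walks of the same parity are at even distance at all times, so they cannot jump over each other,
  and once they meet they stay together.
\<close>

lemma walk_mono:
  assumes "y \<le> y'" "even (y' - y)"
  shows "walk f t y k \<le> walk f t y' k"
proof -
  have "walk f t y k \<le> walk f t y' k \<and> even (walk f t y' k - walk f t y k)"
  proof (induction k)
    case (Suc k)
    let ?a = "walk f t y k" and ?b = "walk f t y' k"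
    have "a = b \<or> a + 2 \<le> b" if "a \<le> b" "even (b - a)" for a b :: int using that by presburger
    from this[of ?a ?b] have "?a = ?b \<or> ?a + 2 \<le> ?b" using Suc by blast
    then show ?case using Suc by auto
  qed (use assms in auto)
  then show ?thesis ..
qed

lemma walk_cong:
  assumes "\<And>n x. t \<le> n \<Longrightarrow> n < t + k \<Longrightarrow> \<bar>x - y\<bar> \<le> int k \<Longrightarrow> f n x = g n x"
  shows "walk f t y k = walk g t y k"
proof -
  have "l \<le> k \<Longrightarrow> walk f t y l = walk g t y l" for l
  proof (induction l)
    case (Suc l)
    have "\<bar>walk g t y l - y\<bar> \<le> int k" using walk_range[of g t y l] Suc by linarith
    then show ?case using Suc assms[of "t+l" "walk g t y l"] by simp
  qed simp
  then show ?thesis by simp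
qed

lemma walk_reflect: "walk (\<lambda>n x. \<not> f n (2 * c - x)) t y k = 2 * c - walk f t (2 * c - y) k"
  by (induction k) auto

text \<open>
  All increments up to the first exceptional one and after the last exceptional one are at most \<open>c\<close>,
  and everything in between is bounded by \<open>G\<close> at one stroke. In the induction \<open>j\<close> is the
  first exceptional index.
\<close>

lemma increment_bound:
  fixes X :: "nat \<Rightarrow> real"
  assumes c: "0 \<le> c" "0 \<le> G"
    and bad: "\<And>j i. j \<le> i \<Longrightarrow> i < K \<Longrightarrow> X (Suc j) - X j > c \<Longrightarrow> X (Suc i) - X i > c \<Longrightarrow> X (Suc i) - X j \<le> G"
    and i: "i \<le> i'" "i' \<le> K"
  shows "X i' - X i \<le> (real i' - real i) * c + G"
proof -
  let ?P = "\<lambda>n. X n - X i \<le> (real n - real i) * c \<or>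
     (\<exists>j. i \<le> j \<and> j < n \<and> X j - X i \<le> (real j - real i) * c \<and> X (Suc j) - X j > c \<and>
        X n - X j \<le> (real n - real j) * c + G)"
  have "n \<le> K \<longrightarrow> ?P n" if "i \<le> n" for n
    using that
  proof (induction n rule: dec_induct)
    case (step n)
    show ?case
    proof
      assume nK: "Suc n \<le> K"
      then have IH: "?P n" using step by simp
      show "?P (Suc n)"
      proof (cases "X (Suc n) - X n > c")
        case False
        then have le: "X (Suc n) \<le> X n + c" by simp
        from IH show ?thesis
        proof
          assume "X n - X i \<le> (real n - real i) * c"
          then show ?thesis using le by (simp add: algebra_simps)
        next
          assume "\<exists>j. i \<le> j \<and> j < n \<and> X j - X i \<le> (real j - real i) * c \<and> X (Suc j) - X j > c \<and>
            X n - X j \<le> (real n - real j) * c + G"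
          then obtain j where "i \<le> j" "j < n" "X j - X i \<le> (real j - real i) * c" "X (Suc j) - X j > c"
            "X n - X j \<le> (real n - real j) * c + G" by blast
          then show ?thesis using le by (intro disjI2 exI[of _ j]) (auto simp: algebra_simps)
        qed
      next
        case True
        from IH show ?thesis
        proof
          assume "X n - X i \<le> (real n - real i) * c"
          moreover have "X (Suc n) - X n \<le> G" using bad[of n n] True nK by simp
          ultimately show ?thesis using True step c
            by (intro disjI2 exI[of _ n]) (auto simp: algebra_simps)
        next
          assume "\<exists>j. i \<le> j \<and> j < n \<and> X j - X i \<le> (real j - real i) * c \<and> X (Suc j) - X j > c \<and>
            X n - X j \<le> (real n - real j) * c + G"
          then obtain j where j: "i \<le> j" "j < n" "X j - X i \<le> (real j - real i) * c" "X (Suc j) - X j > c" by blast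
          have "X (Suc n) - X j \<le> G" using bad[of j n] j True nK by simp
          moreover have "0 \<le> (real (Suc n) - real j) * c" using j c by simp
          ultimately show ?thesis using j by (intro disjI2 exI[of _ j]) auto
        qed
      qed
    qed
  qed (use c in auto)
  from this[OF i(1)] i(2) have "?P i'" by blast
  then show ?thesis
  proof
    assume "\<exists>j. i \<le> j \<and> j < i' \<and> X j - X i \<le> (real j - real i) * c \<and> X (Suc j) - X j > c \<and>
        X i' - X j \<le> (real i' - real j) * c + G"
    then show ?thesis by (auto simp: algebra_simps)
  qed (use c in auto)
qed

text \<open>
  The starting points of the blocks of length \<open>L\<close> are rounded to a grid of the even spacing \<open>2 * g\<close>.
  Its points have the parity of the walk from \<open>y\<close> at time \<open>i * L\<close>, as \<open>walk_mono\<close> requires.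
\<close>

definition grid_point :: "int \<Rightarrow> nat \<Rightarrow> nat \<Rightarrow> nat \<Rightarrow> int \<Rightarrow> int" where
  "grid_point y L g i z = y + int (i * L) + 2 * int g * z"

definition fast :: "(nat \<Rightarrow> int \<Rightarrow> bool) \<Rightarrow> nat \<Rightarrow> real \<Rightarrow> nat \<Rightarrow> int \<Rightarrow> bool" where
  "fast f L w t u \<longleftrightarrow> real_of_int (walk f t u L - u) \<ge> w * real L"

text \<open>
  A walk from \<open>y\<close> is at most at \<open>y + i * L\<close> at time \<open>i * L\<close>, so rounding up never leads to \<open>z > 0\<close>.
\<close>

definition grid_range :: "nat \<Rightarrow> nat \<Rightarrow> nat \<Rightarrow> int set" where
  "grid_range K L g = {- int (K * L div g + 1)..0}"

text \<open>
  The walk from the grid point next to the right never gets to the left of the given walk, and its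
  head start is less than \<open>2 * g\<close>. Thus it is fast too, and the random starting point of
  the block is replaced by one of finitely many fixed ones.
\<close>

lemma fast_from_grid:
  fixes f :: "nat \<Rightarrow> int \<Rightarrow> bool" and y :: int and L g :: nat and w :: real
  defines "X \<equiv> \<lambda>i. walk f 0 y (i * L)"
  assumes "0 < g" "i < K"
    and big: "real_of_int (X (Suc i)) - X i > w * L + 2 * g"
  obtains z where "z \<in> grid_range K L g" "fast f L w (i * L) (grid_point y L g i z)"
    "X i \<le> grid_point y L g i z" "grid_point y L g i z < X i + 2 * int g"
proof -
  have "even (X i - y - int (i * L))" unfolding X_def by (rule walk_parity)
  then obtain b where b: "X i - y - int (i * L) = 2 * b" by (elim evenE)
  have Xr: "\<bar>X i - y\<bar> \<le> int (i * L)" unfolding X_def by (rule walk_range)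
  have b_range: "b \<le> 0" "- int (K * L) \<le> b"
  proof -
    show "b \<le> 0" using b Xr by linarith
    have "int (i * L) \<le> int (K * L)" using assms by (intro of_nat_mono mult_le_mono1) simp
    then show "- int (K * L) \<le> b" using b Xr by linarith
  qed
  \<comment> \<open>division rounds down, so the two signs make it round up\<close>
  define z where "z = - ((- b) div int g)"
  have gz: "b \<le> int g * z" "int g * z < b + int g"
  proof -
    have e: "- b = int g * ((- b) div int g) + (- b) mod int g" by simp
    have "0 \<le> (- b) mod int g" "(- b) mod int g < int g" using assms by auto
    then show "b \<le> int g * z" "int g * z < b + int g" using e unfolding z_def mult_minus_right by linarith+
  qed
  let ?u = "grid_point y L g i z"
  have u: "X i \<le> ?u" "?u < X i + 2 * int g" "even (?u - X i)"
    using gz b unfolding grid_point_def by (auto simp: algebra_simps)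
  have "X (Suc i) = walk f (i * L) (X i) L"
    unfolding X_def using walk_add[of f 0 y "i * L" L] by (simp add: add.commute)
  also have "\<dots> \<le> walk f (i * L) ?u L" by (rule walk_mono) (use u in auto)
  finally have "real_of_int (walk f (i * L) ?u L) \<ge> real_of_int (X (Suc i))" by simp
  moreover have "real_of_int ?u < X i + 2 * real g" using u(2) by linarith
  ultimately have "fast f L w (i * L) ?u" unfolding fast_def using big by simp
  moreover have "z \<in> grid_range K L g"
  proof -
    have "0 \<le> (-b) div int g" using b_range assms by (simp add: pos_imp_zdiv_nonneg_iff)
    moreover have "(-b) div int g \<le> int (K * L) div int g" using b_range assms
      by (intro zdiv_mono1) auto
    ultimately show ?thesis unfolding grid_range_def z_def by (simp add: zdiv_int)
  qed
  ultimately show thesis using that u by blast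
qed

text \<open>
  The top of the tube is the line of slope \<open>w\<close> raised by \<open>8 * L\<close>. This is the lowest point on or above it
  that has the parity of the walk.
\<close>

definition tube_point :: "int \<Rightarrow> nat \<Rightarrow> real \<Rightarrow> nat \<Rightarrow> int" where
  "tube_point y L w i = y + int (i * L) + 2 * \<lceil>(real i * w * real L + 8 * real L - real (i * L)) / 2\<rceil>"

lemma tube_point_bounds:
  "real_of_int (tube_point y L w i) \<ge> real_of_int y + real i * w * real L + 8 * real L"
  "real_of_int (tube_point y L w i) \<le> real_of_int y + real i * w * real L + 8 * real L + 2"
proof -
  define r where "r = (real i * w * real L + 8 * real L - real (i * L)) / 2"
  have r: "r \<le> \<lceil>r\<rceil>" "\<lceil>r\<rceil> \<le> r + 1" by linarith+
  have u: "real_of_int (tube_point y L w i) = y + real (i * L) + 2 * \<lceil>r\<rceil>"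
    unfolding tube_point_def r_def by simp
  have e: "2 * r = real i * w * real L + 8 * real L - real (i * L)" unfolding r_def by simp
  show "real_of_int (tube_point y L w i) \<ge> real_of_int y + real i * w * real L + 8 * real L"
    using r u e by linarith
  show "real_of_int (tube_point y L w i) \<le> real_of_int y + real i * w * real L + 8 * real L + 2"
    using r u e by linarith
qed

abbreviation far_apart_fast :: "(nat \<Rightarrow> int \<Rightarrow> bool) \<Rightarrow> int \<Rightarrow> nat \<Rightarrow> nat \<Rightarrow> nat \<Rightarrow> real \<Rightarrow> bool" where
  "far_apart_fast f y K L g w \<equiv> \<exists>i<K. \<exists>i'<K. \<exists>z\<in>grid_range K L g. \<exists>z'\<in>grid_range K L g.
    \<bar>grid_point y L g i z - grid_point y L g i' z'\<bar> > 5 * int L \<and>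
    fast f L w (i * L) (grid_point y L g i z) \<and> fast f L w (i' * L) (grid_point y L g i' z')"

abbreviation climbs :: "(nat \<Rightarrow> int \<Rightarrow> bool) \<Rightarrow> int \<Rightarrow> nat \<Rightarrow> real \<Rightarrow> nat \<Rightarrow> nat \<Rightarrow> nat \<Rightarrow> bool" where
  "climbs f y L w h s J \<equiv>
    \<forall>j<J. walk f (j * s * L) (tube_point y L w (j * s)) (h * L) > tube_point y L w (j * s)"

text \<open>
  If the starting points of the fast blocks are within \<open>5 * L\<close> of each other, then the walk gains at
  most \<open>7 * L\<close> from the beginning of its first to the end of its last fast block. So it never gets
  higher than \<open>8 * L\<close> above the line of slope \<open>w\<close>. Since it ends near that line, it was never lower than
  \<open>9 * L\<close> below it. The walks from the tube points do not start to the left of it, and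
  so they stay on its right or join it; after
  \<open>h\<close> blocks the line has risen by \<open>20 * L\<close>, which exceeds the width of the tube.
\<close>

lemma fast_walk_dichotomy:
  fixes y :: int and K L g h s J :: nat and w :: real
  assumes K: "0 < K" and g: "0 < g" "2 * K * g \<le> L" and L: "3 \<le> L" and w: "0 < w" and h: "20 \<le> real h * w"
    and J: "\<And>j. j < J \<Longrightarrow> j * s + h \<le> K"
    and far: "real_of_int (walk f 0 y (K * L) - y) \<ge> (w - 1 / K) * real (K * L)"
  shows "(far_apart_fast f y K L g w)
       \<or> (climbs f y L w h s J)"
proof (cases "far_apart_fast f y K L g w")
  case True
  then show ?thesis by blast
next
  case close: False
  define X where "X i = walk f 0 y (i * L)" for i
  let ?c = "w * L + 2 * g"
  have gL: "2 * g \<le> L" using g K by (metis One_nat_def Suc_leI dual_order.trans le_add1 mult.commute mult.left_commute mult_le_mono1 nat_mult_1)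
  have step: "X (Suc i) \<le> X i + int L" for i
    unfolding X_def using walk_add[of f 0 y "i * L" L] walk_range[of f "i * L" "walk f 0 y (i*L)" L]
    by (simp add: add.commute)
  have gain: "real_of_int (X (Suc i)) - X j \<le> 7 * L"
    if "j \<le> i" "i < K" "real_of_int (X (Suc j)) - X j > ?c" "real_of_int (X (Suc i)) - X i > ?c" for i j
  proof -
    from fast_from_grid[OF g(1), of j K w L f y] that obtain z where
      z: "z \<in> grid_range K L g" "fast f L w (j * L) (grid_point y L g j z)"
      "grid_point y L g j z < X j + 2 * int g" unfolding X_def by auto
    from fast_from_grid[OF g(1), of i K w L f y] that obtain z' where
      z': "z' \<in> grid_range K L g" "fast f L w (i * L) (grid_point y L g i z')"
      "X i \<le> grid_point y L g i z'" unfolding X_def by auto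
    have "\<not> \<bar>grid_point y L g j z - grid_point y L g i z'\<bar> > 5 * int L"
      using close z z' that by (meson le_less_trans)
    then have "X (Suc i) - X j \<le> 7 * int L" using z z' step[of i] gL by linarith
    then show ?thesis by linarith
  qed
  have incr: "real_of_int (X i') - X i \<le> (real i' - real i) * ?c + 7 * L" if "i \<le> i'" "i' \<le> K" for i i'
    by (rule increment_bound[where X="\<lambda>i. real_of_int (X i)" and K=K]) (use that w gain in auto)
  have Kg: "2 * real K * real g \<le> L" using g(2) by (metis of_nat_le_iff of_nat_mult of_nat_numeral)
  have slack: "r * ?c \<le> r * w * L + L" if "0 \<le> r" "r \<le> real K" for r :: real
  proof -
    have "r * (2 * real g) \<le> real K * (2 * real g)" using that by (intro mult_right_mono) auto
    then show ?thesis using Kg by (simp add: algebra_simps)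
  qed
  have X0: "X 0 = y" unfolding X_def by simp
  have upper: "real_of_int (X i) \<le> real_of_int y + real i * w * real L + 8 * real L" if "i \<le> K" for i
    using incr[of 0 i] slack[of "real i"] that X0 by simp
  have XK: "real_of_int (X K) \<ge> y + real K * w * L - L"
  proof -
    have "(w - 1 / K) * real (K * L) = real K * w * L - L" using K by (simp add: field_simps)
    then show ?thesis using far unfolding X_def by simp
  qed
  have lower: "real_of_int (X i) \<ge> y + real i * w * L - 9 * L" if "i \<le> K" for i
    using incr[of i K] slack[of "real K - real i"] that XK by (simp add: algebra_simps)
  have "climbs f y L w h s J"
  proof (intro allI impI)
    fix j assume j: "j < J"
    define i where "i = j * s"
    have ih: "i + h \<le> K" using J[OF j] unfolding i_def .
    let ?u = "tube_point y L w i"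
    have "X i \<le> ?u" using upper[of i] tube_point_bounds(1)[of y i w L] ih by linarith
    moreover have "even (?u - X i)"
      using walk_parity[of f 0 y "i * L"] unfolding X_def tube_point_def
      by (simp add: algebra_simps)
    ultimately have "walk f (i * L) (X i) (h * L) \<le> walk f (i * L) ?u (h * L)" by (intro walk_mono)
    moreover have "walk f (i * L) (X i) (h * L) = X (i + h)"
      unfolding X_def using walk_add[of f 0 y "i * L" "h * L"] by (simp add: algebra_simps)
    ultimately have "walk f (i * L) ?u (h * L) \<ge> X (i + h)" by simp
    moreover have "real_of_int (X (i + h)) > ?u"
    proof -
      have "20 * real L \<le> real h * w * L" using h by (intro mult_right_mono) auto
      then have "real_of_int (X (i + h)) \<ge> y + real i * w * L + 11 * L"
        using lower[OF ih] by (simp add: algebra_simps)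
      moreover have "real_of_int ?u \<le> real_of_int y + real i * w * real L + 8 * real L + 2" using tube_point_bounds(2)[of y L w i] by simp
      ultimately show ?thesis using L by linarith
    qed
    ultimately show "walk f (j * s * L) (tube_point y L w (j * s)) (h * L) > tube_point y L w (j * s)"
      unfolding i_def by linarith
  qed
  then show ?thesis by blast
qed

section \<open>Independent Bernoulli coordinates\<close>

definition depends_on :: "'i set \<Rightarrow> (('i \<Rightarrow> bool) \<Rightarrow> bool) \<Rightarrow> bool" where
  "depends_on J E \<longleftrightarrow> (\<forall>a b. (\<forall>i\<in>J. a i = b i) \<longrightarrow> E a = E b)"

lemma depends_onI: "(\<And>a b. (\<And>i. i \<in> J \<Longrightarrow> a i = b i) \<Longrightarrow> E a = E b) \<Longrightarrow> depends_on J E"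
  unfolding depends_on_def by blast

lemma depends_onD: "depends_on J E \<Longrightarrow> (\<And>i. i \<in> J \<Longrightarrow> a i = b i) \<Longrightarrow> E a = E b"
  unfolding depends_on_def by blast

lemma depends_on_mono: "depends_on J E \<Longrightarrow> J \<subseteq> J' \<Longrightarrow> depends_on J' E"
  unfolding depends_on_def by blast

text \<open>
  Only the probabilities of finite patterns are prescribed, because they are what can be computed for
  the exclusion process. They determine the probability of each event that depends on finitely
  many coordinates, and such events are measurable.
\<close>

definition bernoulli_family :: "'a measure \<Rightarrow> 'i set \<Rightarrow> ('i \<Rightarrow> 'a \<Rightarrow> bool) \<Rightarrow> ('i \<Rightarrow> real) \<Rightarrow> bool" where
  "bernoulli_family M I X r \<longleftrightarrow>
    (\<forall>J v. finite J \<longrightarrow> J \<subseteq> I \<longrightarrow>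
      {\<omega>\<in>space M. \<forall>i\<in>J. X i \<omega> = v i} \<in> sets M \<and>
      measure M {\<omega>\<in>space M. \<forall>i\<in>J. X i \<omega> = v i} = (\<Prod>i\<in>J. if v i then r i else 1 - r i))"

lemma bernoulli_family_subset:
  assumes fam: "bernoulli_family M I X r" and sub: "I' \<subseteq> I"
  shows "bernoulli_family M I' X r"
  unfolding bernoulli_family_def
proof (intro allI impI)
  fix J v assume "finite J" "J \<subseteq> I'"
  with sub have "finite J" "J \<subseteq> I" by auto
  then show "{\<omega>\<in>space M. \<forall>i\<in>J. X i \<omega> = v i} \<in> sets M \<and>
      measure M {\<omega>\<in>space M. \<forall>i\<in>J. X i \<omega> = v i} = (\<Prod>i\<in>J. if v i then r i else 1 - r i)"
    by (rule fam[unfolded bernoulli_family_def, rule_format])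
qed

lemma (in prob_space) bernoulli_family_event:
  assumes fam: "bernoulli_family M I X r" and J: "finite J" "J \<subseteq> I" and E: "depends_on J E"
  shows "{\<omega>\<in>space M. E (\<lambda>i. X i \<omega>)} \<in> sets M"
    and "prob {\<omega>\<in>space M. E (\<lambda>i. X i \<omega>)} =
      (\<Sum>v\<in>{v\<in>J \<rightarrow>\<^sub>E UNIV. E v}. \<Prod>i\<in>J. if v i then r i else 1 - r i)"
proof -
  let ?P = "\<lambda>v. {\<omega>\<in>space M. \<forall>i\<in>J. X i \<omega> = v i}"
  let ?V = "{v\<in>J \<rightarrow>\<^sub>E (UNIV::bool set). E v}"
  have fin: "finite ?V" using J by (intro finite_subset[OF _ finite_PiE[of J "\<lambda>_. UNIV"]]) auto
  have sets: "?P v \<in> sets M" "prob (?P v) = (\<Prod>i\<in>J. if v i then r i else 1 - r i)" for v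
    using fam[unfolded bernoulli_family_def, rule_format, OF J, of v] by (rule conjunct1, rule conjunct2)
  have eq: "{\<omega>\<in>space M. E (\<lambda>i. X i \<omega>)} = (\<Union>v\<in>?V. ?P v)"
  proof (intro set_eqI iffI)
    fix \<omega> assume w: "\<omega> \<in> {\<omega>\<in>space M. E (\<lambda>i. X i \<omega>)}"
    define v where "v = (\<lambda>i\<in>J. X i \<omega>)"
    have "E v = E (\<lambda>i. X i \<omega>)" by (rule depends_onD[OF E]) (simp add: v_def)
    then have V: "v \<in> ?V" using w by (simp add: v_def)
    have "\<omega> \<in> ?P v" using w by (simp add: v_def)
    with V show "\<omega> \<in> (\<Union>v\<in>?V. ?P v)" by (rule UN_I[of v ?V \<omega> ?P])
  next
    fix \<omega> assume "\<omega> \<in> (\<Union>v\<in>?V. ?P v)"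
    then obtain v where v: "v \<in> ?V" "\<omega> \<in> ?P v" by blast
    have "E (\<lambda>i. X i \<omega>) = E v" by (rule depends_onD[OF E]) (use v in simp)
    then show "\<omega> \<in> {\<omega>\<in>space M. E (\<lambda>i. X i \<omega>)}" using v by simp
  qed
  show "{\<omega>\<in>space M. E (\<lambda>i. X i \<omega>)} \<in> sets M" unfolding eq using fin sets by auto
  have disj: "disjoint_family_on ?P ?V"
  proof (unfold disjoint_family_on_def, intro ballI impI)
    fix v v' assume vv: "v \<in> ?V" "v' \<in> ?V" "v \<noteq> v'"
    obtain i where i: "v i \<noteq> v' i" using vv(3) unfolding fun_eq_iff by blast
    have "i \<in> J"
    proof (rule ccontr)
      assume "i \<notin> J"
      then have "v i = undefined" "v' i = undefined" using vv by (auto intro: PiE_arb)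
      then show False using i by simp
    qed
    then show "?P v \<inter> ?P v' = {}" using i by blast
  qed
  show "prob {\<omega>\<in>space M. E (\<lambda>i. X i \<omega>)} = (\<Sum>v\<in>?V. \<Prod>i\<in>J. if v i then r i else 1 - r i)"
    unfolding eq using finite_measure_finite_Union[OF fin _ disj] sets by auto
qed

lemma bernoulli_family_same_law:
  assumes "prob_space M" "prob_space N" "bernoulli_family M I X r" "bernoulli_family N I Y r"
    and J: "finite J" "J \<subseteq> I" and E: "depends_on J E"
  shows "measure M {\<omega>\<in>space M. E (\<lambda>i. X i \<omega>)} = measure N {\<omega>\<in>space N. E (\<lambda>i. Y i \<omega>)}"
  using prob_space.bernoulli_family_event(2)[OF assms(1,3) J E]
    prob_space.bernoulli_family_event(2)[OF assms(2,4) J E] by simp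

text \<open>
  The coordinates of the product space: the initial occupation of \<open>x\<close>, whether the edge \<open>{x, x + 1}\<close>
  rings during the \<open>i\<close>th time cell, and the coin that the walk uses at \<open>x\<close> at time \<open>n\<close>.
\<close>

datatype coord = Init int | Clock nat int | Coin nat int

lemma finite_depends_on_sets:
  assumes "finite J" "depends_on J E"
  shows "{f \<in> J \<rightarrow>\<^sub>E (UNIV::bool set). E f} \<in> sets (PiM J (\<lambda>i. measure_pmf (\<mu> i)))"
proof -
  have "{f} \<in> sets (PiM J (\<lambda>i. measure_pmf (\<mu> i)))" if "f \<in> J \<rightarrow>\<^sub>E (UNIV::bool set)" for f
  proof -
    have "{f} = PiE J (\<lambda>i. {f i})" using that by (simp add: PiE_singleton PiE_iff)
    then show ?thesis using assms by (auto intro: sets_PiM_I_finite)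
  qed
  moreover have "{f \<in> J \<rightarrow>\<^sub>E (UNIV::bool set). E f} = (\<Union>f\<in>{f \<in> J \<rightarrow>\<^sub>E (UNIV::bool set). E f}. {f})" by blast
  moreover have "finite {f \<in> J \<rightarrow>\<^sub>E (UNIV::bool set). E f}"
    using assms by (intro finite_subset[OF _ finite_PiE[of J "\<lambda>_. UNIV"]]) auto
  ultimately show ?thesis
    using sets.finite_UN[of "{f \<in> J \<rightarrow>\<^sub>E (UNIV::bool set). E f}" "\<lambda>f. {f}" "PiM J (\<lambda>i. measure_pmf (\<mu> i))"] by simp
qed

text \<open>
  One unit of time consists of \<open>m\<close> cells.
\<close>

locale product_model =
  fixes q p :: real and m :: nat
  assumes q: "0 \<le> q" "q \<le> 1" and p: "0 \<le> p" "p \<le> 1" and m: "0 < m"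
begin

primrec weight :: "coord \<Rightarrow> real" where
  "weight (Init x) = 1 / 2"
| "weight (Clock i x) = q"
| "weight (Coin n x) = p"

lemma weight: "0 \<le> weight i" "weight i \<le> 1" using q p by (cases i; simp)+

definition \<Omega> :: "(coord \<Rightarrow> bool) measure" where
  "\<Omega> = (\<Pi>\<^sub>M i\<in>UNIV. measure_pmf (bernoulli_pmf (weight i)))"

sublocale P: product_prob_space "\<lambda>i. measure_pmf (bernoulli_pmf (weight i))" UNIV
  by unfold_locales

sublocale prob_space \<Omega> unfolding \<Omega>_def by (rule P.prob_space_axioms)

lemma space_\<Omega> [simp]: "space \<Omega> = UNIV"
  unfolding \<Omega>_def by (auto simp: space_PiM)

abbreviation Pr :: "((coord \<Rightarrow> bool) \<Rightarrow> bool) \<Rightarrow> real" where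
  "Pr E \<equiv> prob {a. E a}"

lemma coordinates_indep:
  "indep_vars (\<lambda>i. measure_pmf (bernoulli_pmf (weight i))) (\<lambda>i a. a i) UNIV"
proof -
  let ?\<mu> = "\<lambda>i. measure_pmf (bernoulli_pmf (weight i))"
  have meas: "(\<lambda>a. a i) \<in> measurable \<Omega> (?\<mu> i)" for i
    unfolding \<Omega>_def by (rule measurable_component_singleton) (rule UNIV_I)
  have "distr \<Omega> (PiM UNIV ?\<mu>) (\<lambda>a. \<lambda>i\<in>UNIV. a i) = \<Omega>"
    unfolding \<Omega>_def restrict_UNIV by (rule distr_id)
  also have "\<Omega> = (\<Pi>\<^sub>M i\<in>UNIV. distr \<Omega> (?\<mu> i) (\<lambda>a. a i))"
  proof -
    have "distr \<Omega> (?\<mu> i) (\<lambda>a. a i) = ?\<mu> i" for i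
      unfolding \<Omega>_def by (rule P.PiM_component) (rule UNIV_I)
    then show ?thesis by (simp only: \<Omega>_def)
  qed
  finally show ?thesis by (subst indep_vars_iff_distr_eq_PiM[OF UNIV_not_empty meas])
qed

lemma coordinates: "bernoulli_family \<Omega> UNIV (\<lambda>i a. a i) weight"
  unfolding bernoulli_family_def
proof (intro allI impI)
  fix J :: "coord set" and v assume J: "finite J"
  have eq: "{a\<in>space \<Omega>. \<forall>i\<in>J. a i = v i} = prod_emb UNIV (\<lambda>i. measure_pmf (bernoulli_pmf (weight i))) J (PiE J (\<lambda>i. {v i}))"
  proof (rule set_eqI)
    fix a
    have "a \<in> prod_emb UNIV (\<lambda>i. measure_pmf (bernoulli_pmf (weight i))) J (PiE J (\<lambda>i. {v i})) \<longleftrightarrow>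
        restrict a J \<in> PiE J (\<lambda>i. {v i})"
      unfolding prod_emb_def by (simp add: PiE_UNIV_domain)
    also have "\<dots> \<longleftrightarrow> (\<forall>i\<in>J. a i = v i)" by (simp add: restrict_PiE_iff Pi_iff)
    finally show "a \<in> {a\<in>space \<Omega>. \<forall>i\<in>J. a i = v i} \<longleftrightarrow>
        a \<in> prod_emb UNIV (\<lambda>i. measure_pmf (bernoulli_pmf (weight i))) J (PiE J (\<lambda>i. {v i}))"
      by (simp only: space_\<Omega> mem_Collect_eq UNIV_I simp_thms)
  qed
  have "prob {a\<in>space \<Omega>. \<forall>i\<in>J. a i = v i} = (\<Prod>i\<in>J. measure (measure_pmf (bernoulli_pmf (weight i))) {v i})"
    unfolding eq unfolding \<Omega>_def using J by (intro P.measure_PiM_emb) auto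
  also have "\<dots> = (\<Prod>i\<in>J. if v i then weight i else 1 - weight i)"
  proof (intro prod.cong refl)
    fix i
    show "measure (measure_pmf (bernoulli_pmf (weight i))) {v i} = (if v i then weight i else 1 - weight i)"
      using weight[of i] by (cases "v i") (simp_all add: measure_pmf_single)
  qed
  finally have "prob {a\<in>space \<Omega>. \<forall>i\<in>J. a i = v i} = (\<Prod>i\<in>J. if v i then weight i else 1 - weight i)" .
  moreover have "{a\<in>space \<Omega>. \<forall>i\<in>J. a i = v i} \<in> events"
    unfolding eq unfolding \<Omega>_def by (rule sets_PiM_I[OF J]) auto
  ultimately show "{a\<in>space \<Omega>. \<forall>i\<in>J. a i = v i} \<in> events \<and>
      prob {a\<in>space \<Omega>. \<forall>i\<in>J. a i = v i} = (\<Prod>i\<in>J. if v i then weight i else 1 - weight i)" by (intro conjI)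
qed

lemma depends_on_events:
  assumes "finite J" "depends_on J E"
  shows "{a. E a} \<in> events"
  using bernoulli_family_event(1)[OF coordinates assms(1) subset_UNIV assms(2)]
  unfolding space_\<Omega> by simp

text \<open>
  This is applied to configurations that are shifted in time or reflected, and to the one that is read
  off from the exclusion process.
\<close>

lemma Pr_transfer:
  assumes "prob_space M" "bernoulli_family M I X weight" "finite J" "J \<subseteq> I" "depends_on J E"
  shows "measure M {\<omega>\<in>space M. E (\<lambda>i. X i \<omega>)} = Pr E"
proof -
  have "bernoulli_family \<Omega> I (\<lambda>i a. a i) weight" by (rule bernoulli_family_subset[OF coordinates subset_UNIV])
  from bernoulli_family_same_law[OF assms(1) prob_space_axioms assms(2) this assms(3-5)] show ?thesis by simp
qed

lemma Pr_indep_family: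
  assumes L: "finite L" and J: "\<And>j. j \<in> L \<Longrightarrow> finite (J j)" "disjoint_family_on J L"
    and E: "\<And>j. j \<in> L \<Longrightarrow> depends_on (J j) (E j)"
  shows "Pr (\<lambda>a. \<forall>j\<in>L. E j a) = (\<Prod>j\<in>L. Pr (E j))"
proof (cases "L = {}")
  case True then show ?thesis using prob_space by simp
next
  case False
  let ?\<mu> = "\<lambda>i. measure_pmf (bernoulli_pmf (weight i))"
  let ?S = "\<lambda>j. {f \<in> J j \<rightarrow>\<^sub>E (UNIV::bool set). E j f}"
  have ind: "indep_vars (\<lambda>j. PiM (J j) ?\<mu>) (\<lambda>j a. restrict (\<lambda>i. a i) (J j)) L"
    by (rule indep_vars_restrict[OF coordinates_indep]) (use J in auto)
  have eq: "(\<lambda>a. restrict (\<lambda>i. a i) (J j)) -` ?S j \<inter> space \<Omega> = {a. E j a}" if "j \<in> L" for j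
  proof -
    have "E j (restrict a (J j)) = E j a" for a by (rule depends_onD[OF E[OF that]]) simp
    then show ?thesis by auto
  qed
  have "prob (\<Inter>j\<in>L. (\<lambda>a. restrict (\<lambda>i. a i) (J j)) -` ?S j \<inter> space \<Omega>)
      = (\<Prod>j\<in>L. prob ((\<lambda>a. restrict (\<lambda>i. a i) (J j)) -` ?S j \<inter> space \<Omega>))"
    using L False J E by (intro indep_varsD_finite[OF ind]) (auto intro!: finite_depends_on_sets)
  also have "(\<Inter>j\<in>L. (\<lambda>a. restrict (\<lambda>i. a i) (J j)) -` ?S j \<inter> space \<Omega>) = {a. \<forall>j\<in>L. E j a}"
    using eq by auto
  also have "(\<Prod>j\<in>L. prob ((\<lambda>a. restrict (\<lambda>i. a i) (J j)) -` ?S j \<inter> space \<Omega>)) = (\<Prod>j\<in>L. Pr (E j))"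
    using eq by (intro prod.cong) auto
  finally show ?thesis .
qed

lemma Pr_indep:
  assumes "finite J" "finite J'" "J \<inter> J' = {}" "depends_on J E" "depends_on J' E'"
  shows "Pr (\<lambda>a. E a \<and> E' a) = Pr E * Pr E'"
proof -
  let ?J = "\<lambda>b::nat. if b = 0 then J else J'" and ?E = "\<lambda>b::nat. if b = 0 then E else E'"
  have "Pr (\<lambda>a. \<forall>b\<in>{0, 1}. ?E b a) = (\<Prod>b\<in>{0, 1}. Pr (?E b))"
  proof (rule Pr_indep_family[of "{0, 1}" ?J ?E])
    show "disjoint_family_on ?J {0, 1}" using assms(3) by (simp add: disjoint_family_on_def Int_commute)
  qed (use assms in auto)
  then show ?thesis by simp
qed

end

section \<open>Stirring in discrete time\<close>

text \<open>
  An edge is ignored in a cell in which a neighbouring edge rings as well. So the swaps of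
  one cell concern disjoint pairs of sites and \<open>stir\<close> is a bijection, which is what makes the fair
  product measure stationary. In short cells such coincidences are rare.
\<close>

definition swaps :: "(coord \<Rightarrow> bool) \<Rightarrow> nat \<Rightarrow> int \<Rightarrow> bool" where
  "swaps a i x \<longleftrightarrow> a (Clock i x) \<and> \<not> a (Clock i (x - 1)) \<and> \<not> a (Clock i (x + 1))"

definition stir :: "(coord \<Rightarrow> bool) \<Rightarrow> nat \<Rightarrow> int \<Rightarrow> int" where
  "stir a i x = (if swaps a i x then x + 1 else if swaps a i (x - 1) then x - 1 else x)"

text \<open>
  The present occupation of \<open>x\<close> after \<open>j\<close> cells is the initial occupation of \<open>origin a j x\<close>; the
  recursion follows it backwards in time, starting with the last cell.
\<close>

fun origin :: "(coord \<Rightarrow> bool) \<Rightarrow> nat \<Rightarrow> int \<Rightarrow> int" where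
  "origin a 0 x = x"
| "origin a (Suc j) x = origin a j (stir a j x)"

text \<open>
  The trace is stopped at distance \<open>R\<close> from \<open>c\<close>. It then reads only the clocks near \<open>c\<close>, and it agrees
  with \<open>origin\<close> unless it has been stopped.
\<close>

fun frozen_origin :: "int \<Rightarrow> int \<Rightarrow> (coord \<Rightarrow> bool) \<Rightarrow> nat \<Rightarrow> int \<Rightarrow> int" where
  "frozen_origin R c a 0 x = x"
| "frozen_origin R c a (Suc j) x = (if R \<le> \<bar>x - c\<bar> then x else frozen_origin R c a j (stir a j x))"

text \<open>
  With a coin of success probability \<open>p\<close> this is true with probability \<open>p\<close> at an occupied and with
  probability \<open>1 - p\<close> at an empty site.
\<close>

definition arrow :: "nat \<Rightarrow> (coord \<Rightarrow> bool) \<Rightarrow> nat \<Rightarrow> int \<Rightarrow> bool" where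
  "arrow m a n x \<longleftrightarrow> a (Init (origin a (m * n) x)) = a (Coin n x)"

definition local_arrow :: "int \<Rightarrow> nat \<Rightarrow> (coord \<Rightarrow> bool) \<Rightarrow> nat \<Rightarrow> int \<Rightarrow> bool" where
  "local_arrow R m a n x \<longleftrightarrow> a (Init (frozen_origin R x a (m * n) x)) = a (Coin n x)"

lemma swaps_exclusive: "swaps a i x \<Longrightarrow> \<not> swaps a i (x - 1)"
  unfolding swaps_def by simp

lemma stir_involution: "stir a i (stir a i x) = x"
proof -
  consider (right) "swaps a i x" | (left) "\<not> swaps a i x" "swaps a i (x - 1)" | (stay) "\<not> swaps a i x" "\<not> swaps a i (x - 1)" by blast
  then show ?thesis
  proof cases
    case right
    then have "\<not> swaps a i (x + 1)" unfolding swaps_def by simp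
    with right show ?thesis by (simp add: stir_def)
  qed (simp_all add: stir_def)
qed

lemma origin_inj: "inj (origin a j)"
proof (induction j)
  case (Suc j)
  have "inj (stir a j)" by (rule inj_on_inverseI[where g="stir a j"]) (simp add: stir_involution)
  with Suc have "inj (origin a j \<circ> stir a j)" by (rule inj_compose)
  moreover have "origin a j \<circ> stir a j = origin a (Suc j)" by (rule ext) simp
  ultimately show ?case by (simp only:)
qed (simp add: inj_def)

lemma stir_range: "\<bar>stir a i x - x\<bar> \<le> 1"
  unfolding stir_def by auto

lemma origin_range: "\<bar>origin a j x - x\<bar> \<le> int j"
proof (induction j arbitrary: x)
  case (Suc j)
  show ?case using Suc[of "stir a j x"] stir_range[of a j x] by simp
qed simp

lemma frozen_origin_range: "\<bar>x - c\<bar> \<le> R \<Longrightarrow> \<bar>frozen_origin R c a j x - c\<bar> \<le> R"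
proof (induction j arbitrary: x)
  case (Suc j)
  show ?case using Suc.IH[of "stir a j x"] stir_range[of a j x] Suc.prems by auto
qed simp

lemma frozen_origin_eq: "\<bar>frozen_origin R c a j x - c\<bar> < R \<Longrightarrow> frozen_origin R c a j x = origin a j x"
  by (induction j arbitrary: x) (auto split: if_splits)

lemma stir_cong:
  assumes "\<And>z. \<bar>z - x\<bar> \<le> 2 \<Longrightarrow> a (Clock i z) = b (Clock i z)"
  shows "stir a i x = stir b i x"
  unfolding stir_def swaps_def by (simp add: assms)

lemma origin_cong:
  assumes "\<And>i z. i < j \<Longrightarrow> \<bar>z - x\<bar> \<le> int j + 1 \<Longrightarrow> a (Clock i z) = b (Clock i z)"
  shows "origin a j x = origin b j x"
  using assms
proof (induction j arbitrary: x)
  case (Suc j)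
  have s: "stir a j x = stir b j x" by (rule stir_cong) (rule Suc.prems, auto)
  have "origin a j (stir a j x) = origin b j (stir a j x)"
  proof (rule Suc.IH)
    fix i z assume "i < j" "\<bar>z - stir a j x\<bar> \<le> int j + 1"
    then show "a (Clock i z) = b (Clock i z)"
      using stir_range[of a j x] by (intro Suc.prems) auto
  qed
  then show ?case by (simp add: s)
qed simp

lemma frozen_origin_cong:
  assumes "\<And>i z. i < j \<Longrightarrow> \<bar>z - c\<bar> \<le> R + 1 \<Longrightarrow> a (Clock i z) = b (Clock i z)"
  shows "frozen_origin R c a j x = frozen_origin R c b j x"
  using assms
proof (induction j arbitrary: x)
  case (Suc j)
  have "frozen_origin R c a j z = frozen_origin R c b j z" for z
    by (rule Suc.IH) (rule Suc.prems, auto)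
  moreover have "stir a j x = stir b j x" if "\<bar>x - c\<bar> < R"
    by (rule stir_cong) (rule Suc.prems, use that in auto)
  ultimately show ?case by auto
qed simp

text \<open>
  All coordinates that walks near \<open>y\<close> can depend on before the cell number \<open>H\<close>. One bound \<open>H\<close>
  serves for the cells and for the coins, because time \<open>n\<close> is at most the cell number \<open>m * n\<close>.
\<close>

definition coords_near :: "int \<Rightarrow> int \<Rightarrow> nat \<Rightarrow> coord set" where
  "coords_near y B H = Init ` {y - B..y + B} \<union> (\<lambda>(i, x). Clock i x) ` ({..<H} \<times> {y - B..y + B})
    \<union> (\<lambda>(n, x). Coin n x) ` ({..<H} \<times> {y - B..y + B})"

lemma finite_coords_near [simp]: "finite (coords_near y B H)"
  unfolding coords_near_def by auto

lemma coords_near_iff [simp]: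
  "Init x \<in> coords_near y B H \<longleftrightarrow> \<bar>x - y\<bar> \<le> B"
  "Clock i x \<in> coords_near y B H \<longleftrightarrow> i < H \<and> \<bar>x - y\<bar> \<le> B"
  "Coin n x \<in> coords_near y B H \<longleftrightarrow> n < H \<and> \<bar>x - y\<bar> \<le> B"
  unfolding coords_near_def by (auto simp: image_iff)

lemma coords_near_disjoint:
  assumes "B + B' < \<bar>y - y'\<bar>"
  shows "coords_near y B H \<inter> coords_near y' B' H' = {}"
proof (rule equals0I)
  fix i assume "i \<in> coords_near y B H \<inter> coords_near y' B' H'"
  then show False using assms by (cases i) auto
qed

lemma arrow_walk_cong:
  assumes ab: "\<And>i. i \<in> coords_near y (int (k + m * (t + k) + 1)) (m * (t + k)) \<Longrightarrow> a i = b i" and m: "0 < m" and l: "l \<le> k"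
  shows "walk (arrow m a) t y l = walk (arrow m b) t y l"
proof (rule walk_cong)
  fix n x assume n: "n < t + l" and x: "\<bar>x - y\<bar> \<le> int l"
  have mn: "m * n + 1 \<le> m * (t + k)"
  proof -
    have "m * Suc n \<le> m * (t + k)" using n l by (intro mult_le_mono2) simp
    then show ?thesis using m by simp
  qed
  have "1 * n \<le> m * n" using m by (intro mult_le_mono1) simp
  then have n': "n < m * (t + k)" using mn by linarith
  have mn': "int (m * n) + 1 \<le> int (m * (t + k))" and xk: "\<bar>x - y\<bar> \<le> int k" using mn x l by linarith+
  have o: "origin a (m * n) x = origin b (m * n) x"
  proof (rule origin_cong)
    fix i z assume "i < m * n" "\<bar>z - x\<bar> \<le> int (m * n) + 1"
    then show "a (Clock i z) = b (Clock i z)" using mn mn' xk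
      by (intro ab, unfold coords_near_iff) linarith
  qed
  have "a (Init (origin b (m * n) x)) = b (Init (origin b (m * n) x))"
    using origin_range[of b "m * n" x] mn' xk by (intro ab, unfold coords_near_iff) linarith
  moreover have "a (Coin n x) = b (Coin n x)" using n' xk
    by (intro ab, unfold coords_near_iff) linarith
  ultimately show "arrow m a n x = arrow m b n x" unfolding arrow_def o by simp
qed

lemma local_arrow_walk_cong:
  assumes ab: "\<And>i. i \<in> coords_near y (int k + R + 1) (m * (t + k)) \<Longrightarrow> a i = b i" and m: "0 < m" and R: "0 \<le> R"
  shows "walk (local_arrow R m a) t y k = walk (local_arrow R m b) t y k"
proof (rule walk_cong)
  fix n x assume n: "n < t + k" and x: "\<bar>x - y\<bar> \<le> int k"
  have mn: "m * n < m * (t + k)" using n m by simp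
  have "1 * n \<le> m * n" using m by (intro mult_le_mono1) simp
  then have n': "n < m * (t + k)" using mn by linarith
  have o: "frozen_origin R x a (m * n) x = frozen_origin R x b (m * n) x"
  proof (rule frozen_origin_cong)
    fix i z assume "i < m * n" "\<bar>z - x\<bar> \<le> R + 1"
    then show "a (Clock i z) = b (Clock i z)" using mn x by (intro ab, unfold coords_near_iff) linarith
  qed
  have "a (Init (frozen_origin R x b (m * n) x)) = b (Init (frozen_origin R x b (m * n) x))"
    using frozen_origin_range[of x x R b "m * n"] x R by (intro ab, unfold coords_near_iff) linarith
  moreover have "a (Coin n x) = b (Coin n x)" using n' x R by (intro ab, unfold coords_near_iff) linarith
  ultimately show "local_arrow R m a n x = local_arrow R m b n x" unfolding local_arrow_def o by simp
qed

context product_model begin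

lemma Pr_reindex:
  assumes J: "finite J" "inj_on f J" and w: "\<And>i. i \<in> J \<Longrightarrow> weight (f i) = weight i"
  shows "Pr (\<lambda>a. \<forall>i\<in>J. a (f i) = v i) = (\<Prod>i\<in>J. if v i then weight i else 1 - weight i)"
proof -
  let ?u = "\<lambda>k. v (the_inv_into J f k)"
  have inv: "?u (f i) = v i" if "i \<in> J" for i using the_inv_into_f_f[OF J(2) that] by simp
  have "(\<forall>i\<in>J. a (f i) = v i) \<longleftrightarrow> (\<forall>k\<in>f ` J. a k = ?u k)" for a using inv by auto
  then have "Pr (\<lambda>a. \<forall>i\<in>J. a (f i) = v i) = prob {a\<in>space \<Omega>. \<forall>k\<in>f ` J. a k = ?u k}"
    unfolding space_\<Omega> by simp
  also have "\<dots> = (\<Prod>k\<in>f ` J. if ?u k then weight k else 1 - weight k)"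
    using coordinates[unfolded bernoulli_family_def, rule_format, OF finite_imageI[OF J(1)] subset_UNIV] by (rule conjunct2)
  also have "\<dots> = (\<Prod>i\<in>J. if v i then weight i else 1 - weight i)"
    unfolding prod.reindex[OF J(2)] by (intro prod.cong refl) (simp add: inv w)
  finally show ?thesis .
qed

definition stir_rate :: real where "stir_rate = q * (1 - q)\<^sup>2"

lemma stir_rate: "0 \<le> stir_rate" "stir_rate \<le> q"
proof -
  have "0 \<le> (1 - q)\<^sup>2" "(1 - q)\<^sup>2 \<le> 1" using q by (auto simp: power_le_one)
  then show "0 \<le> stir_rate" "stir_rate \<le> q" unfolding stir_rate_def using q mult_left_le by auto
qed

lemma Pr_swaps: "Pr (\<lambda>a. swaps a i x) = stir_rate"
proof -
  let ?J = "{Clock i x, Clock i (x - 1), Clock i (x + 1)}"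
  have "swaps a i x \<longleftrightarrow> (\<forall>k\<in>?J. a k = (k = Clock i x))" for a unfolding swaps_def by auto
  then have "Pr (\<lambda>a. swaps a i x) = Pr (\<lambda>a. \<forall>k\<in>?J. a (id k) = (k = Clock i x))" by simp
  also have "\<dots> = (\<Prod>k\<in>?J. if k = Clock i x then weight k else 1 - weight k)"
    by (rule Pr_reindex) auto
  also have "\<dots> = stir_rate" by (simp add: stir_rate_def power2_eq_square)
  finally show ?thesis .
qed

end

section \<open>The origins of the occupations are diffusive\<close>

lemma depends_on_not: "depends_on J E \<Longrightarrow> depends_on J (\<lambda>a. \<not> E a)"
  unfolding depends_on_def by (intro allI impI arg_cong[where f=Not]) blast

lemma depends_on_conj:
  assumes "depends_on J E" "depends_on J F"
  shows "depends_on J (\<lambda>a. E a \<and> F a)"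
proof (rule depends_onI)
  fix a b :: "'a \<Rightarrow> bool" assume "\<And>i. i \<in> J \<Longrightarrow> a i = b i"
  then have "E a = E b" "F a = F b" using assms by (simp_all add: depends_on_def)
  then show "(E a \<and> F a) = (E b \<and> F b)" by simp
qed

lemma depends_on_disj:
  assumes "depends_on J E" "depends_on J F"
  shows "depends_on J (\<lambda>a. E a \<or> F a)"
  using depends_on_not[OF depends_on_conj[OF assms[THEN depends_on_not]]] by simp

lemma swaps_depends: "depends_on ((\<lambda>z. Clock i z) ` {x - 1..x + 1}) (\<lambda>a. swaps a i x)"
  by (rule depends_onI) (simp add: swaps_def)

definition escapes :: "int \<Rightarrow> int \<Rightarrow> nat \<Rightarrow> int \<Rightarrow> (coord \<Rightarrow> bool) \<Rightarrow> bool" where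
  "escapes R c j x a \<longleftrightarrow> R \<le> \<bar>frozen_origin R c a j x - c\<bar>"

definition clocks_near :: "int \<Rightarrow> int \<Rightarrow> nat \<Rightarrow> coord set" where
  "clocks_near c B j = (\<lambda>(i, z). Clock i z) ` ({..<j} \<times> {c - B..c + B})"

lemma clocks_near_iff: "k \<in> clocks_near c B j \<longleftrightarrow> (\<exists>i z. k = Clock i z \<and> i < j \<and> \<bar>z - c\<bar> \<le> B)"
  unfolding clocks_near_def by (auto simp: image_iff)

lemma finite_clocks_near: "finite (clocks_near c B j)"
  unfolding clocks_near_def by auto

lemma escapes_depends: "depends_on (clocks_near c (R + 1) j) (escapes R c j x)"
proof (rule depends_onI)
  fix a b :: "coord \<Rightarrow> bool" assume ab: "\<And>i. i \<in> clocks_near c (R + 1) j \<Longrightarrow> a i = b i"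
  have "frozen_origin R c a j x = frozen_origin R c b j x"
    by (rule frozen_origin_cong) (rule ab, auto simp: clocks_near_iff)
  then show "escapes R c j x a = escapes R c j x b" unfolding escapes_def by simp
qed

abbreviation reads :: "nat \<Rightarrow> nat \<Rightarrow> (nat \<Rightarrow> int) \<Rightarrow> (nat \<Rightarrow> bool) \<Rightarrow> (coord \<Rightarrow> bool) \<Rightarrow> bool" where
  "reads m n \<pi> v a \<equiv> \<forall>k<n. a (Init (origin a (m * k) (\<pi> k))) = v k"

definition environment_window :: "nat \<Rightarrow> nat \<Rightarrow> coord set" where
  "environment_window m n = Init ` {- int (n + m * n)..int (n + m * n)}
    \<union> clocks_near 0 (int (n + m * n + 1)) (m * n)"

lemma finite_environment_window: "finite (environment_window m n)"
  unfolding environment_window_def using finite_clocks_near by simp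

lemma environment_depends:
  assumes \<pi>: "\<And>k. k < n \<Longrightarrow> \<bar>\<pi> k\<bar> \<le> int n"
  shows "depends_on (environment_window m n) (\<lambda>a. reads m n \<pi> v a)"
proof (rule depends_onI)
  fix a b :: "coord \<Rightarrow> bool" assume ab: "\<And>i. i \<in> environment_window m n \<Longrightarrow> a i = b i"
  have "a (Init (origin a (m * k) (\<pi> k))) = b (Init (origin b (m * k) (\<pi> k)))" if k: "k < n" for k
  proof -
    have "m * k \<le> m * n" using k by simp
    then have mk: "int (m * k) \<le> int (m * n)" by (rule of_nat_mono)
    have o: "origin a (m * k) (\<pi> k) = origin b (m * k) (\<pi> k)"
    proof (rule origin_cong)
      fix i z assume i: "i < m * k" and z: "\<bar>z - \<pi> k\<bar> \<le> int (m * k) + 1"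
      have "i < m * n" using i \<open>m * k \<le> m * n\<close> by linarith
      moreover have "\<bar>z - 0\<bar> \<le> int (n + m * n + 1)" using z mk \<pi>[OF k] by linarith
      ultimately have "Clock i z \<in> clocks_near 0 (int (n + m * n + 1)) (m * n)" unfolding clocks_near_iff by blast
      then show "a (Clock i z) = b (Clock i z)" by (intro ab) (simp only: environment_window_def Un_iff simp_thms)
    qed
    have "\<bar>origin b (m * k) (\<pi> k)\<bar> \<le> int (n + m * n)" using origin_range[of b "m * k" "\<pi> k"] mk \<pi>[OF k] by linarith
    then have "Init (origin b (m * k) (\<pi> k)) \<in> environment_window m n" unfolding environment_window_def by (intro UnI1 imageI) auto
    then show ?thesis unfolding o by (rule ab)
  qed
  then show "(reads m n \<pi> v a) = (reads m n \<pi> v b)" by simp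
qed

context product_model begin

lemma Pr_disjoint_Un:
  assumes "{a. E a} \<in> events" "{a. F a} \<in> events" "\<And>a. \<not> (E a \<and> F a)"
  shows "Pr (\<lambda>a. E a \<or> F a) = Pr E + Pr F"
proof -
  have "{a. E a \<or> F a} = {a. E a} \<union> {a. F a}" by auto
  then show ?thesis using finite_measure_Union[OF assms(1,2)] assms(3) by auto
qed

lemma Pr_le1: "Pr E \<le> 1" by (rule prob_le_1)

text \<open>
  The most recent cell moves the trace by a symmetric step, independently of the earlier cells.
\<close>

lemma Pr_escapes_Suc:
  assumes "\<bar>x - c\<bar> < R"
  shows "Pr (escapes R c (Suc j) x) = stir_rate * Pr (escapes R c j (x + 1))
    + stir_rate * Pr (escapes R c j (x - 1)) + (1 - 2 * stir_rate) * Pr (escapes R c j x)"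
proof -
  let ?C = "(\<lambda>z. Clock j z) ` {x - 2..x + 1}"
  let ?R = "\<lambda>a. swaps a j x" and ?L = "\<lambda>a. swaps a j (x - 1)"
  let ?S = "\<lambda>a. \<not> swaps a j x \<and> \<not> swaps a j (x - 1)"
  have dR: "depends_on ?C ?R" by (rule depends_on_mono[OF swaps_depends]) auto
  have dL: "depends_on ?C ?L" by (rule depends_on_mono[OF swaps_depends]) auto
  have dS: "depends_on ?C ?S"
    by (intro depends_on_conj depends_on_not dR dL)
  have dRL: "depends_on ?C (\<lambda>a. ?R a \<or> ?L a)"
    by (rule depends_on_disj[OF dR dL])
  have finC: "finite ?C" by simp
  note ev = depends_on_events[OF finC]
  have excl: "\<not> (?R a \<and> ?L a)" for a using swaps_exclusive[of a j x] by blast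
  have RL: "Pr (\<lambda>a. ?R a \<or> ?L a) = 2 * stir_rate"
    using Pr_disjoint_Un[OF ev[OF dR] ev[OF dL] excl] Pr_swaps by simp
  have "Pr (\<lambda>a. (?R a \<or> ?L a) \<or> ?S a) = Pr (\<lambda>a. ?R a \<or> ?L a) + Pr ?S"
    by (rule Pr_disjoint_Un[OF ev[OF dRL] ev[OF dS]]) blast
  moreover have "{a. (?R a \<or> ?L a) \<or> ?S a} = space \<Omega>" by auto
  ultimately have PS: "Pr ?S = 1 - 2 * stir_rate" using RL prob_space by simp
  have split: "Pr (\<lambda>a. E a \<and> escapes R c j z a) = Pr E * Pr (escapes R c j z)" if "depends_on ?C E" for E z
    by (rule Pr_indep[OF finC finite_clocks_near _ that escapes_depends]) (auto simp: clocks_near_iff)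
  have fin2: "finite (?C \<union> clocks_near c (R + 1) j)" using finite_clocks_near by simp
  have dE: "depends_on (?C \<union> clocks_near c (R + 1) j) (\<lambda>a. E a \<and> escapes R c j z a)" if "depends_on ?C E" for E z
    by (rule depends_on_conj[OF depends_on_mono[OF that] depends_on_mono[OF escapes_depends]]) auto
  note ev2 = depends_on_events[OF fin2 dE]
  let ?e = "\<lambda>z. escapes R c j z"
  have dE2: "depends_on (?C \<union> clocks_near c (R + 1) j) (\<lambda>a. (?R a \<and> ?e (x + 1) a) \<or> (?L a \<and> ?e (x - 1) a))"
    by (rule depends_on_disj[OF dE[OF dR] dE[OF dL]])
  have step: "escapes R c (Suc j) x a \<longleftrightarrow> ((?R a \<and> ?e (x + 1) a) \<or> (?L a \<and> ?e (x - 1) a)) \<or> (?S a \<and> ?e x a)" for a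
  proof -
    have "escapes R c (Suc j) x a = ?e (stir a j x) a" using assms unfolding escapes_def by simp
    moreover have "?e (stir a j x) a \<longleftrightarrow> ((?R a \<and> ?e (x + 1) a) \<or> (?L a \<and> ?e (x - 1) a)) \<or> (?S a \<and> ?e x a)"
    proof (cases "?R a")
      case True
      then have "\<not> ?L a" "stir a j x = x + 1" using excl[of a] by (simp_all add: stir_def)
      with True show ?thesis by simp
    next
      case False
      then show ?thesis by (cases "?L a") (simp_all add: stir_def)
    qed
    ultimately show ?thesis by simp
  qed
  have "Pr (escapes R c (Suc j) x) = Pr (\<lambda>a. ((?R a \<and> ?e (x + 1) a) \<or> (?L a \<and> ?e (x - 1) a)) \<or> (?S a \<and> ?e x a))"
    by (simp only: step)
  also have "\<dots> = Pr (\<lambda>a. (?R a \<and> ?e (x + 1) a) \<or> (?L a \<and> ?e (x - 1) a)) + Pr (\<lambda>a. ?S a \<and> ?e x a)"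
    by (rule Pr_disjoint_Un[OF depends_on_events[OF fin2 dE2] ev2[OF dS]]) (rule notI, elim conjE disjE, simp_all)
  also have "Pr (\<lambda>a. (?R a \<and> ?e (x + 1) a) \<or> (?L a \<and> ?e (x - 1) a)) = Pr (\<lambda>a. ?R a \<and> ?e (x + 1) a) + Pr (\<lambda>a. ?L a \<and> ?e (x - 1) a)"
    by (rule Pr_disjoint_Un[OF ev2[OF dR] ev2[OF dL]]) (metis excl)
  finally show ?thesis
    by (simp only: split[OF dR, of "x + 1"] split[OF dL, of "x - 1"] split[OF dS, of x] PS Pr_swaps)
qed

text \<open>
  An exponential moment bound for the stopped random walk: in each step the expectation of
  \<open>cosh (l * (x - c))\<close> grows at most by the factor in front, and the function is at least
  \<open>cosh (l * R)\<close> where the trace stops. The stopping takes the place of a maximal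
  inequality.
\<close>

lemma Pr_escapes_cosh:
  assumes R: "0 \<le> R" and l: "0 \<le> l"
  shows "Pr (escapes R c j x) \<le> (1 + 2 * stir_rate * (cosh l - 1)) ^ j * cosh (l * real_of_int (x - c)) / cosh (l * real_of_int R)"
proof (induction j arbitrary: x)
  have out: "1 \<le> cosh (l * real_of_int (x - c)) / cosh (l * real_of_int R)" if "R \<le> \<bar>x - c\<bar>" for x
  proof -
    have "cosh (l * real_of_int R) \<le> cosh (l * real_of_int \<bar>x - c\<bar>)"
      using that R l by (subst cosh_real_nonneg_le_iff) (auto intro: mult_left_mono)
    also have "\<dots> = cosh (l * real_of_int (x - c))"
    proof -
      have "real_of_int \<bar>x - c\<bar> = real_of_int (x - c) \<or> real_of_int \<bar>x - c\<bar> = - real_of_int (x - c)" by linarith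
      then show ?thesis by (elim disjE) (simp_all only: mult_minus_right cosh_minus)
    qed
    finally show ?thesis by (simp add: cosh_real_pos)
  qed
  have cosh1: "1 \<le> cosh l" by (rule cosh_real_ge_1)
  {
    case 0
    show ?case
    proof (cases "R \<le> \<bar>x - c\<bar>")
      case True then show ?thesis using order.trans[OF Pr_le1[of "escapes R c 0 x"] out[OF True]] by simp
    next
      case False
      then have "{a. escapes R c 0 x a} = {}" by (simp add: escapes_def)
      then show ?thesis by (simp add: cosh_real_pos less_imp_le)
    qed
  next
    case (Suc j)
    let ?B = "1 + 2 * stir_rate * (cosh l - 1)"
    have B: "1 \<le> ?B" using cosh1 stir_rate by simp
    show ?case
    proof (cases "R \<le> \<bar>x - c\<bar>")
      case True
      have "Pr (escapes R c (Suc j) x) \<le> 1 * 1" using Pr_le1 by simp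
      also have "\<dots> \<le> ?B ^ Suc j * (cosh (l * real_of_int (x - c)) / cosh (l * real_of_int R))"
        using B out[OF True] by (intro mult_mono one_le_power) auto
      finally show ?thesis by simp
    next
      case False
      let ?z = "l * real_of_int (x - c)" and ?K = "?B ^ j / cosh (l * real_of_int R)"
      have r2: "0 \<le> 1 - 2 * stir_rate"
      proof -
        have "Pr (\<lambda>a. swaps a 0 1 \<or> swaps a 0 0) = Pr (\<lambda>a. swaps a 0 1) + Pr (\<lambda>a. swaps a 0 0)"
        proof (rule Pr_disjoint_Un)
          show "\<not> (swaps a 0 1 \<and> swaps a 0 0)" for a using swaps_exclusive[of a 0 1] by auto
        qed (rule depends_on_events[OF _ swaps_depends], simp)+
        then have "2 * stir_rate \<le> 1"
          unfolding Pr_swaps using Pr_le1[of "\<lambda>a. swaps a 0 1 \<or> swaps a 0 0"] by linarith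
        then show ?thesis by simp
      qed
      have e: "l * real_of_int (x + 1 - c) = ?z + l" "l * real_of_int (x - 1 - c) = ?z - l" by (simp_all add: algebra_simps)
      have "Pr (escapes R c (Suc j) x) = stir_rate * Pr (escapes R c j (x + 1))
        + stir_rate * Pr (escapes R c j (x - 1)) + (1 - 2 * stir_rate) * Pr (escapes R c j x)"
        by (rule Pr_escapes_Suc) (use False in simp)
      also have "\<dots> \<le> stir_rate * (?K * cosh (?z + l)) + stir_rate * (?K * cosh (?z - l)) + (1 - 2 * stir_rate) * (?K * cosh ?z)"
        using Suc[of "x + 1"] Suc[of "x - 1"] Suc[of x] stir_rate r2 unfolding e
        by (intro add_mono mult_left_mono) simp_all
      also have "\<dots> = ?K * cosh ?z * ?B"
      proof -
        have "r * (k * cosh (z + d)) + r * (k * cosh (z - d)) + (1 - 2 * r) * (k * cosh z)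
            = k * cosh z * (1 + 2 * r * (cosh d - 1))" for r k z d :: real
          unfolding cosh_add cosh_diff by (simp add: algebra_simps)
        then show ?thesis .
      qed
      finally show ?thesis by (simp add: ac_simps)
    qed
  }
qed

lemma cosh_le_quadratic:
  fixes l :: real
  assumes "0 \<le> l" "l \<le> 1"
  shows "cosh l - 1 \<le> l\<^sup>2"
proof -
  have "exp l \<le> 1 + l + l\<^sup>2" by (rule exp_bound) (use assms in auto)
  moreover have "exp (- l) \<le> 1 - l + l\<^sup>2"
  proof -
    have "exp (- l) \<le> 1 / (1 + l)" using exp_ge_add_one_self[of l] assms
      by (simp add: exp_minus field_simps)
    also have "\<dots> \<le> 1 - l + l\<^sup>2"
    proof -
      have "(1 - l + l\<^sup>2) * (1 + l) = 1 + l ^ 3" by (simp add: algebra_simps power2_eq_square power3_eq_cube)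
      then show ?thesis using assms by (simp add: divide_le_eq)
    qed
    finally show ?thesis .
  qed
  ultimately have "exp l + exp (- l) \<le> 2 + 2 * l\<^sup>2" by linarith
  then show ?thesis by (simp add: cosh_field_def field_simps)
qed

text \<open>
  The parameters \<open>q\<close> and \<open>m\<close> enter only through the bound \<open>g\<close> for the rate \<open>q * m\<close> per unit of time.
\<close>

lemma Pr_escapes:
  assumes R: "0 \<le> R" and l: "0 \<le> l" "l \<le> 1" and g: "q * real m \<le> g"
  shows "Pr (escapes R x (m * n) x) \<le> 2 * exp (2 * g * real n * l\<^sup>2 - l * real_of_int R)"
proof -
  have "Pr (escapes R x (m * n) x) \<le> (1 + 2 * stir_rate * (cosh l - 1)) ^ (m * n) / cosh (l * real_of_int R)"
    using Pr_escapes_cosh[OF R l(1), of x "m * n" x] by simp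
  also have "\<dots> \<le> exp (2 * g * real n * l\<^sup>2) / (exp (l * real_of_int R) / 2)"
  proof (intro frac_le)
    have c: "0 \<le> cosh l - 1" using cosh_real_ge_1[of l] by simp
    have "(1 + 2 * stir_rate * (cosh l - 1)) ^ (m * n) \<le> exp (2 * stir_rate * (cosh l - 1)) ^ (m * n)"
      using c stir_rate by (intro power_mono exp_ge_add_one_self) auto
    also have "\<dots> = exp (2 * stir_rate * (cosh l - 1) * (real m * real n))"
      by (simp add: exp_of_nat_mult[symmetric] mult.commute)
    also have "\<dots> \<le> exp (2 * g * real n * l\<^sup>2)"
    proof -
      have "stir_rate * (cosh l - 1) * (real m * real n) \<le> q * l\<^sup>2 * (real m * real n)"
        using c stir_rate q cosh_le_quadratic[OF l] by (intro mult_right_mono mult_mono) auto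
      also have "\<dots> = (q * real m) * (real n * l\<^sup>2)" by simp
      also have "\<dots> \<le> g * (real n * l\<^sup>2)" using g by (intro mult_right_mono) auto
      finally show ?thesis by simp
    qed
    finally show "(1 + 2 * stir_rate * (cosh l - 1)) ^ (m * n) \<le> exp (2 * g * real n * l\<^sup>2)" .
    show "exp (l * real_of_int R) / 2 \<le> cosh (l * real_of_int R)" by (simp add: cosh_def)
  qed simp_all
  also have "\<dots> = 2 * exp (2 * g * real n * l\<^sup>2 - l * real_of_int R)" by (simp add: exp_diff)
  finally show ?thesis .
qed

end

section \<open>Stationarity and reflection\<close>

definition rename :: "nat \<Rightarrow> (int \<Rightarrow> int) \<Rightarrow> coord \<Rightarrow> coord" where
  "rename m f i = (case i of Init x \<Rightarrow> Init (f x) | Clock j x \<Rightarrow> Clock (j + m) x | Coin n x \<Rightarrow> Coin (Suc n) x)"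

lemma rename_simps [simp]:
  "rename m f (Init x) = Init (f x)" "rename m f (Clock j x) = Clock (j + m) x" "rename m f (Coin n x) = Coin (Suc n) x"
  by (simp_all add: rename_def)

text \<open>
  The configuration that an observer sees who starts after one unit of time.
\<close>

definition shift :: "nat \<Rightarrow> (coord \<Rightarrow> bool) \<Rightarrow> coord \<Rightarrow> bool" where
  "shift m a i = a (rename m (origin a m) i)"

lemma stir_shift: "stir (shift m a) i x = stir a (i + m) x"
  unfolding stir_def swaps_def shift_def by simp

lemma origin_add: "origin a (j + m) x = origin a m (origin (shift m a) j x)"
  by (induction j arbitrary: x) (simp_all add: stir_shift)

lemma arrow_shift: "arrow m (shift m a) n x = arrow m a (Suc n) x"
  unfolding arrow_def using origin_add[of a "m * n" m x] by (simp add: shift_def add.commute)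

lemma walk_shift: "walk (arrow m (shift m a)) t y k = walk (arrow m a) (Suc t) y k"
  by (induction k) (simp_all add: arrow_shift)

definition mirror :: "int \<Rightarrow> coord \<Rightarrow> coord" where
  "mirror c i = (case i of Init x \<Rightarrow> Init (2 * c - x) | Clock j x \<Rightarrow> Clock j (2 * c - 1 - x) | Coin n x \<Rightarrow> Coin n (2 * c - x))"

lemma mirror_simps [simp]:
  "mirror c (Init x) = Init (2 * c - x)" "mirror c (Clock j x) = Clock j (2 * c - 1 - x)" "mirror c (Coin n x) = Coin n (2 * c - x)"
  by (simp_all add: mirror_def)

definition is_init :: "coord \<Rightarrow> bool" where "is_init i \<longleftrightarrow> (\<exists>x. i = Init x)"

lemma is_init_simps [simp]: "is_init (Init x)" "\<not> is_init (Clock j x)" "\<not> is_init (Coin n x)"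
  by (simp_all add: is_init_def)

text \<open>
  Space is reflected about \<open>c\<close>, and particles and holes are exchanged.
\<close>

definition reflect :: "int \<Rightarrow> (coord \<Rightarrow> bool) \<Rightarrow> coord \<Rightarrow> bool" where
  "reflect c a i = (a (mirror c i) \<noteq> is_init i)"

lemma swaps_reflect: "swaps (reflect c a) i x = swaps a i (2 * c - 1 - x)"
proof -
  have "2 * c - 1 - (x - 1) = 2 * c - 1 - x + 1" "2 * c - 1 - (x + 1) = 2 * c - 1 - x - 1" by simp_all
  then show ?thesis
    by (simp only: swaps_def reflect_def mirror_simps is_init_simps not_False_eq_True simp_thms) blast
qed

lemma stir_reflect: "stir (reflect c a) i x = 2 * c - stir a i (2 * c - x)"
proof -
  let ?z = "2 * c - x"
  have e: "2 * c - 1 - x = ?z - 1" "2 * c - 1 - (x - 1) = ?z" by simp_all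
  show ?thesis
  proof (cases "swaps a i ?z")
    case True
    then have "\<not> swaps a i (?z - 1)" by (rule swaps_exclusive)
    then show ?thesis using True unfolding stir_def swaps_reflect e by simp
  next
    case False
    then show ?thesis unfolding stir_def swaps_reflect e by simp
  qed
qed

lemma origin_reflect: "origin (reflect c a) j x = 2 * c - origin a j (2 * c - x)"
  by (induction j arbitrary: x) (simp_all add: stir_reflect)

lemma arrow_reflect: "arrow m (reflect c a) = (\<lambda>n x. \<not> arrow m a n (2 * c - x))"
  unfolding arrow_def by (intro ext) (simp add: origin_reflect, simp add: reflect_def, blast)

lemma walk_arrow_reflect: "walk (arrow m (reflect c a)) t y k = 2 * c - walk (arrow m a) t (2 * c - y) k"
  unfolding arrow_reflect by (rule walk_reflect)

context product_model begin

text \<open>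
  The exchange of particles and holes preserves the measure because the initial occupations have
  mean \<open>1 / 2\<close>.
\<close>

lemma reflect_family: "bernoulli_family \<Omega> UNIV (\<lambda>i a. reflect c a i) weight"
  unfolding bernoulli_family_def
proof (intro allI impI)
  fix J :: "coord set" and v assume J: "finite J"
  let ?v = "\<lambda>i. v i \<noteq> is_init i"
  have eq: "{a\<in>space \<Omega>. \<forall>i\<in>J. reflect c a i = v i} = {a. \<forall>i\<in>J. a (mirror c i) = ?v i}"
    unfolding reflect_def space_\<Omega> by auto
  have inj: "inj_on (mirror c) J"
  proof (rule inj_on_inverseI[where g="mirror c"])
    show "mirror c (mirror c i) = i" for i by (cases i) simp_all
  qed
  have "Pr (\<lambda>a. \<forall>i\<in>J. a (mirror c i) = ?v i) = (\<Prod>i\<in>J. if ?v i then weight i else 1 - weight i)"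
  proof (rule Pr_reindex[OF J inj])
    show "weight (mirror c i) = weight i" for i by (cases i) simp_all
  qed
  also have "\<dots> = (\<Prod>i\<in>J. if v i then weight i else 1 - weight i)"
  proof (rule prod.cong[OF refl])
    show "(if ?v i then weight i else 1 - weight i) = (if v i then weight i else 1 - weight i)" for i
      by (cases i) simp_all
  qed
  moreover have "{a. \<forall>i\<in>J. a (mirror c i) = ?v i} \<in> events"
    by (rule depends_on_events[of "mirror c ` J"]) (simp_all add: J depends_on_def)
  ultimately show "{a\<in>space \<Omega>. \<forall>i\<in>J. reflect c a i = v i} \<in> events \<and>
     prob {a\<in>space \<Omega>. \<forall>i\<in>J. reflect c a i = v i} = (\<Prod>i\<in>J. if v i then weight i else 1 - weight i)"
    unfolding eq by simp
qed

text \<open>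
  Stationarity of the environment. Given the first \<open>m\<close> cells, \<open>origin a m\<close> is a fixed
  injection, so the occupations after these cells are distinct initial occupations: they are
  independent, fair, and independent of all later clocks and coins. The proof sums over the
  finitely many values of this injection on the sites that occur in the pattern.
\<close>

lemma shift_family: "bernoulli_family \<Omega> UNIV (\<lambda>i a. shift m a i) weight"
  unfolding bernoulli_family_def
proof (intro allI impI)
  fix J :: "coord set" and v assume J: "finite J"
  define JI where "JI = {x. Init x \<in> J}"
  have "JI = Init -` J" unfolding JI_def by auto
  then have JI: "finite JI" using J by (simp add: finite_vimageI inj_def)
  \<comment> \<open>the possible restrictions of \<open>origin a m\<close> to \<open>JI\<close>\<close>
  define \<Phi> where "\<Phi> = PiE JI (\<lambda>x. {x - int m..x + int m})"
  have fin: "finite \<Phi>" unfolding \<Phi>_def using JI by (intro finite_PiE) auto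
  define A where "A f a \<longleftrightarrow> (\<forall>x\<in>JI. origin a m x = f x)" for f :: "int \<Rightarrow> int" and a
  define B where "B f a \<longleftrightarrow> (\<forall>i\<in>J. a (rename m f i) = v i)" for f :: "int \<Rightarrow> int" and a :: "coord \<Rightarrow> bool"
  define C where "C = (\<Union>x\<in>JI. clocks_near x (int m + 1) m)"
  have finC: "finite C" unfolding C_def using JI finite_clocks_near by auto
  define w where "w = (\<Prod>i\<in>J. if v i then weight i else 1 - weight i)"
  have dA: "depends_on C (A f)" for f
  proof (rule depends_onI)
    fix a b :: "coord \<Rightarrow> bool" assume ab: "\<And>i. i \<in> C \<Longrightarrow> a i = b i"
    have "origin a m x = origin b m x" if "x \<in> JI" for x
    proof (rule origin_cong)
      fix i z assume "i < m" "\<bar>z - x\<bar> \<le> int m + 1"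
      then have "Clock i z \<in> clocks_near x (int m + 1) m" unfolding clocks_near_iff by blast
      then show "a (Clock i z) = b (Clock i z)" using that by (intro ab) (auto simp: C_def)
    qed
    then show "A f a = A f b" unfolding A_def by simp
  qed
  have dB: "depends_on (rename m f ` J) (B f)" for f
    unfolding depends_on_def B_def by simp
  have disj: "C \<inter> rename m f ` J = {}" for f
  proof (rule equals0I)
    fix k assume k: "k \<in> C \<inter> rename m f ` J"
    then obtain i z where "k = Clock i z" "i < m" unfolding C_def by (auto simp: clocks_near_iff)
    moreover obtain l where "k = rename m f l" using k by auto
    ultimately show False by (cases l) auto
  qed
  have AB: "Pr (\<lambda>a. A f a \<and> B f a) = Pr (A f) * w" for f
  proof (cases "\<exists>a. A f a")
    case False
    then have "{a. A f a \<and> B f a} = {}" "{a. A f a} = {}" by auto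
    then show ?thesis by simp
  next
    case True
    then obtain a where a: "A f a" by blast
    have "f x \<noteq> f y" if "x \<in> JI" "y \<in> JI" "x \<noteq> y" for x y
      using a that origin_inj[of a m] unfolding A_def inj_def by metis
    then have "inj_on (rename m f) J"
      unfolding inj_on_def JI_def rename_def by (auto split: coord.splits)
    moreover have "weight (rename m f i) = weight i" for i by (cases i) simp_all
    ultimately have "Pr (B f) = w" unfolding B_def w_def using Pr_reindex[OF J] by simp
    moreover have "Pr (\<lambda>a. A f a \<and> B f a) = Pr (A f) * Pr (B f)"
      using J by (intro Pr_indep[OF finC _ disj dA dB]) simp
    ultimately show ?thesis by simp
  qed
  have evA: "{a. A f a} \<in> events" for f by (rule depends_on_events[OF finC dA])
  have evAB: "{a. A f a \<and> B f a} \<in> events" for f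
  proof (rule depends_on_events)
    show "depends_on (C \<union> rename m f ` J) (\<lambda>a. A f a \<and> B f a)"
      by (intro depends_on_conj depends_on_mono[OF dA] depends_on_mono[OF dB]) auto
  qed (use finC J in simp)
  have dfam: "disjoint_family_on (\<lambda>f. {a. A f a}) \<Phi>"
  proof (unfold disjoint_family_on_def, intro ballI impI)
    fix f g assume fg: "f \<in> \<Phi>" "g \<in> \<Phi>" "f \<noteq> g"
    show "{a. A f a} \<inter> {a. A g a} = {}"
    proof (rule equals0I)
      fix a assume "a \<in> {a. A f a} \<inter> {a. A g a}"
      then have "f x = g x" if "x \<in> JI" for x using that unfolding A_def by auto
      then have "f = g" using fg(1,2) unfolding \<Phi>_def by (auto intro: PiE_ext)
      then show False using fg(3) by simp
    qed
  qed
  have dfam': "disjoint_family_on (\<lambda>f. {a. A f a \<and> B f a}) \<Phi>"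
    using dfam unfolding disjoint_family_on_def by blast
  have witness: "restrict (origin a m) JI \<in> \<Phi>" "A (restrict (origin a m) JI) a" for a
    using origin_range[of a m] unfolding \<Phi>_def A_def by (auto simp: abs_le_iff algebra_simps)
  have "(\<Union>f\<in>\<Phi>. {a. A f a}) = space \<Omega>" using witness by auto
  then have one: "(\<Sum>f\<in>\<Phi>. Pr (A f)) = 1"
    using finite_measure_finite_Union[OF fin _ dfam] evA prob_space by auto
  have shift_B: "(\<forall>i\<in>J. shift m a i = v i) = B f a" if "A f a" for a f
  proof -
    have "rename m (origin a m) i = rename m f i" if "i \<in> J" for i
      using \<open>A f a\<close> that unfolding A_def JI_def by (cases i) simp_all
    then show ?thesis unfolding B_def shift_def by simp
  qed
  have eq: "{a\<in>space \<Omega>. \<forall>i\<in>J. shift m a i = v i} = (\<Union>f\<in>\<Phi>. {a. A f a \<and> B f a})"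
  proof (intro set_eqI iffI)
    fix a assume "a \<in> {a\<in>space \<Omega>. \<forall>i\<in>J. shift m a i = v i}"
    then have "B (restrict (origin a m) JI) a" using shift_B[OF witness(2)] by blast
    then show "a \<in> (\<Union>f\<in>\<Phi>. {a. A f a \<and> B f a})" using witness by blast
  next
    fix a assume "a \<in> (\<Union>f\<in>\<Phi>. {a. A f a \<and> B f a})"
    then show "a \<in> {a\<in>space \<Omega>. \<forall>i\<in>J. shift m a i = v i}" using shift_B by auto
  qed
  have "prob (\<Union>f\<in>\<Phi>. {a. A f a \<and> B f a}) = (\<Sum>f\<in>\<Phi>. Pr (\<lambda>a. A f a \<and> B f a))"
    using evAB by (intro finite_measure_finite_Union[OF fin _ dfam']) auto
  also have "\<dots> = w" unfolding AB sum_distrib_right[symmetric] one by simp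
  finally show "{a\<in>space \<Omega>. \<forall>i\<in>J. shift m a i = v i} \<in> events \<and>
     prob {a\<in>space \<Omega>. \<forall>i\<in>J. shift m a i = v i} = (\<Prod>i\<in>J. if v i then weight i else 1 - weight i)"
    unfolding eq w_def using fin evAB by auto
qed

lemma walk_depends:
  "depends_on (coords_near y (int (k + m * (t + k) + 1)) (m * (t + k))) (\<lambda>a. P (walk (arrow m a) t y k))"
proof (rule depends_onI)
  fix a b :: "coord \<Rightarrow> bool"
  assume ab: "\<And>i. i \<in> coords_near y (int (k + m * (t + k) + 1)) (m * (t + k)) \<Longrightarrow> a i = b i"
  show "P (walk (arrow m a) t y k) = P (walk (arrow m b) t y k)"
    using arrow_walk_cong[OF ab m le_refl] by simp
qed

lemma walk_stationary: "Pr (\<lambda>a. P (walk (arrow m a) t y k)) = Pr (\<lambda>a. P (walk (arrow m a) 0 y k))"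
proof (induction t)
  case (Suc t)
  have "Pr (\<lambda>a. P (walk (arrow m a) (Suc t) y k)) = prob {a\<in>space \<Omega>. P (walk (arrow m (\<lambda>i. shift m a i)) t y k)}"
    by (simp add: walk_shift)
  also have "\<dots> = Pr (\<lambda>a. P (walk (arrow m a) t y k))"
    by (rule Pr_transfer[OF prob_space_axioms shift_family finite_coords_near subset_UNIV walk_depends])
  finally show ?case using Suc by simp
qed simp

text \<open>
  Reflection about the starting point turns the event that the walk ends to the right into the
  disjoint event that it ends to the left.
\<close>

lemma walk_up_half: "Pr (\<lambda>a. walk (arrow m a) t y k > y) \<le> 1 / 2"
proof -
  let ?U = "\<lambda>a. walk (arrow m a) t y k > y" and ?D = "\<lambda>a. walk (arrow m a) t y k < y"
  note ev = depends_on_events[OF finite_coords_near walk_depends, where t1=t and y1=y and k1=k]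
  have "Pr ?D = prob {a\<in>space \<Omega>. walk (arrow m (\<lambda>i. reflect y a i)) t y k < y}"
    by (rule Pr_transfer[OF prob_space_axioms reflect_family finite_coords_near subset_UNIV walk_depends, symmetric])
  also have "\<dots> = Pr ?U" by (simp add: walk_arrow_reflect)
  finally have "Pr ?D = Pr ?U" .
  moreover have "Pr (\<lambda>a. ?U a \<or> ?D a) = Pr ?U + Pr ?D"
    by (rule Pr_disjoint_Un) (rule depends_on_events[OF finite_coords_near walk_depends], rule depends_on_events[OF finite_coords_near walk_depends], auto)
  ultimately show ?thesis using Pr_le1[of "\<lambda>a. ?U a \<or> ?D a"] by simp
qed

end

section \<open>The renormalisation inequality\<close>

context product_model begin

text \<open>
  Outside this event every arrow of the window is determined by coordinates within distance about \<open>R\<close>.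
\<close>

definition nonlocal_event :: "nat \<Rightarrow> int \<Rightarrow> int \<Rightarrow> nat \<Rightarrow> (coord \<Rightarrow> bool) \<Rightarrow> bool" where
  "nonlocal_event R y W N a \<longleftrightarrow> (\<exists>n<N. \<exists>x\<in>{y - W..y + W}. escapes (int R) x (m * n) x a)"

lemma escapes_events: "{a. escapes R c j x a} \<in> events"
  by (rule depends_on_events[OF finite_clocks_near escapes_depends])

lemma nonlocal_UN: "{a. nonlocal_event R y W N a} = (\<Union>(n, x)\<in>{..<N} \<times> {y - W..y + W}. {a. escapes (int R) x (m * n) x a})"
  unfolding nonlocal_event_def by auto

lemma nonlocal_events: "{a. nonlocal_event R y W N a} \<in> events"
  unfolding nonlocal_UN by (intro sets.finite_UN) (auto intro: escapes_events)

lemma Pr_nonlocal: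
  assumes W: "0 \<le> W" and l: "0 \<le> l" "l \<le> 1" and g: "q * real m \<le> g" "0 \<le> g"
  shows "Pr (nonlocal_event R y W N) \<le> real N * real_of_int (2 * W + 1) * (2 * exp (2 * g * real N * l\<^sup>2 - l * real R))"
proof -
  let ?I = "{..<N} \<times> {y - W..y + W}"
  have "Pr (nonlocal_event R y W N) \<le> (\<Sum>(n, x)\<in>?I. Pr (escapes (int R) x (m * n) x))"
    unfolding nonlocal_UN case_prod_unfold
    by (rule finite_measure_subadditive_finite) (auto intro: escapes_events)
  also have "\<dots> \<le> (\<Sum>(n, x)\<in>?I. 2 * exp (2 * g * real N * l\<^sup>2 - l * real R))"
  proof (rule sum_mono)
    fix c assume "c \<in> ?I"
    then obtain n x where c: "c = (n, x)" and "n < N" by auto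
    then have "g * real n * l\<^sup>2 \<le> g * real N * l\<^sup>2" using g by (intro mult_right_mono mult_left_mono) auto
    moreover have "Pr (escapes (int R) x (m * n) x) \<le> 2 * exp (2 * g * real n * l\<^sup>2 - l * real_of_int (int R))"
      by (rule Pr_escapes) (use l g in auto)
    moreover have "exp (2 * g * real n * l\<^sup>2 - l * real_of_int (int R)) \<le> exp (2 * g * real N * l\<^sup>2 - l * real R)" if "g * real n * l\<^sup>2 \<le> g * real N * l\<^sup>2"
      using that by simp
    ultimately have "Pr (escapes (int R) x (m * n) x) \<le> 2 * exp (2 * g * real N * l\<^sup>2 - l * real R)" by linarith
    then show "(case c of (n, x) \<Rightarrow> Pr (escapes (int R) x (m * n) x)) \<le>
        (case c of (n, x) \<Rightarrow> 2 * exp (2 * g * real N * l\<^sup>2 - l * real R))" by (simp add: c)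
  qed
  also have "\<dots> = real N * real_of_int (2 * W + 1) * (2 * exp (2 * g * real N * l\<^sup>2 - l * real R))"
    using W by (simp add: case_prod_unfold card_cartesian_product)
  finally show ?thesis .
qed

lemma local_walk_eq:
  assumes a: "\<not> nonlocal_event R y W N a" and tk: "t + k \<le> N" "\<bar>u - y\<bar> + int k \<le> W"
  shows "walk (local_arrow (int R) m a) t u k = walk (arrow m a) t u k"
proof (rule walk_cong)
  fix n x assume n: "n < t + k" and x: "\<bar>x - u\<bar> \<le> int k"
  have "n < N" "x \<in> {y - W..y + W}" using n x tk by auto
  then have "\<not> escapes (int R) x (m * n) x a" using a unfolding nonlocal_event_def by blast
  then have "frozen_origin (int R) x a (m * n) x = origin a (m * n) x"
    unfolding escapes_def by (intro frozen_origin_eq) simp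
  then show "local_arrow (int R) m a n x = arrow m a n x" unfolding local_arrow_def arrow_def by simp
qed

lemma local_walk_depends:
  assumes "B = int k + int R + 1" "H = m * (t + k)"
  shows "depends_on (coords_near y B H) (\<lambda>a. P (walk (local_arrow (int R) m a) t y k))"
proof (rule depends_onI)
  fix a b :: "coord \<Rightarrow> bool" assume "\<And>i. i \<in> coords_near y B H \<Longrightarrow> a i = b i"
  then have "walk (local_arrow (int R) m a) t y k = walk (local_arrow (int R) m b) t y k"
    using m unfolding assms by (intro local_arrow_walk_cong) auto
  then show "P (walk (local_arrow (int R) m a) t y k) = P (walk (local_arrow (int R) m b) t y k)" by simp
qed

lemma Pr_union_bound:
  assumes "\<And>a. E a \<Longrightarrow> F a \<or> G a" "{a. F a} \<in> events" "{a. G a} \<in> events"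
  shows "Pr E \<le> Pr F + Pr G"
proof -
  have "Pr E \<le> prob ({a. F a} \<union> {a. G a})" using assms by (intro finite_measure_mono) auto
  also have "\<dots> \<le> Pr F + Pr G" by (rule measure_Un_le) fact+
  finally show ?thesis .
qed

lemma Pr_local_walk:
  assumes tk: "t + k \<le> N" "\<bar>u - y\<bar> + int k \<le> W" and e: "Pr (nonlocal_event R y W N) \<le> \<epsilon>"
  shows "Pr (\<lambda>a. P (walk (local_arrow (int R) m a) t u k)) \<le> Pr (\<lambda>a. P (walk (arrow m a) t u k)) + \<epsilon>"
proof -
  have "Pr (\<lambda>a. P (walk (local_arrow (int R) m a) t u k)) \<le> Pr (\<lambda>a. P (walk (arrow m a) t u k)) + Pr (nonlocal_event R y W N)"
  proof (rule Pr_union_bound)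
    show "P (walk (arrow m a) t u k) \<or> nonlocal_event R y W N a" if "P (walk (local_arrow (int R) m a) t u k)" for a
      using that local_walk_eq[OF _ tk, of R a] by auto
  qed (rule depends_on_events[OF finite_coords_near walk_depends] nonlocal_events)+
  then show ?thesis using e by simp
qed

lemma Pr_fast_stationary: "Pr (\<lambda>a. fast (arrow m a) L w t y) = Pr (\<lambda>a. fast (arrow m a) L w 0 y)"
  unfolding fast_def by (rule walk_stationary)

text \<open>
  The three terms bound the probabilities of the failure of localisation, of two fast blocks in
  columns at distance more than \<open>5 * L\<close> (a union bound over pairs of grid points, the blocks of each
  pair being independent after localisation), and of \<open>J\<close> upward moves in columns that
  are far apart because the tube rises.
\<close>

lemma renormalisation_inequality:
  fixes y :: int and K L g h s J :: nat and w \<delta> \<epsilon> :: real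
  assumes K: "5 \<le> K" and g: "0 < g" "2 * K * g \<le> L" and L: "3 \<le> L" and w: "0 < w" "w \<le> 2"
    and h: "20 \<le> real h * w" and s: "2 * real h + 6 \<le> real s * w"
    and J: "\<And>j. j < J \<Longrightarrow> j * s + h \<le> K"
    and slow: "\<And>u. Pr (\<lambda>a. fast (arrow m a) L w 0 u) \<le> \<delta>"
    and loc: "Pr (nonlocal_event L y (int (4 * K * L)) (K * L)) \<le> \<epsilon>"
  shows "Pr (\<lambda>a. fast (arrow m a) (K * L) (w - 1 / K) 0 y)
    \<le> \<epsilon> + (real K * real (card (grid_range K L g)))\<^sup>2 * (\<delta> + \<epsilon>)\<^sup>2 + (1 / 2 + \<epsilon>) ^ J"
proof -
  let ?W = "int (4 * K * L)" and ?N = "K * L"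
  let ?bad = "nonlocal_event L y ?W ?N"
  let ?f = "\<lambda>a. local_arrow (int L) m a"
  let ?u = "\<lambda>(i, z). grid_point y L g i z"
  let ?G = "{..<K} \<times> grid_range K L g"
  let ?I = "{(b, b') \<in> ?G \<times> ?G. \<bar>?u b - ?u b'\<bar> > 5 * int L}"
  let ?E = "\<lambda>b a. fast (?f a) L w (fst b * L) (?u b)"
  let ?D = "\<lambda>j a. walk (?f a) (j * s * L) (tube_point y L w (j * s)) (h * L) > tube_point y L w (j * s)"
  let ?V = "\<lambda>j. coords_near (tube_point y L w (j * s)) (int (h * L) + int L + 1) (m * (j * s * L + h * L))"
  have \<epsilon>0: "0 \<le> \<epsilon>" using loc measure_nonneg order.trans by blast
  have \<delta>0: "0 \<le> \<delta>" using slow measure_nonneg order.trans by blast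
  have finG: "finite (grid_range K L g)" unfolding grid_range_def by simp
  have finI: "finite ?I" by (rule finite_subset[of _ "?G \<times> ?G"]) (use finG in auto)
  have grid_range: "\<bar>?u (i, z) - y\<bar> + int L \<le> ?W" if "i < K" "z \<in> grid_range K L g" for i z
  proof -
    have z: "z \<le> 0" "- z \<le> int (K * L div g + 1)" using that unfolding grid_range_def by auto
    have "int g * (- z) \<le> int g * int (K * L div g + 1)" using z by (intro mult_left_mono) auto
    also have "\<dots> = int (g * (K * L div g) + g)" by (simp add: algebra_simps)
    also have "g * (K * L div g) + g \<le> K * L + g" by simp
    finally have zg: "int g * (- z) \<le> int (K * L) + int g" by simp
    have gz0: "int g * z \<le> 0" using z by (simp add: mult_le_0_iff)
    have "2 * g \<le> 2 * K * g" using K by simp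
    then have g2: "2 * int g \<le> int L" using g by linarith
    have "(i + 1) * L \<le> K * L" using that by (intro mult_le_mono1) simp
    then have "i * L + L \<le> K * L" by simp
    then have iL: "int (i * L) + int L \<le> int (K * L)" by linarith
    have KL: "5 * int L \<le> int (K * L)" using K by (simp add: mult_right_mono)
    have "?W = 4 * int (K * L)" by simp
    moreover have "?u (i, z) - y = int (i * L) + 2 * (int g * z)" unfolding grid_point_def by simp
    ultimately show ?thesis using zg gz0 g2 iL KL by linarith
  qed
  have grid_time: "i * L + L \<le> ?N" if "i < K" for i
    using that by (metis Suc_leI add.commute mult_Suc mult_le_mono1)
  have tube_range: "\<bar>tube_point y L w (j * s) - y\<bar> + int (h * L) \<le> ?W" and tube_time: "j * s * L + h * L \<le> ?N" if "j < J" for j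
  proof -
    have js: "j * s + h \<le> K" by (rule J[OF that])
    show "j * s * L + h * L \<le> ?N" using mult_le_mono1[OF js, of L] by (simp add: algebra_simps)
    have "j * s \<le> K - h" using js by simp
    then have "real (j * s) * w \<le> real (K - h) * 2" using w by (intro mult_mono of_nat_mono) auto
    also have "\<dots> = 2 * real K - 2 * real h" using js by (simp add: of_nat_diff)
    finally have "real (j * s) * w * L \<le> (2 * real K - 2 * real h) * L" by (intro mult_right_mono) auto
    then have a: "real (j * s) * w * L \<le> 2 * real (K * L) - 2 * real (h * L)" by (simp add: algebra_simps)
    have b: "5 * real L \<le> real (K * L)" using K by (simp add: mult_right_mono)
    have c: "0 \<le> real (j * s) * w * real L" using w by simp
    have "\<bar>real_of_int (tube_point y L w (j * s)) - real_of_int y\<bar> + real (h * L) \<le> 4 * real (K * L)"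
      using tube_point_bounds(1)[of y "j * s" w L] tube_point_bounds(2)[of y L w "j * s"] a b c L by linarith
    then show "\<bar>tube_point y L w (j * s) - y\<bar> + int (h * L) \<le> ?W" by linarith
  qed
  have Edep: "depends_on (coords_near (?u b) (2 * int L + 1) (m * (fst b * L + L))) (?E b)" for b
    unfolding fast_def by (rule local_walk_depends) simp_all
  have Ddep: "depends_on (?V j) (?D j)" for j
    by (rule local_walk_depends) simp_all
  have Pr_E: "Pr (?E b) \<le> \<delta> + \<epsilon>" if b: "b \<in> ?G" for b
  proof -
    obtain i z where iz: "b = (i, z)" "i < K" "z \<in> grid_range K L g" using b by auto
    have "Pr (?E b) \<le> Pr (\<lambda>a. fast (arrow m a) L w (i * L) (?u b)) + \<epsilon>"
      unfolding fast_def iz fst_conv using grid_time[OF iz(2)] grid_range[OF iz(2,3)] loc by (rule Pr_local_walk)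
    then show ?thesis using slow[of "?u b"] unfolding Pr_fast_stationary[of L w "i * L"] by linarith
  qed
  have Pr_EE: "Pr (\<lambda>a. ?E b a \<and> ?E b' a) \<le> (\<delta> + \<epsilon>)\<^sup>2" if "(b, b') \<in> ?I" for b b'
  proof -
    have far: "\<bar>?u b - ?u b'\<bar> > 5 * int L" and G: "b \<in> ?G" "b' \<in> ?G" using that by auto
    have "Pr (\<lambda>a. ?E b a \<and> ?E b' a) = Pr (?E b) * Pr (?E b')"
      by (rule Pr_indep[OF finite_coords_near finite_coords_near coords_near_disjoint Edep Edep]) (use far L in linarith)
    also have "\<dots> \<le> (\<delta> + \<epsilon>) * (\<delta> + \<epsilon>)"
      using Pr_E[OF G(1)] Pr_E[OF G(2)] \<delta>0 \<epsilon>0 by (intro mult_mono) auto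
    finally show ?thesis by (simp add: power2_eq_square)
  qed
  have evEE: "{a. ?E b a \<and> ?E b' a} \<in> events" for b b'
  proof -
    have "{a. ?E b a \<and> ?E b' a} = {a. ?E b a} \<inter> {a. ?E b' a}" by auto
    then show ?thesis using depends_on_events[OF finite_coords_near Edep[of b]] depends_on_events[OF finite_coords_near Edep[of b']] by auto
  qed
  let ?S = "\<lambda>a. \<exists>c\<in>?I. ?E (fst c) a \<and> ?E (snd c) a"
  have S_UN: "{a. ?S a} = (\<Union>c\<in>?I. {a. ?E (fst c) a \<and> ?E (snd c) a})" by blast
  have evS: "{a. ?S a} \<in> events" unfolding S_UN by (rule sets.finite_UN[OF finI]) (rule evEE)
  have "Pr ?S \<le> (\<Sum>c\<in>?I. Pr (\<lambda>a. ?E (fst c) a \<and> ?E (snd c) a))"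
    unfolding S_UN by (rule finite_measure_subadditive_finite[OF finI]) (auto intro: evEE)
  also have "\<dots> \<le> (\<Sum>c\<in>?I. (\<delta> + \<epsilon>)\<^sup>2)" by (rule sum_mono) (rule Pr_EE, simp)
  also have "\<dots> = real (card ?I) * (\<delta> + \<epsilon>)\<^sup>2" by simp
  also have "\<dots> \<le> (real K * real (card (grid_range K L g)))\<^sup>2 * (\<delta> + \<epsilon>)\<^sup>2"
  proof (rule mult_right_mono)
    have "card ?I \<le> card (?G \<times> ?G)" by (rule card_mono) (use finG in auto)
    also have "\<dots> = (K * card (grid_range K L g))\<^sup>2" by (simp add: card_cartesian_product power2_eq_square)
    finally have "real (card ?I) \<le> real ((K * card (grid_range K L g))\<^sup>2)" by (rule of_nat_mono)
    then show "real (card ?I) \<le> (real K * real (card (grid_range K L g)))\<^sup>2"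
      by (simp only: of_nat_mult of_nat_power)
  qed simp
  finally have PS: "Pr ?S \<le> (real K * real (card (grid_range K L g)))\<^sup>2 * (\<delta> + \<epsilon>)\<^sup>2" .
  let ?T = "\<lambda>a. \<forall>j\<in>{..<J}. ?D j a"
  have far_tube: "int (h * L) + int L + 1 + (int (h * L) + int L + 1) < \<bar>tube_point y L w (j * s) - tube_point y L w (j' * s)\<bar>"
    if "j < j'" for j j'
  proof -
    have "1 * (2 * real h + 6) \<le> (real j' - real j) * (real s * w)"
      using that s w by (intro mult_mono) auto
    then have "(2 * real h + 6) * L \<le> (real j' - real j) * (real s * w) * L" by (intro mult_right_mono) auto
    then have "2 * real (h * L) + 6 * real L \<le> real (j' * s) * w * L - real (j * s) * w * L" by (simp add: algebra_simps)
    then have "real_of_int (tube_point y L w (j' * s)) - real_of_int (tube_point y L w (j * s)) > 2 * real (h * L) + 2 * real L + 2"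
      using tube_point_bounds(1)[of y "j' * s" w L] tube_point_bounds(2)[of y L w "j * s"] L by linarith
    then show ?thesis by linarith
  qed
  have "Pr ?T = (\<Prod>j\<in>{..<J}. Pr (?D j))"
  proof (rule Pr_indep_family[OF _ _ _ Ddep])
    show "disjoint_family_on ?V {..<J}"
      unfolding disjoint_family_on_def
    proof (intro ballI impI)
      fix j j' :: nat assume "j \<noteq> j'"
      then have "j < j' \<or> j' < j" by auto
      then show "?V j
         \<inter> ?V j' = {}"
        using far_tube[of j j'] far_tube[of j' j] by (intro coords_near_disjoint) (auto simp: abs_minus_commute)
    qed
  qed simp_all
  also have "\<dots> \<le> (\<Prod>j\<in>{..<J}. 1 / 2 + \<epsilon>)"
  proof (rule prod_mono, intro conjI measure_nonneg)
    fix j assume "j \<in> {..<J}"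
    then have j: "j < J" by simp
    have "Pr (?D j) \<le> Pr (\<lambda>a. walk (arrow m a) (j * s * L) (tube_point y L w (j * s)) (h * L) > tube_point y L w (j * s)) + \<epsilon>"
      using tube_time[OF j] tube_range[OF j] loc by (rule Pr_local_walk)
    then show "Pr (?D j) \<le> 1 / 2 + \<epsilon>" using walk_up_half[of "tube_point y L w (j * s)" "j * s * L" "h * L"] by linarith
  qed
  finally have PT: "Pr ?T \<le> (1 / 2 + \<epsilon>) ^ J" by simp
  have evT: "{a. ?T a} \<in> events"
  proof (rule depends_on_events)
    show "depends_on (\<Union>j<J. ?V j) ?T"
      unfolding depends_on_def
    proof (intro allI impI)
      fix a b :: "coord \<Rightarrow> bool"
      assume "\<forall>i\<in>\<Union>j<J. ?V j. a i = b i"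
      then have "?D j a = ?D j b" if "j < J" for j using that by (intro depends_onD[OF Ddep]) auto
      then show "?T a = ?T b" by auto
    qed
  qed simp
  have "Pr (\<lambda>a. fast (arrow m a) (K * L) (w - 1 / K) 0 y) \<le> Pr ?bad + Pr (\<lambda>a. ?S a \<or> ?T a)"
  proof (rule Pr_union_bound[OF _ nonlocal_events])
    show "{a. ?S a \<or> ?T a} \<in> events" using evS evT by (simp add: Collect_disj_eq)
    fix a assume f: "fast (arrow m a) (K * L) (w - 1 / K) 0 y"
    show "?bad a \<or> ?S a \<or> ?T a"
    proof (rule disjCI)
      assume nST: "\<not> (?S a \<or> ?T a)"
      show "?bad a"
      proof (rule ccontr)
        assume nb: "\<not> ?bad a"
        have loc_fast: "fast (?f a) L w (i * L) (?u (i, z))"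
          if "i < K" "z \<in> grid_range K L g" "fast (arrow m a) L w (i * L) (?u (i, z))" for i z
          using that(3) unfolding fast_def local_walk_eq[OF nb grid_time[OF that(1)] grid_range[OF that(1,2)]] .
        have loc_up: "?D j a = (walk (arrow m a) (j * s * L) (tube_point y L w (j * s)) (h * L) > tube_point y L w (j * s))"
          if "j < J" for j
          unfolding local_walk_eq[OF nb tube_time[OF that] tube_range[OF that]] ..
        have "(far_apart_fast (arrow m a) y K L g w)
         \<or> (climbs (arrow m a) y L w h s J)"
        proof (rule fast_walk_dichotomy)
          show "(w - 1 / real K) * real (K * L) \<le> real_of_int (walk (arrow m a) 0 y (K * L) - y)"
            using f unfolding fast_def .
        qed (use K g L w h J in simp_all)
        then show False
        proof
          assume "climbs (arrow m a) y L w h s J"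
          then have "?T a" using loc_up by simp
          then show False using nST by simp
        next
          assume "far_apart_fast (arrow m a) y K L g w"
          then obtain i i' z z' where b: "i < K" "i' < K" "z \<in> grid_range K L g" "z' \<in> grid_range K L g"
            "\<bar>grid_point y L g i z - grid_point y L g i' z'\<bar> > 5 * int L"
            "fast (arrow m a) L w (i * L) (grid_point y L g i z)" "fast (arrow m a) L w (i' * L) (grid_point y L g i' z')"
            by blast
          have "((i, z), (i', z')) \<in> ?I" using b by simp
          moreover have "?E (i, z) a" "?E (i', z') a" using loc_fast[of i z] loc_fast[of i' z'] b by simp_all
          ultimately have "?S a" by (intro bexI[of _ "((i, z), (i', z'))"]) simp_all
          then show False using nST by blast
        qed
      qed
    qed
  qed
  also have "Pr (\<lambda>a. ?S a \<or> ?T a) \<le> Pr ?S + Pr ?T" by (rule Pr_union_bound[OF _ evS evT])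
  finally show ?thesis using loc PS PT by linarith
qed

end

section \<open>The renormalisation step\<close>

lemma eventually_poly_exp_le_1:
  fixes c C :: real
  assumes "0 < c"
  shows "eventually (\<lambda>x. C * x ^ k * exp (- (c * x)) \<le> 1) at_top"
proof -
  have lim: "filterlim (\<lambda>x. c * x) at_top at_top"
    by (rule filterlim_tendsto_pos_mult_at_top[OF tendsto_const assms filterlim_ident])
  have "((\<lambda>x. (c * x) ^ k / exp (c * x)) \<longlongrightarrow> 0) at_top"
    by (rule filterlim_compose[OF tendsto_power_div_exp_0 lim])
  then have "((\<lambda>x. C / c ^ k * ((c * x) ^ k / exp (c * x))) \<longlongrightarrow> C / c ^ k * 0) at_top"
    by (rule tendsto_mult_left)
  then have "((\<lambda>x. C / c ^ k * ((c * x) ^ k / exp (c * x))) \<longlongrightarrow> 0) at_top" by simp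
  then have "eventually (\<lambda>x. C / c ^ k * ((c * x) ^ k / exp (c * x)) < 1) at_top"
    by (rule order_tendstoD) simp
  then show ?thesis
  proof eventually_elim
    case (elim x)
    have "C / c ^ k * ((c * x) ^ k / exp (c * x)) = C * x ^ k * exp (- (c * x))"
      using assms by (simp add: power_mult_distrib exp_minus field_simps)
    with elim show ?case by simp
  qed
qed

text \<open>
  The numbers \<open>h\<close> and \<open>s\<close> of \<open>renormalisation_inequality\<close> for all slopes above \<open>w\<close>.
\<close>

definition climb_blocks :: "real \<Rightarrow> nat" where "climb_blocks w = nat \<lceil>20 / w\<rceil>"

definition climb_spacing :: "real \<Rightarrow> nat" where "climb_spacing w = nat \<lceil>(2 * real (climb_blocks w) + 6) / w\<rceil>"

text \<open>
  What \<open>renormalisation_step\<close> demands of the ratio \<open>K\<close> of two scales. The condition on \<open>x\<close> is used for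
  \<open>x = L / K\<close> and makes localisation fail rarely; the last one bounds the probability that all the walks
  from the tube points move up.
\<close>

definition large_ratio :: "real \<Rightarrow> real \<Rightarrow> nat \<Rightarrow> bool" where
  "large_ratio g w K \<longleftrightarrow> 278 \<le> K \<and> 1 \<le> real K * w \<and>
    (\<forall>x\<ge>real K. 13824 * x ^ 14 * exp (- (x / (2 * (4 * g + 1)))) \<le> 1) \<and>
    768 * real K ^ 8 * (3 / 4) ^ ((K - climb_blocks w) div climb_spacing w) \<le> 1"

lemma climb_blocks: "0 < w \<Longrightarrow> w \<le> w' \<Longrightarrow> 20 \<le> real (climb_blocks w) * w'"
proof -
  assume w: "0 < w" "w \<le> w'"
  have "20 / w \<le> real (climb_blocks w)" unfolding climb_blocks_def by linarith
  then have "20 \<le> real (climb_blocks w) * w" using w by (simp add: pos_divide_le_eq)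
  also have "\<dots> \<le> real (climb_blocks w) * w'" using w by (intro mult_left_mono) auto
  finally show ?thesis .
qed

lemma climb_spacing: "0 < w \<Longrightarrow> w \<le> w' \<Longrightarrow> 2 * real (climb_blocks w) + 6 \<le> real (climb_spacing w) * w'"
proof -
  assume w: "0 < w" "w \<le> w'"
  have "(2 * real (climb_blocks w) + 6) / w \<le> real (climb_spacing w)" unfolding climb_spacing_def by linarith
  then have "2 * real (climb_blocks w) + 6 \<le> real (climb_spacing w) * w" using w by (simp add: pos_divide_le_eq)
  also have "\<dots> \<le> real (climb_spacing w) * w'" using w by (intro mult_left_mono) auto
  finally show ?thesis .
qed

lemma climb_spacing_pos: "0 < w \<Longrightarrow> 0 < climb_spacing w"
  using climb_spacing[of w w] by (intro gr0I) auto

lemma eventually_large_ratio: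
  assumes g: "0 \<le> g" and w: "0 < w"
  obtains K0 where "\<And>K. K0 \<le> K \<Longrightarrow> large_ratio g w K"
proof -
  let ?c = "1 / (2 * (4 * g + 1))"
  have "eventually (\<lambda>x. 13824 * x ^ 14 * exp (- (?c * x)) \<le> 1) at_top"
    by (rule eventually_poly_exp_le_1) (use g in simp)
  then obtain A where A: "\<And>x. A \<le> x \<Longrightarrow> 13824 * x ^ 14 * exp (- (?c * x)) \<le> 1"
    unfolding eventually_at_top_linorder by blast
  define d where "d = ln (4 / 3 :: real) / real (climb_spacing w)"
  define C where "C = 768 * exp (ln (4 / 3) * (real (climb_blocks w) / real (climb_spacing w) + 1))"
  have d: "0 < d" unfolding d_def using climb_spacing_pos[OF w] by simp
  obtain B where B: "\<And>x. B \<le> x \<Longrightarrow> C * x ^ 8 * exp (- (d * x)) \<le> 1"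
    using eventually_poly_exp_le_1[OF d, of C 8] unfolding eventually_at_top_linorder by blast
  define K0 where "K0 = nat (\<lceil>\<bar>A\<bar>\<rceil> + \<lceil>\<bar>B\<bar>\<rceil> + \<lceil>1 / w\<rceil> + 278)"
  show thesis
  proof (rule that)
    fix K assume K: "K0 \<le> K"
    have "0 < 1 / w" using w by simp
    then have real_K: "A \<le> real K" "B \<le> real K" "1 / w \<le> real K" "278 \<le> K" using K unfolding K0_def by linarith+
    have "768 * real K ^ 8 * (3 / 4) ^ ((K - climb_blocks w) div climb_spacing w) \<le> C * real K ^ 8 * exp (- (d * real K))"
    proof -
      let ?J = "(K - climb_blocks w) div climb_spacing w"
      have "(K - climb_blocks w) < (?J + 1) * climb_spacing w" using climb_spacing_pos[OF w]
        by (metis Suc_eq_plus1 dividend_less_times_div mult.commute mult_Suc_right add.commute)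
      then have "K \<le> (?J + 1) * climb_spacing w + climb_blocks w" by linarith
      then have "real K \<le> real ((?J + 1) * climb_spacing w + climb_blocks w)" by (simp only: of_nat_le_iff)
      then have "real K - real (climb_blocks w) \<le> (real ?J + 1) * real (climb_spacing w)"
        by (simp only: of_nat_add of_nat_mult of_nat_1)
      then have "(real K - real (climb_blocks w)) / real (climb_spacing w) \<le> real ?J + 1" using climb_spacing_pos[OF w] by (simp add: pos_divide_le_eq)
      then have "ln (4 / 3) * ((real K - real (climb_blocks w)) / real (climb_spacing w)) \<le> ln (4 / 3) * (real ?J + 1)"
        by (intro mult_left_mono) auto
      then have le: "- (real ?J * ln (4 / 3)) \<le> ln (4 / 3) * (real (climb_blocks w) / real (climb_spacing w) + 1) - d * real K"
        unfolding d_def by (simp add: algebra_simps diff_divide_distrib)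
      have "(3 / 4 :: real) ^ ?J = exp (- (real ?J * ln (4 / 3)))"
      proof -
        have "exp (- (real ?J * ln (4 / 3))) = exp (- ln (4 / 3 :: real)) ^ ?J"
          by (simp add: exp_of_nat_mult[symmetric])
        also have "exp (- ln (4 / 3 :: real)) = 3 / 4" by (simp add: exp_minus)
        finally show ?thesis by simp
      qed
      also have "\<dots> \<le> exp (ln (4 / 3) * (real (climb_blocks w) / real (climb_spacing w) + 1) - d * real K)" using le by simp
      finally have "768 * real K ^ 8 * (3 / 4) ^ ?J \<le> 768 * real K ^ 8 * exp (ln (4 / 3) * (real (climb_blocks w) / real (climb_spacing w) + 1) - d * real K)"
        by (intro mult_left_mono) auto
      also have "\<dots> = C * real K ^ 8 * exp (- (d * real K))"
        unfolding C_def by (simp add: exp_diff exp_minus field_simps)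
      finally show ?thesis .
    qed
    also have "\<dots> \<le> 1" using B real_K by simp
    finally show "large_ratio g w K"
      unfolding large_ratio_def using real_K A w by (auto simp: pos_divide_le_eq)
  qed
qed

lemma grid_step:
  fixes K L :: nat
  assumes "4 * K \<le> L" "0 < K"
  shows "0 < L div (2 * K)" "2 * K * (L div (2 * K)) \<le> L" "real L \<le> 4 * real K * real (L div (2 * K))"
proof -
  let ?g = "L div (2 * K)"
  show "2 * K * ?g \<le> L" by simp
  have "2 * K \<le> L" using assms by simp
  then show "0 < ?g" using assms by (simp add: div_greater_zero_iff)
  then have "1 \<le> ?g" by simp
  have "L < 2 * K * (?g + 1)" using assms dividend_less_times_div[of "2 * K" L] by simp
  also have "\<dots> \<le> 2 * K * (2 * ?g)" using \<open>1 \<le> ?g\<close> by (intro mult_le_mono2) simp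
  finally have "L \<le> 4 * K * ?g" by simp
  then have "real L \<le> real (4 * K * ?g)" by (simp only: of_nat_le_iff)
  then show "real L \<le> 4 * real K * real ?g" by (simp only: of_nat_mult of_nat_numeral)
qed

lemma card_grid_range:
  fixes J K L :: nat
  assumes "4 * K \<le> L" "0 < K"
  shows "real (card (grid_range J L (L div (2 * K)))) \<le> 4 * real J * real K + 2"
proof -
  let ?g = "L div (2 * K)"
  have "card (grid_range J L ?g) = J * L div ?g + 2" unfolding grid_range_def by simp
  moreover have "real (J * L div ?g) \<le> real (J * L) / real ?g" by (rule of_nat_div_le_of_nat)
  moreover have "real (J * L) / real ?g \<le> 4 * real J * real K"
    using mult_left_mono[OF grid_step(3)[OF assms], of "real J"] grid_step(1)[OF assms]
    by (simp add: pos_divide_le_eq ac_simps)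
  ultimately show ?thesis by simp
qed

context product_model begin

definition slow :: "nat \<Rightarrow> real \<Rightarrow> real \<Rightarrow> bool" where
  "slow L w \<delta> \<longleftrightarrow> (\<forall>u. Pr (\<lambda>a. fast (arrow m a) L w 0 u) \<le> \<delta>)"

lemma fast_events: "{a. fast (arrow m a) L w t u} \<in> events"
  unfolding fast_def by (rule depends_on_events[OF finite_coords_near walk_depends])

lemma slow_mono:
  assumes "slow L w \<delta>" "w \<le> w'" "\<delta> \<le> \<delta>'"
  shows "slow L w' \<delta>'"
  unfolding slow_def
proof
  fix u
  have "Pr (\<lambda>a. fast (arrow m a) L w' 0 u) \<le> Pr (\<lambda>a. fast (arrow m a) L w 0 u)"
  proof (rule finite_measure_mono[OF _ fast_events], safe)
    fix a assume "fast (arrow m a) L w' 0 u"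
    moreover have "w * real L \<le> w' * real L" using assms(2) by (intro mult_right_mono) auto
    ultimately show "fast (arrow m a) L w 0 u" unfolding fast_def by linarith
  qed
  then show "Pr (\<lambda>a. fast (arrow m a) L w' 0 u) \<le> \<delta>'" using assms unfolding slow_def by (meson order_trans)
qed

text \<open>
  Each of the three terms in \<open>renormalisation_inequality\<close> is at most a third of \<open>1 / (2 * K) ^ 8\<close>. The
  one with \<open>\<delta>\<^sup>2\<close> is of order \<open>K ^ 6 * K ^ (-16)\<close>, which leaves room for the constant and for
  the factor \<open>2 ^ 8\<close>.
\<close>

lemma renormalisation_step:
  assumes g: "q * real m \<le> g" "0 \<le> g" and w0: "0 < w0" "w0 \<le> w" "w \<le> 2"
    and K: "large_ratio g w0 K" and L: "K\<^sup>2 \<le> L" and sl: "slow L w (1 / real K ^ 8)"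
  shows "slow (K * L) (w - 1 / K) (1 / real (2 * K) ^ 8)"
  unfolding slow_def
proof
  fix y
  have K278: "278 \<le> K" using K unfolding large_ratio_def by simp
  then have K0: "0 < K" and Kr: "278 \<le> real K" by simp_all
  have "4 * K \<le> K * K" using K278 by (intro mult_le_mono1) simp
  then have L4: "4 * K \<le> L" using L unfolding power2_eq_square by linarith
  let ?g = "L div (2 * K)" and ?h = "climb_blocks w0" and ?s = "climb_spacing w0"
  let ?J = "(K - ?h) div ?s"
  define x where "x = real L / real K"
  have Kx: "real K \<le> x" unfolding x_def using L K0
    by (simp add: pos_le_divide_eq power2_eq_square flip: of_nat_mult)
  have Lx: "real L = real K * x" unfolding x_def using K0 by simp
  \<comment> \<open>chosen such that the quadratic term in the exponent of \<open>Pr_nonlocal\<close> is at most half of the linear one\<close>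
  define l where "l = 1 / (4 * g * real K + 1)"
  have gK: "0 \<le> g * real K" using g by simp
  have l: "0 \<le> l" "l \<le> 1" unfolding l_def using gK by simp_all
  let ?\<epsilon> = "Pr (nonlocal_event L y (int (4 * K * L)) (K * L))"
  have expo: "2 * g * real (K * L) * l\<^sup>2 - l * real L \<le> - (x / (2 * (4 * g + 1)))"
  proof -
    have "2 * g * real K * l \<le> 1 / 2" unfolding l_def using gK by (simp add: pos_divide_le_eq)
    then have "(2 * g * real K * l) * (l * real L) \<le> 1 / 2 * (l * real L)" using l by (intro mult_right_mono) auto
    then have "2 * g * real (K * L) * l\<^sup>2 - l * real L \<le> - (l * real L / 2)" by (simp add: power2_eq_square algebra_simps)
    moreover have "x / (2 * (4 * g + 1)) \<le> l * real L / 2"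
    proof -
      have "4 * g * real K + 1 \<le> (4 * g + 1) * real K" using Kr by (simp add: algebra_simps)
      moreover have "0 < 4 * g * real K + 1" using gK by linarith
      ultimately have "1 / ((4 * g + 1) * real K) \<le> l" unfolding l_def by (intro frac_le) auto
      then have A: "1 / ((4 * g + 1) * real K) * real L \<le> l * real L" by (intro mult_right_mono) auto
      have B: "1 / ((4 * g + 1) * real K) * real L = x / (4 * g + 1)" unfolding x_def by simp
      have "x / (4 * g + 1) / 2 \<le> l * real L / 2" by (rule divide_right_mono[OF A[unfolded B]]) simp
      then show ?thesis by (simp only: divide_divide_eq_left mult.commute[of 2])
    qed
    ultimately show ?thesis by linarith
  qed
  have eps: "?\<epsilon> \<le> 1 / (768 * real K ^ 8)"
  proof -
    have "?\<epsilon> \<le> real (K * L) * real_of_int (2 * int (4 * K * L) + 1) * (2 * exp (2 * g * real (K * L) * l\<^sup>2 - l * real L))"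
      by (rule Pr_nonlocal) (use l g in auto)
    also have "\<dots> \<le> real (K * L) * (9 * real (K * L)) * (2 * exp (- (x / (2 * (4 * g + 1)))))"
    proof (intro mult_mono)
      have "1 \<le> K * L" using K0 L4 by simp
      then have "real 1 \<le> real (K * L)" by (simp only: of_nat_le_iff)
      then show "real_of_int (2 * int (4 * K * L) + 1) \<le> 9 * real (K * L)" by simp
    qed (use expo in auto)
    also have "\<dots> = 18 * real K ^ 4 * x\<^sup>2 * exp (- (x / (2 * (4 * g + 1))))"
      by (simp add: Lx power2_eq_square power4_eq_xxxx)
    also have "\<dots> \<le> 18 * x ^ 4 * x\<^sup>2 * exp (- (x / (2 * (4 * g + 1))))"
      using Kx by (intro mult_right_mono mult_left_mono power_mono) auto
    also have "\<dots> = (13824 * x ^ 14 * exp (- (x / (2 * (4 * g + 1))))) / (768 * x ^ 8)"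
      using Kx Kr by (simp add: field_simps flip: power_add)
    also have "\<dots> \<le> 1 / (768 * real K ^ 8)"
    proof (rule frac_le)
      show "13824 * x ^ 14 * exp (- (x / (2 * (4 * g + 1)))) \<le> 1"
        using K Kx unfolding large_ratio_def by blast
      show "768 * real K ^ 8 \<le> 768 * x ^ 8" using Kx by (intro mult_left_mono power_mono) auto
    qed (use K0 in auto)
    finally show ?thesis .
  qed
  have tiny: "1 / (768 * real K ^ 8) \<le> 1 / real K ^ 8" "1 / (768 * real K ^ 8) \<le> 1 / 4"
  proof -
    have "1 \<le> real K ^ 8" using Kr by simp
    moreover have "1 / (768 * k) \<le> 1 / k" "1 / (768 * k) \<le> 1 / 4" if "1 \<le> k" for k :: real
      by (rule frac_le, use that in simp_all)+
    ultimately show "1 / (768 * real K ^ 8) \<le> 1 / real K ^ 8" "1 / (768 * real K ^ 8) \<le> 1 / 4" by blast+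
  qed
  have "Pr (\<lambda>a. fast (arrow m a) (K * L) (w - 1 / real K) 0 y)
    \<le> ?\<epsilon> + (real K * real (card (grid_range K L ?g)))\<^sup>2 * (1 / real K ^ 8 + ?\<epsilon>)\<^sup>2 + (1 / 2 + ?\<epsilon>) ^ ?J"
  proof (rule renormalisation_inequality)
    show "j * ?s + ?h \<le> K" if "j < ?J" for j
    proof -
      have "(j + 1) * ?s \<le> ?J * ?s" using that by (intro mult_le_mono1) simp
      also have "\<dots> \<le> K - ?h" by simp
      finally have "j * ?s + ?s \<le> K - ?h" by simp
      moreover have "0 < ?s" by (rule climb_spacing_pos[OF w0(1)])
      ultimately show ?thesis by simp
    qed
    show "0 < ?g" "2 * K * ?g \<le> L" using grid_step[OF L4 K0] by auto
    show "Pr (\<lambda>a. fast (arrow m a) L w 0 u) \<le> 1 / real K ^ 8" for u using sl unfolding slow_def by blast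
  qed (use K278 L4 w0 climb_blocks climb_spacing in auto)
  also have "\<dots> \<le> 1 / (768 * real K ^ 8) + 1 / (768 * real K ^ 8) + 1 / (768 * real K ^ 8)"
  proof (intro add_mono eps)
    have "real (card (grid_range K L ?g)) \<le> 4 * real K * real K + 2" by (rule card_grid_range[OF L4 K0])
    also have "\<dots> \<le> 5 * (real K * real K)"
    proof -
      have "278 * 278 \<le> real K * real K" using Kr by (intro mult_mono) auto
      then show ?thesis by linarith
    qed
    finally have "real K * real (card (grid_range K L ?g)) \<le> real K * (5 * (real K * real K))" by (rule mult_left_mono) simp
    then have c: "real K * real (card (grid_range K L ?g)) \<le> 5 * real K ^ 3"
      unfolding power3_eq_cube by linarith
    have le1: "(real K * real (card (grid_range K L ?g)))\<^sup>2 * (1 / real K ^ 8 + ?\<epsilon>)\<^sup>2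
        \<le> (5 * real K ^ 3)\<^sup>2 * (2 / real K ^ 8)\<^sup>2"
    proof (rule mult_mono)
      show "(real K * real (card (grid_range K L ?g)))\<^sup>2 \<le> (5 * real K ^ 3)\<^sup>2"
        by (rule power_mono[OF c]) simp
      have "2 / real K ^ 8 = 1 / real K ^ 8 + 1 / real K ^ 8" by simp
      then have "1 / real K ^ 8 + ?\<epsilon> \<le> 2 / real K ^ 8" using order.trans[OF eps tiny(1)] by linarith
      then show "(1 / real K ^ 8 + ?\<epsilon>)\<^sup>2 \<le> (2 / real K ^ 8)\<^sup>2"
        by (rule power_mono) (intro add_nonneg_nonneg measure_nonneg, simp)
    qed (rule zero_le_power2)+
    have le2: "(5 * real K ^ 3)\<^sup>2 * (2 / real K ^ 8)\<^sup>2 \<le> 1 / (768 * real K ^ 8)"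
    proof -
      have "76800 \<le> real K ^ 2" using mult_mono[OF Kr Kr] by (simp add: power2_eq_square)
      then have "76800 * real K ^ 8 \<le> real K ^ 2 * real K ^ 8" by (intro mult_right_mono) auto
      then have "100 * (1 / (real K ^ 2 * real K ^ 8)) \<le> 1 / (768 * real K ^ 8)"
        using K0 by (simp add: field_simps)
      moreover have "(5 * k ^ 3)\<^sup>2 * (2 / k ^ 8)\<^sup>2 = 100 * (1 / (k ^ 2 * k ^ 8))" if "0 < k" for k :: real
      proof -
        have "k ^ 16 = k ^ 6 * (k ^ 2 * k ^ 8)" by (simp flip: power_add)
        then show ?thesis using that
          by (simp add: power_mult_distrib power_divide frac_eq_eq flip: power_mult)
      qed
      ultimately show ?thesis using K0 by simp
    qed
    show "(real K * real (card (grid_range K L ?g)))\<^sup>2 * (1 / real K ^ 8 + ?\<epsilon>)\<^sup>2 \<le> 1 / (768 * real K ^ 8)"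
      by (rule order.trans[OF le1 le2])
    have "1 / 2 + ?\<epsilon> \<le> 3 / 4" using order.trans[OF eps tiny(2)] by linarith
    then have "(1 / 2 + ?\<epsilon>) ^ ?J \<le> (3 / 4) ^ ?J"
      by (rule power_mono) (intro add_nonneg_nonneg measure_nonneg, simp)
    also have "\<dots> \<le> 1 / (768 * real K ^ 8)"
      using K K0 unfolding large_ratio_def by (simp add: field_simps)
    finally show "(1 / 2 + ?\<epsilon>) ^ ?J \<le> 1 / (768 * real K ^ 8)" .
  qed
  also have "\<dots> = 1 / real (2 * K) ^ 8" by (simp add: power_mult_distrib)
  finally show "Pr (\<lambda>a. fast (arrow m a) (K * L) (w - 1 / real K) 0 y) \<le> 1 / real (2 * K) ^ 8" .
qed

end

section \<open>Excursions on a growing sequence of scales\<close>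

text \<open>
  The first scale is the one that \<open>slow_descent\<close> reaches from \<open>K\<^sup>2\<close> after \<open>2 * K\<close> steps of ratio \<open>K\<close>; then
  the ratio is doubled in every step.
\<close>

fun block_scale :: "nat \<Rightarrow> nat \<Rightarrow> nat" where
  "block_scale K 0 = K ^ (2 * K + 2)"
| "block_scale K (Suc k) = 2 ^ k * K * block_scale K k"

text \<open>
  If no block of length \<open>L\<close> is fast at slope \<open>w\<close> from a grid point, then the walk gains at most
  \<open>w * L + 2 * g \<le> 2 * w * L\<close> per block. The last, incomplete block adds less than \<open>L\<close>, which is
  at most \<open>w * N\<close> for the times \<open>N\<close> considered.
\<close>

lemma walk_bound_between_scales:
  fixes f :: "nat \<Rightarrow> int \<Rightarrow> bool" and L \<kappa> N :: nat and w :: real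
  defines "g \<equiv> L div (2 * \<kappa>)" and "J \<equiv> 2 * \<kappa>\<^sup>2"
  assumes L: "4 * \<kappa> \<le> L" and k: "0 < \<kappa>" "1 \<le> real \<kappa> * w" and w: "0 < w"
    and nofast: "\<And>i z. i < J \<Longrightarrow> z \<in> grid_range J L g \<Longrightarrow> \<not> fast f L w (i * L) (grid_point 0 L g i z)"
    and N: "\<kappa> * L \<le> N" "N < J * L"
  shows "real_of_int (walk f 0 0 N) \<le> 3 * w * real N"
proof -
  let ?X = "\<lambda>i. walk f 0 0 (i * L)"
  have L0: "0 < L" using L k by simp
  have g0: "0 < g" unfolding g_def by (rule grid_step(1)[OF L k(1)])
  have kL: "real L \<le> w * real (\<kappa> * L)"
    using mult_right_mono[OF k(2), of "real L"] by (simp add: ac_simps)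
  have "real \<kappa> * (2 * real g) \<le> real L"
  proof -
    have "real (2 * \<kappa> * g) \<le> real L" using grid_step(2)[OF L k(1)] unfolding g_def by (simp only: of_nat_le_iff)
    then show ?thesis by simp
  qed
  also have "\<dots> \<le> real \<kappa> * (w * real L)" using kL by (simp add: ac_simps)
  finally have g2: "2 * real g \<le> w * real L" using k by simp
  have incr: "real_of_int (?X (Suc i)) - ?X i \<le> 2 * w * real L" if "i < J" for i
  proof (rule ccontr)
    assume "\<not> ?thesis"
    then have "real_of_int (?X (Suc i)) - ?X i > w * L + 2 * g" using g2 by linarith
    from fast_from_grid[OF g0 that this] nofast[OF that] show False by blast
  qed
  have sum: "j \<le> J \<longrightarrow> real_of_int (?X j) \<le> 2 * w * real (j * L)" for j
  proof (induction j)
    case (Suc j)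
    show ?case
    proof
      assume "Suc j \<le> J"
      then have "real_of_int (?X (Suc j)) \<le> 2 * w * real L + 2 * w * real (j * L)" using incr[of j] Suc by force
      also have "\<dots> = 2 * w * real (Suc j * L)" by (simp add: algebra_simps)
      finally show "real_of_int (?X (Suc j)) \<le> 2 * w * real (Suc j * L)" .
    qed
  qed simp
  have jN: "N = N div L * L + N mod L" and r: "N mod L < L" using L0 by simp_all
  have j: "N div L < J" using N(2) L0 by (simp add: less_mult_imp_div_less)
  have "walk f 0 0 N = walk f (N div L * L) (?X (N div L)) (N mod L)"
    using walk_add[of f 0 0 "N div L * L" "N mod L"] by simp
  then have "walk f 0 0 N \<le> ?X (N div L) + int (N mod L)"
    using walk_range[of f "N div L * L" "?X (N div L)" "N mod L"] by linarith
  then have "real_of_int (walk f 0 0 N) \<le> real_of_int (?X (N div L)) + real L" using r by linarith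
  moreover have "real_of_int (?X (N div L)) \<le> 2 * w * real (N div L * L)" using sum j by simp
  moreover have "2 * w * real (N div L * L) \<le> 2 * w * real N"
    using w by (intro mult_left_mono of_nat_mono) auto
  moreover have "w * real (\<kappa> * L) \<le> w * real N" using w N by (intro mult_left_mono of_nat_mono) auto
  ultimately show ?thesis using kL by linarith
qed

context product_model begin

text \<open>
  The induction starts from slope \<open>2\<close>, at which no walk is fast.
\<close>

lemma slow_descent:
  assumes g: "q * real m \<le> g" "0 \<le> g" and w0: "0 < w0" "w0 \<le> 2" and K: "large_ratio g w0 K"
  shows "slow (K ^ (i + 2)) (max w0 (2 - real i / real K)) (1 / real K ^ 8)"
proof (induction i)
  case 0
  have K0: "0 < K" using K unfolding large_ratio_def by simp
  have "\<not> fast f (K\<^sup>2) 2 0 u" for f u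
  proof -
    have "real_of_int (walk f 0 u (K\<^sup>2) - u) \<le> real (K\<^sup>2)" using walk_range[of f 0 u "K\<^sup>2"] by linarith
    moreover have "0 < real (K\<^sup>2)" using K0 by simp
    ultimately show ?thesis unfolding fast_def by linarith
  qed
  then have "slow (K\<^sup>2) 2 (1 / real K ^ 8)" unfolding slow_def by simp
  then show ?case using w0 by (simp add: max_def power2_eq_square)
next
  case (Suc i)
  let ?w = "max w0 (2 - real i / real K)"
  have K0: "278 \<le> K" using K unfolding large_ratio_def by simp
  have "K\<^sup>2 \<le> K ^ (i + 2)" by (rule power_increasing) (use K0 in auto)
  then have "slow (K * K ^ (i + 2)) (?w - 1 / K) (1 / real (2 * K) ^ 8)"
    using g w0 K Suc by (intro renormalisation_step[where g=g and ?w0.0=w0]) auto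
  moreover have "?w - 1 / K \<le> max w0 (2 - real (Suc i) / real K)"
  proof -
    have "max w (2 - u) - d \<le> max w (2 - (u + d))" if "0 \<le> d" for w u d :: real
      using that by (auto simp: max_def)
    moreover have "real (Suc i) / real K = real i / real K + 1 / real K" by (simp add: add_divide_distrib)
    ultimately show ?thesis by simp
  qed
  moreover have "1 / real (2 * K) ^ 8 \<le> 1 / real K ^ 8" using K0 by (intro frac_le power_mono) auto
  ultimately show ?case using slow_mono by simp
qed

text \<open>
  Here the gain of \<open>1 / K\<close> in the slope is given away, and the better bound on the probability is kept.
\<close>

lemma slow_scale:
  assumes g: "q * real m \<le> g" "0 \<le> g" and w0: "0 < w0" "w0 \<le> 2" and K: "\<And>K'. K \<le> K' \<Longrightarrow> large_ratio g w0 K'"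
  shows "slow (block_scale K k) w0 (1 / real (2 ^ k * K) ^ 8)" "(2 ^ k * K)\<^sup>2 \<le> block_scale K k"
proof -
  have K278: "278 \<le> K" using K[of K] unfolding large_ratio_def by simp
  have "slow (block_scale K k) w0 (1 / real (2 ^ k * K) ^ 8) \<and> (2 ^ k * K)\<^sup>2 \<le> block_scale K k"
  proof (induction k)
    case 0
    have "slow (K ^ (2 * K + 2)) (max w0 (2 - real (2 * K) / real K)) (1 / real K ^ 8)"
      by (rule slow_descent[OF g w0 K]) simp
    moreover have "max w0 (2 - real (2 * K) / real K) = w0" using K278 w0 by simp
    moreover have "K\<^sup>2 \<le> K ^ (2 * K + 2)" by (rule power_increasing) (use K278 in auto)
    ultimately show ?case by simp
  next
    case (Suc k)
    let ?\<kappa> = "2 ^ k * K"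
    have \<kappa>: "K \<le> ?\<kappa>" by simp
    have "slow (?\<kappa> * block_scale K k) (w0 - 1 / real ?\<kappa>) (1 / real (2 * ?\<kappa>) ^ 8)"
      using g w0 K[OF \<kappa>] Suc by (intro renormalisation_step[where g=g and ?w0.0=w0]) auto
    then have "slow (block_scale K (Suc k)) w0 (1 / real (2 ^ Suc k * K) ^ 8)"
      by (intro slow_mono[of "block_scale K (Suc k)" "w0 - 1 / real ?\<kappa>" "1 / real (2 * ?\<kappa>) ^ 8" w0]) (simp_all add: ac_simps)
    moreover have "(2 ^ Suc k * K)\<^sup>2 \<le> block_scale K (Suc k)"
    proof -
      have "(2 ^ Suc k * K)\<^sup>2 = 4 * ?\<kappa>\<^sup>2" by (simp add: power_mult_distrib)
      also have "\<dots> \<le> ?\<kappa> * block_scale K k" using Suc \<kappa> K278 by (intro mult_le_mono) linarith+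
      finally show ?thesis by simp
    qed
    ultimately show ?case by blast
  qed
  then show "slow (block_scale K k) w0 (1 / real (2 ^ k * K) ^ 8)" "(2 ^ k * K)\<^sup>2 \<le> block_scale K k" by blast+
qed

lemma walk_path_depends:
  assumes "\<And>f g. (\<And>l. l \<le> k \<Longrightarrow> f l = g l) \<Longrightarrow> P f = P g"
  shows "depends_on (coords_near y (int (k + m * k + 1)) (m * k)) (\<lambda>a. P (walk (arrow m a) 0 y))"
proof (rule depends_onI)
  fix a b :: "coord \<Rightarrow> bool"
  assume ab: "\<And>i. i \<in> coords_near y (int (k + m * k + 1)) (m * k) \<Longrightarrow> a i = b i"
  have "walk (arrow m a) 0 y l = walk (arrow m b) 0 y l" if "l \<le> k" for l
    using arrow_walk_cong[of y k m 0 a b l] ab m that by simp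
  then show "P (walk (arrow m a) 0 y) = P (walk (arrow m b) 0 y)" by (rule assms)
qed

text \<open>
  A union bound over \<open>2 * \<kappa>\<^sup>2\<close> blocks and \<open>O(\<kappa> ^ 3)\<close> grid points for each, where \<open>\<kappa> = 2 ^ k * K\<close>. Each
  block is fast with probability at most \<open>\<kappa> ^ (-8)\<close>.
\<close>

lemma Pr_excursion_up:
  assumes g: "q * real m \<le> g" "0 \<le> g" and w0: "0 < w0" "w0 \<le> 2" and K: "\<And>K'. K \<le> K' \<Longrightarrow> large_ratio g w0 K'"
  shows "Pr (\<lambda>a. \<exists>N\<in>{block_scale K (Suc k)..<block_scale K (Suc (Suc k))}. real_of_int (walk (arrow m a) 0 0 N) > 3 * w0 * real N)
    \<le> 18 * (1 / 2) ^ k"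
proof -
  define \<kappa> where "\<kappa> = 2 ^ k * K"
  define L where "L = block_scale K k"
  define d where "d = L div (2 * \<kappa>)"
  define J where "J = 2 * \<kappa>\<^sup>2"
  let ?I = "{..<J} \<times> grid_range J L d"
  have K\<kappa>: "K \<le> \<kappa>" unfolding \<kappa>_def by simp
  then have \<kappa>278: "278 \<le> \<kappa>" and \<kappa>w: "1 \<le> real \<kappa> * w0" using K[of \<kappa>] unfolding large_ratio_def by auto
  have sl: "slow L w0 (1 / real \<kappa> ^ 8)" and L2: "\<kappa>\<^sup>2 \<le> L"
    using slow_scale[OF g w0, of K k, OF K] unfolding L_def \<kappa>_def by auto
  have "4 * \<kappa> \<le> \<kappa> * \<kappa>" using \<kappa>278 by (intro mult_le_mono1) simp
  then have L4: "4 * \<kappa> \<le> L" using L2 unfolding power2_eq_square by linarith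
  have s1: "block_scale K (Suc k) = \<kappa> * L" unfolding \<kappa>_def L_def by simp
  have s2: "block_scale K (Suc (Suc k)) = J * L" unfolding J_def \<kappa>_def L_def by (simp add: power2_eq_square)
  have "Pr (\<lambda>a. \<exists>N\<in>{block_scale K (Suc k)..<block_scale K (Suc (Suc k))}. real_of_int (walk (arrow m a) 0 0 N) > 3 * w0 * real N)
      \<le> prob (\<Union>c\<in>?I. {a. fast (arrow m a) L w0 (fst c * L) (grid_point 0 L d (fst c) (snd c))})"
  proof (rule finite_measure_mono)
    show "(\<Union>c\<in>?I. {a. fast (arrow m a) L w0 (fst c * L) (grid_point 0 L d (fst c) (snd c))}) \<in> events"
      by (rule sets.finite_UN) (auto simp: grid_range_def intro: fast_events)
    show "{a. \<exists>N\<in>{block_scale K (Suc k)..<block_scale K (Suc (Suc k))}. real_of_int (walk (arrow m a) 0 0 N) > 3 * w0 * real N}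
      \<subseteq> (\<Union>c\<in>?I. {a. fast (arrow m a) L w0 (fst c * L) (grid_point 0 L d (fst c) (snd c))})"
    proof (rule subsetI, rule ccontr)
      fix a assume "a \<in> {a. \<exists>N\<in>{block_scale K (Suc k)..<block_scale K (Suc (Suc k))}. real_of_int (walk (arrow m a) 0 0 N) > 3 * w0 * real N}"
        and no: "a \<notin> (\<Union>c\<in>?I. {a. fast (arrow m a) L w0 (fst c * L) (grid_point 0 L d (fst c) (snd c))})"
      then obtain N where N: "\<kappa> * L \<le> N" "N < J * L" "real_of_int (walk (arrow m a) 0 0 N) > 3 * w0 * real N"
        unfolding s1 s2 by auto
      have "real_of_int (walk (arrow m a) 0 0 N) \<le> 3 * w0 * real N"
      proof (rule walk_bound_between_scales[OF L4 _ \<kappa>w w0(1)])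
        show "\<not> fast (arrow m a) L w0 (i * L) (grid_point 0 L (L div (2 * \<kappa>)) i z)"
          if "i < 2 * \<kappa>\<^sup>2" "z \<in> grid_range (2 * \<kappa>\<^sup>2) L (L div (2 * \<kappa>))" for i z
        proof
          assume f: "fast (arrow m a) L w0 (i * L) (grid_point 0 L (L div (2 * \<kappa>)) i z)"
          have "(i, z) \<in> ?I" using that unfolding J_def d_def by simp
          then have "a \<in> (\<Union>c\<in>?I. {a. fast (arrow m a) L w0 (fst c * L) (grid_point 0 L d (fst c) (snd c))})"
            by (rule UN_I) (use f in \<open>simp add: d_def\<close>)
          with no show False by contradiction
        qed
      qed (use N \<kappa>278 in \<open>auto simp: J_def\<close>)
      with N(3) show False by linarith
    qed
  qed
  also have "\<dots> \<le> (\<Sum>c\<in>?I. Pr (\<lambda>a. fast (arrow m a) L w0 (fst c * L) (grid_point 0 L d (fst c) (snd c))))"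
    by (rule finite_measure_subadditive_finite) (auto simp: grid_range_def intro: fast_events)
  also have "\<dots> \<le> (\<Sum>c\<in>?I. 1 / real \<kappa> ^ 8)"
  proof (rule sum_mono)
    fix c
    show "Pr (\<lambda>a. fast (arrow m a) L w0 (fst c * L) (grid_point 0 L d (fst c) (snd c))) \<le> 1 / real \<kappa> ^ 8"
      using sl unfolding slow_def Pr_fast_stationary[of L w0 "fst c * L"] by blast
  qed
  also have "\<dots> = real J * real (card (grid_range J L d)) * (1 / real \<kappa> ^ 8)"
    by (simp add: card_cartesian_product)
  also have "\<dots> \<le> (2 * real \<kappa> ^ 2 * (9 * real \<kappa> ^ 3)) * (1 / real \<kappa> ^ 8)"
  proof (intro mult_right_mono mult_mono)
    have "real (card (grid_range J L d)) \<le> 4 * real J * real \<kappa> + 2"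
      unfolding d_def by (rule card_grid_range[OF L4]) (use \<kappa>278 in simp)
    also have "\<dots> = 8 * real \<kappa> ^ 3 + 2" unfolding J_def by (simp add: power2_eq_square power3_eq_cube)
    also have "\<dots> \<le> 9 * real \<kappa> ^ 3"
    proof -
      have "(2::real) ^ 3 \<le> real \<kappa> ^ 3" using \<kappa>278 by (intro power_mono) auto
      then show ?thesis by simp
    qed
    finally show "real (card (grid_range J L d)) \<le> 9 * real \<kappa> ^ 3" .
  qed (simp_all add: J_def)
  also have "\<dots> = 18 * (1 / real \<kappa> ^ 3)"
  proof -
    have "(2 * x ^ 2 * (9 * x ^ 3)) * (1 / x ^ 8) = 18 * (1 / x ^ 3)" if "0 < x" for x :: real
    proof -
      have "18 * x ^ 5 / x ^ 8 = 18 / x ^ 3" using that by (subst frac_eq_eq) simp_all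
      then show ?thesis by simp
    qed
    then show ?thesis using \<kappa>278 by simp
  qed
  also have "\<dots> \<le> 18 * (1 / 2) ^ k"
  proof -
    have "1 \<le> K" using K[of K] unfolding large_ratio_def by simp
    then have "2 ^ k * 1 \<le> \<kappa>" unfolding \<kappa>_def by (intro mult_le_mono2)
    then have k2: "(2::real) ^ k \<le> real \<kappa>" using of_nat_mono[of "2 ^ k" \<kappa>, where 'a=real] by simp
    have "real \<kappa> \<le> real \<kappa> ^ 3" by (rule self_le_power) (use \<kappa>278 in auto)
    with k2 have "(2::real) ^ k \<le> real \<kappa> ^ 3" by (rule order.trans)
    then have "1 / real \<kappa> ^ 3 \<le> 1 / 2 ^ k" by (intro frac_le) auto
    then show ?thesis by (simp add: power_one_over)
  qed
  finally show ?thesis .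
qed

lemma Pr_excursion:
  assumes g: "q * real m \<le> g" "0 \<le> g" and w0: "0 < w0" "w0 \<le> 2" and K: "\<And>K'. K \<le> K' \<Longrightarrow> large_ratio g w0 K'"
  shows "Pr (\<lambda>a. \<exists>N\<in>{block_scale K (Suc k)..<block_scale K (Suc (Suc k))}. \<bar>real_of_int (walk (arrow m a) 0 0 N)\<bar> > 3 * w0 * real N)
    \<le> 36 * (1 / 2) ^ k"
proof -
  let ?T = "block_scale K (Suc (Suc k))"
  let ?A = "{block_scale K (Suc k)..<?T}"
  let ?up = "\<lambda>X. \<exists>N\<in>?A. real_of_int (X N) > 3 * w0 * real N"
  let ?down = "\<lambda>X. \<exists>N\<in>?A. real_of_int (- X N) > 3 * w0 * real N"
  have dep: "depends_on (coords_near 0 (int (?T + m * ?T + 1)) (m * ?T)) (\<lambda>a. ?up (walk (arrow m a) 0 0))"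
    by (rule walk_path_depends) auto
  have dep': "depends_on (coords_near 0 (int (?T + m * ?T + 1)) (m * ?T)) (\<lambda>a. ?down (walk (arrow m a) 0 0))"
    by (rule walk_path_depends) auto
  have "Pr (\<lambda>a. ?up (walk (arrow m a) 0 0)) = prob {a\<in>space \<Omega>. ?up (walk (arrow m (\<lambda>i. reflect 0 a i)) 0 0)}"
    by (rule Pr_transfer[OF prob_space_axioms reflect_family finite_coords_near subset_UNIV dep, symmetric])
  also have "\<dots> = Pr (\<lambda>a. ?down (walk (arrow m a) 0 0))" by (simp add: walk_arrow_reflect)
  finally have eq: "Pr (\<lambda>a. ?down (walk (arrow m a) 0 0)) = Pr (\<lambda>a. ?up (walk (arrow m a) 0 0))" by simp
  have "Pr (\<lambda>a. \<exists>N\<in>?A. \<bar>real_of_int (walk (arrow m a) 0 0 N)\<bar> > 3 * w0 * real N)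
     \<le> Pr (\<lambda>a. ?up (walk (arrow m a) 0 0)) + Pr (\<lambda>a. ?down (walk (arrow m a) 0 0))"
  proof (rule Pr_union_bound)
    fix a assume "\<exists>N\<in>?A. \<bar>real_of_int (walk (arrow m a) 0 0 N)\<bar> > 3 * w0 * real N"
    then obtain N where N: "N \<in> ?A" "\<bar>real_of_int (walk (arrow m a) 0 0 N)\<bar> > 3 * w0 * real N" by blast
    then have "real_of_int (walk (arrow m a) 0 0 N) > 3 * w0 * real N \<or> real_of_int (- walk (arrow m a) 0 0 N) > 3 * w0 * real N"
      by (simp add: abs_if split: if_splits)
    then show "?up (walk (arrow m a) 0 0) \<or> ?down (walk (arrow m a) 0 0)" using N(1) by blast
  qed (rule depends_on_events[OF finite_coords_near dep] depends_on_events[OF finite_coords_near dep'])+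
  then show ?thesis using eq Pr_excursion_up[OF g w0, of K k, OF K] by linarith
qed

end

section \<open>The exchange dynamics on a time grid\<close>

definition cell :: "nat \<Rightarrow> nat \<Rightarrow> real set" where
  "cell m i = {real i / real m<..real (Suc i) / real m}"

text \<open>
  Just before the only ring both sites still have their old values, and after it both keep the
  exchanged ones.
\<close>

lemma exchange_edge:
  assumes ed: "exchange_dynamics T \<xi>" and a: "0 \<le> a"
    and one: "T e \<inter> {a<..b} = {\<tau>}" and none: "T (e - 1) \<inter> {a<..b} = {}" "T (e + 1) \<inter> {a<..b} = {}"
  shows "\<xi> b e = \<xi> a (e + 1)" "\<xi> b (e + 1) = \<xi> a e"
proof -
  have const: "\<xi> t x = \<xi> s x" if "0 \<le> s" "s \<le> t" "(T (x - 1) \<union> T x) \<inter> {s<..t} = {}" for x s t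
    using ed that unfolding exchange_dynamics_def by blast
  have \<tau>: "\<tau> \<in> T e" "a < \<tau>" "\<tau> \<le> b" using one by auto
  have swap: "\<forall>\<^sub>F s in at_left \<tau>. \<xi> \<tau> e = \<xi> s (e + 1) \<and> \<xi> \<tau> (e + 1) = \<xi> s e"
    using ed \<tau>(1) unfolding exchange_dynamics_def by blast
  have "\<forall>\<^sub>F s in at_left \<tau>. (\<xi> \<tau> e = \<xi> s (e + 1) \<and> \<xi> \<tau> (e + 1) = \<xi> s e) \<and> s \<in> {a<..<\<tau>}"
    by (rule eventually_conj[OF swap eventually_at_left_real[OF \<tau>(2)]])
  then obtain s where s: "\<xi> \<tau> e = \<xi> s (e + 1)" "\<xi> \<tau> (e + 1) = \<xi> s e" "a < s" "s < \<tau>"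
    using eventually_happens'[OF trivial_limit_at_left_real] by fastforce
  have only: "z = \<tau>" if "z \<in> T e" "a < z" "z \<le> b" for z using one that by (metis IntI greaterThanAtMost_iff singletonD)
  have not_before: "T e \<inter> {a<..s} = {}"
  proof (rule equals0I)
    fix z assume z: "z \<in> T e \<inter> {a<..s}"
    then have "z \<in> T e" "a < z" "z \<le> b" using s(4) \<tau>(3) by simp_all
    then have "z = \<tau>" by (rule only)
    with z s(4) show False by simp
  qed
  have not_after: "T e \<inter> {\<tau><..b} = {}"
  proof (rule equals0I)
    fix z assume z: "z \<in> T e \<inter> {\<tau><..b}"
    then have "z \<in> T e" "a < z" "z \<le> b" using \<tau>(2) by simp_all
    then have "z = \<tau>" by (rule only)
    with z show False by simp
  qed
  have "\<xi> s (e + 1) = \<xi> a (e + 1)" using s \<tau> a none(2) not_before by (intro const) auto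
  moreover have "\<xi> s e = \<xi> a e" using s \<tau> a none(1) not_before by (intro const) auto
  moreover have "\<xi> b e = \<xi> \<tau> e" using \<tau> a none(1) not_after by (intro const) auto
  moreover have "\<xi> b (e + 1) = \<xi> \<tau> (e + 1)" using \<tau> a none(2) not_after by (intro const) auto
  ultimately show "\<xi> b e = \<xi> a (e + 1)" "\<xi> b (e + 1) = \<xi> a e" using s by simp_all
qed

text \<open>
  The cells in which discrete stirring may differ from the exchange dynamics: an edge rings twice, or two
  neighbouring edges ring.
\<close>

definition crowded :: "(int \<Rightarrow> real set) \<Rightarrow> nat \<Rightarrow> nat \<Rightarrow> int \<Rightarrow> bool" where
  "crowded T m i e \<longleftrightarrow> 2 \<le> card (T e \<inter> cell m i) \<or> (T e \<inter> cell m i \<noteq> {} \<and> T (e + 1) \<inter> cell m i \<noteq> {})"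

lemma exchange_cell:
  assumes ed: "exchange_dynamics T \<xi>" and m: "0 < m" and fin: "\<And>e t. finite (T e \<inter> {..t})"
    and a: "\<And>i x. a (Clock i x) \<longleftrightarrow> T x \<inter> cell m i \<noteq> {}"
    and ok: "\<And>e. \<bar>e - x\<bar> \<le> 2 \<Longrightarrow> \<not> crowded T m i e"
  shows "\<xi> (real (Suc i) / real m) x = \<xi> (real i / real m) (stir a i x)"
proof -
  let ?a = "real i / real m" and ?b = "real (Suc i) / real m"
  have a0: "0 \<le> ?a" and ab: "?a \<le> ?b" by (simp_all add: divide_right_mono)
  have fin': "finite (T e \<inter> cell m i)" for e
    by (rule finite_subset[OF _ fin[of e ?b]]) (auto simp: cell_def)
  have single: "\<exists>\<tau>. T e \<inter> cell m i = {\<tau>}" if "T e \<inter> cell m i \<noteq> {}" "\<bar>e - x\<bar> \<le> 2" for e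
  proof -
    have "card (T e \<inter> cell m i) \<noteq> 0" using that(1) fin' by simp
    moreover have "\<not> 2 \<le> card (T e \<inter> cell m i)" using ok[OF that(2)] unfolding crowded_def by blast
    ultimately have "card (T e \<inter> cell m i) = 1" by linarith
    then show ?thesis by (auto simp: card_1_singleton_iff)
  qed
  have adj: "\<not> (T e \<inter> cell m i \<noteq> {} \<and> T (e + 1) \<inter> cell m i \<noteq> {})" if "\<bar>e - x\<bar> \<le> 2" for e
    using ok[OF that] unfolding crowded_def by blast
  consider (right) "T x \<inter> cell m i \<noteq> {}" | (left) "T x \<inter> cell m i = {}" "T (x - 1) \<inter> cell m i \<noteq> {}"
    | (stay) "T x \<inter> cell m i = {}" "T (x - 1) \<inter> cell m i = {}" by blast
  then show ?thesis
  proof cases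
    case right
    have n: "T (x - 1) \<inter> cell m i = {}" "T (x + 1) \<inter> cell m i = {}"
      using adj[of "x - 1"] adj[of x] right by auto
    obtain \<tau> where "T x \<inter> cell m i = {\<tau>}" using single[OF right] by auto
    then have "\<xi> ?b x = \<xi> ?a (x + 1)"
      using n unfolding cell_def by (rule exchange_edge(1)[OF ed a0])
    moreover have "stir a i x = x + 1" using right n unfolding stir_def swaps_def a by simp
    ultimately show ?thesis by simp
  next
    case left
    have n: "T (x - 1 - 1) \<inter> cell m i = {}" "T (x - 1 + 1) \<inter> cell m i = {}"
      using adj[of "x - 2"] left by auto
    obtain \<tau> where "T (x - 1) \<inter> cell m i = {\<tau>}" using single[OF left(2)] by auto
    then have "\<xi> ?b (x - 1 + 1) = \<xi> ?a (x - 1)"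
      using n unfolding cell_def by (rule exchange_edge(2)[OF ed a0])
    moreover have "stir a i x = x - 1" using left n unfolding stir_def swaps_def a by simp
    ultimately show ?thesis by simp
  next
    case stay
    have "(T (x - 1) \<union> T x) \<inter> {?a<..?b} = {}" using stay unfolding cell_def by blast
    then have "\<xi> ?b x = \<xi> ?a x" using ed a0 ab unfolding exchange_dynamics_def by blast
    moreover have "stir a i x = x" using stay unfolding stir_def swaps_def a by simp
    ultimately show ?thesis by simp
  qed
qed

lemma exchange_origin:
  assumes ed: "exchange_dynamics T \<xi>" and m: "0 < m" and fin: "\<And>e t. finite (T e \<inter> {..t})"
    and a: "\<And>i x. a (Clock i x) \<longleftrightarrow> T x \<inter> cell m i \<noteq> {}"
    and ok: "\<And>i e. i < j \<Longrightarrow> \<bar>e - c\<bar> \<le> R + 1 \<Longrightarrow> \<not> crowded T m i e"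
    and stays: "\<bar>frozen_origin R c a j x - c\<bar> < R"
  shows "\<xi> (real j / real m) x = \<xi> 0 (origin a j x)"
  using ok stays
proof (induction j arbitrary: x)
  case (Suc j)
  have x: "\<bar>x - c\<bar> < R" using Suc.prems(2) by (auto split: if_splits)
  have "\<xi> (real (Suc j) / real m) x = \<xi> (real j / real m) (stir a j x)"
    by (rule exchange_cell[OF ed m fin a]) (rule Suc.prems(1), use x in auto)
  also have "\<dots> = \<xi> 0 (origin a j (stir a j x))"
  proof (rule Suc.IH)
    show "\<not> crowded T m i e" if "i < j" "\<bar>e - c\<bar> \<le> R + 1" for i e using that by (intro Suc.prems(1)) auto
    show "\<bar>frozen_origin R c a j (stir a j x) - c\<bar> < R" using Suc.prems(2) x by simp
  qed
  finally show ?case by simp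
qed simp

context ssep begin

text \<open>
  The coordinates other than coins, as functions of the exclusion process. The value at coins is a
  dummy.
\<close>

fun field :: "nat \<Rightarrow> coord \<Rightarrow> 'a \<Rightarrow> bool" where
  "field m (Init x) \<omega> = \<eta> 0 x \<omega>"
| "field m (Clock i x) \<omega> = (T x \<omega> \<inter> cell m i \<noteq> {})"
| "field m (Coin n x) \<omega> = False"

lemmas clock_facts = clocks[unfolded poisson_point_process_def]

lemma clock_finite: "\<omega> \<in> space M \<Longrightarrow> finite (T x \<omega> \<inter> {..t})"
  by (rule clock_facts[THEN conjunct1, rule_format, THEN conjunct2, rule_format])

lemma cell_finite: "\<omega> \<in> space M \<Longrightarrow> finite (T x \<omega> \<inter> cell m i)"
  by (rule finite_subset[OF _ clock_finite]) (auto simp: cell_def)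

lemma cell_facts:
  assumes "0 < m"
  shows "cell m i \<in> sets borel" "bounded (cell m i)" "cell m i \<subseteq> {0<..}" "measure lborel (cell m i) = 1 / real m"
proof -
  have le: "real i / real m \<le> real (Suc i) / real m" by (simp add: divide_right_mono)
  show "cell m i \<in> sets borel" "bounded (cell m i)" unfolding cell_def by auto
  show "cell m i \<subseteq> {0<..}" unfolding cell_def by (auto intro: le_less_trans[rotated])
  show "measure lborel (cell m i) = 1 / real m"
    unfolding cell_def using le by (simp add: diff_divide_distrib[symmetric])
qed

lemma count_measurable:
  assumes "0 < m"
  shows "(\<lambda>\<omega>. card (T x \<omega> \<inter> cell m i)) \<in> measurable M (count_space UNIV)"
  by (rule clock_facts[THEN conjunct2, THEN conjunct1, rule_format, OF cell_facts(1,2)[OF assms]])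

lemma count_prob:
  assumes "0 < m"
  shows "prob {\<omega>\<in>space M. card (T x \<omega> \<inter> cell m i) = k} = (\<gamma> / m) ^ k / fact k * exp (- (\<gamma> / m))"
proof -
  have "prob {\<omega>\<in>space M. card (T x \<omega> \<inter> cell m i) = k} =
      (\<gamma> * measure lborel (cell m i)) ^ k / fact k * exp (- (\<gamma> * measure lborel (cell m i)))"
    by (rule clock_facts[THEN conjunct2, THEN conjunct2, THEN conjunct1, rule_format, OF cell_facts(1-3)[OF assms]])
  then show ?thesis unfolding cell_facts(4)[OF assms] by simp
qed

lemma counts_indep:
  assumes "0 < m"
  shows "indep_vars (\<lambda>_. count_space UNIV) (\<lambda>i \<omega>. card (T x \<omega> \<inter> cell m i)) {..<n}"
proof -
  have "disjoint_family_on (cell m) {..<n}"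
    unfolding disjoint_family_on_def
  proof (intro ballI impI)
    fix i j :: nat assume "i \<noteq> j"
    have "cell m i \<inter> cell m j = {}" if "i < j" for i j
    proof -
      have "real (Suc i) / real m \<le> real j / real m" using that by (intro divide_right_mono) auto
      then show ?thesis unfolding cell_def by auto
    qed
    from this[of i j] this[of j i] \<open>i \<noteq> j\<close> show "cell m i \<inter> cell m j = {}" by (cases "i < j") auto
  qed
  moreover have "\<forall>i<n. cell m i \<in> sets borel \<and> bounded (cell m i) \<and> cell m i \<subseteq> {0<..}"
    using cell_facts(1-3)[OF assms] by simp
  ultimately show ?thesis
    using clock_facts[of x, THEN conjunct2, THEN conjunct2, THEN conjunct2, THEN spec[of _ n], THEN spec[of _ "cell m"]] by simp
qed

lemma ring_prob:
  assumes "0 < m"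
  shows "prob {\<omega>\<in>space M. (T x \<omega> \<inter> cell m i \<noteq> {}) = b} = (if b then 1 - exp (- (\<gamma> / m)) else 1 - (1 - exp (- (\<gamma> / m))))"
proof -
  have empty: "{\<omega>\<in>space M. (T x \<omega> \<inter> cell m i \<noteq> {}) = False} = {\<omega>\<in>space M. card (T x \<omega> \<inter> cell m i) = 0}"
    using cell_finite by auto
  then have 0: "prob {\<omega>\<in>space M. (T x \<omega> \<inter> cell m i \<noteq> {}) = False} = exp (- (\<gamma> / m))"
    using count_prob[OF assms, of x i 0] by simp
  have ev: "{\<omega>\<in>space M. (T x \<omega> \<inter> cell m i \<noteq> {}) = False} \<in> events"
    unfolding empty using measurable_sets[OF count_measurable[OF assms, of x i], of "{0}"] by (simp add: vimage_def Int_def conj_commute)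
  have "{\<omega>\<in>space M. (T x \<omega> \<inter> cell m i \<noteq> {}) = True} = space M - {\<omega>\<in>space M. (T x \<omega> \<inter> cell m i \<noteq> {}) = False}" by auto
  then have "prob {\<omega>\<in>space M. (T x \<omega> \<inter> cell m i \<noteq> {}) = True} = 1 - exp (- (\<gamma> / m))"
    using prob_compl[OF ev] 0 by simp
  with 0 show ?thesis by (cases b) simp_all
qed

text \<open>
  The independence of the clocks is formulated in terms of their counting paths, so the rings
  must be expressed through these.
\<close>

lemma ring_counting_path:
  assumes w: "\<omega> \<in> space M"
  shows "T x \<omega> \<inter> cell m i \<noteq> {} \<longleftrightarrow>
    counting_path (T x \<omega>) (real i / real m) < counting_path (T x \<omega>) (real (Suc i) / real m)"
proof -
  let ?a = "real i / real m" and ?b = "real (Suc i) / real m"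
  have le: "0 \<le> ?a" "?a \<le> ?b" by (simp_all add: divide_right_mono)
  have split: "T x \<omega> \<inter> {0<..?b} = (T x \<omega> \<inter> {0<..?a}) \<union> (T x \<omega> \<inter> cell m i)"
    unfolding cell_def using le by (auto intro: le_less_trans[OF le(1)])
  have fin: "finite (T x \<omega> \<inter> {0<..?a})" by (rule finite_subset[OF _ clock_finite[OF w, of x ?a]]) auto
  have "card (T x \<omega> \<inter> {0<..?b}) = card (T x \<omega> \<inter> {0<..?a}) + card (T x \<omega> \<inter> cell m i)"
    unfolding split by (rule card_Un_disjoint[OF fin cell_finite[OF w]]) (auto simp: cell_def)
  then show ?thesis unfolding counting_path_def using le cell_finite[OF w, of x m i] by (simp add: card_gt_0_iff)
qed

lemma rings_prob:
  assumes m: "0 < m" and I: "finite I"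
  shows "prob {\<omega>\<in>space M. \<forall>i\<in>I. (T x \<omega> \<inter> cell m i \<noteq> {}) = b i}
    = (\<Prod>i\<in>I. if b i then 1 - exp (- (\<gamma> / m)) else 1 - (1 - exp (- (\<gamma> / m))))"
proof (cases "I = {}")
  case True then show ?thesis using prob_space by simp
next
  case False
  obtain n where n: "I \<subseteq> {..<n}" using I finite_nat_iff_bounded by blast
  have eq: "(\<lambda>\<omega>. card (T x \<omega> \<inter> cell m i)) -` {k. (k \<noteq> 0) = b i} \<inter> space M = {\<omega>\<in>space M. (T x \<omega> \<inter> cell m i \<noteq> {}) = b i}" for i
  proof (rule set_eqI)
    fix \<omega>
    show "\<omega> \<in> (\<lambda>\<omega>. card (T x \<omega> \<inter> cell m i)) -` {k. (k \<noteq> 0) = b i} \<inter> space M \<longleftrightarrow>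
        \<omega> \<in> {\<omega>\<in>space M. (T x \<omega> \<inter> cell m i \<noteq> {}) = b i}"
      by (cases "\<omega> \<in> space M") (simp_all add: cell_finite card_gt_0_iff)
  qed
  have "prob (\<Inter>i\<in>I. (\<lambda>\<omega>. card (T x \<omega> \<inter> cell m i)) -` {k. (k \<noteq> 0) = b i} \<inter> space M)
    = (\<Prod>i\<in>I. prob ((\<lambda>\<omega>. card (T x \<omega> \<inter> cell m i)) -` {k. (k \<noteq> 0) = b i} \<inter> space M))"
    by (rule indep_varsD[OF counts_indep[OF m] False I n]) simp
  moreover have "(\<Inter>i\<in>I. {\<omega>\<in>space M. (T x \<omega> \<inter> cell m i \<noteq> {}) = b i}) = {\<omega>\<in>space M. \<forall>i\<in>I. (T x \<omega> \<inter> cell m i \<noteq> {}) = b i}"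
    using False by auto
  ultimately show ?thesis unfolding eq ring_prob[OF m] by simp
qed

lemma init_prob:
  "prob {\<omega>\<in>space M. \<eta> 0 x \<omega> = b} = (if b then \<rho> else 1 - \<rho>)"
proof -
  have "measure (distr M (count_space UNIV) (\<eta> 0 x)) {b} = prob (\<eta> 0 x -` {b} \<inter> space M)"
    by (rule measure_distr) (simp_all add: measurable_eta)
  moreover have "\<eta> 0 x -` {b} \<inter> space M = {\<omega>\<in>space M. \<eta> 0 x \<omega> = b}" by blast
  ultimately have "prob {\<omega>\<in>space M. \<eta> 0 x \<omega> = b} = measure (distr M (count_space UNIV) (\<eta> 0 x)) {b}"
    by (simp only:)
  also have "\<dots> = pmf (bernoulli_pmf \<rho>) b" unfolding initial_law by (rule measure_pmf_single)
  finally show ?thesis using density by (cases b) simp_all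
qed

lemma inits_prob:
  assumes I: "finite I"
  shows "prob {\<omega>\<in>space M. \<forall>x\<in>I. \<eta> 0 x \<omega> = b x} = (\<Prod>x\<in>I. if b x then \<rho> else 1 - \<rho>)"
proof (cases "I = {}")
  case True then show ?thesis using prob_space by simp
next
  case False
  have eq: "\<eta> 0 x -` {b x} \<inter> space M = {\<omega>\<in>space M. \<eta> 0 x \<omega> = b x}" for x by auto
  have "prob (\<Inter>x\<in>I. \<eta> 0 x -` {b x} \<inter> space M) = (\<Prod>x\<in>I. prob (\<eta> 0 x -` {b x} \<inter> space M))"
    by (rule indep_varsD[OF initial_indep False I]) simp_all
  moreover have "(\<Inter>x\<in>I. {\<omega>\<in>space M. \<eta> 0 x \<omega> = b x}) = {\<omega>\<in>space M. \<forall>x\<in>I. \<eta> 0 x \<omega> = b x}"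
    using False by auto
  ultimately show ?thesis unfolding eq init_prob by simp
qed

end

section \<open>The law of the rings on the time grid\<close>

definition environment_coord :: "coord \<Rightarrow> bool" where
  "environment_coord i \<longleftrightarrow> (\<forall>n x. i \<noteq> Coin n x)"

lemma environment_coord_simps [simp]:
  "environment_coord (Init x)" "environment_coord (Clock i x)" "\<not> environment_coord (Coin n x)"
  by (simp_all add: environment_coord_def)

context ssep begin

definition ring_probability :: "nat \<Rightarrow> real" where "ring_probability m = 1 - exp (- (\<gamma> / real m))"

definition rings_event :: "nat \<Rightarrow> int set \<Rightarrow> (int \<Rightarrow> nat set) \<Rightarrow> (int \<Rightarrow> nat \<Rightarrow> bool) \<Rightarrow> 'a set" where
  "rings_event m X I b = {\<omega>\<in>space M. \<forall>x\<in>X. \<forall>i\<in>I x. (T x \<omega> \<inter> cell m i \<noteq> {}) = b x i}"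

definition ring_paths :: "nat \<Rightarrow> nat set \<Rightarrow> (nat \<Rightarrow> bool) \<Rightarrow> (real \<Rightarrow> nat) set" where
  "ring_paths m I b = {f\<in>space counting_space. \<forall>i\<in>I. (f (real i / real m) < f (real (Suc i) / real m)) = b i}"

lemma ring_paths_sets:
  assumes "finite I"
  shows "ring_paths m I b \<in> sets counting_space"
proof -
  have coord: "(\<lambda>f. f t) \<in> measurable counting_space (count_space UNIV)" if "0 \<le> t" for t
    using that by (intro measurable_component_singleton) simp
  have level: "{f\<in>space counting_space. P (f t)} \<in> sets counting_space" if "0 \<le> t" for P and t
  proof -
    have "(\<lambda>f. f t) -` {k. P k} \<inter> space counting_space \<in> sets counting_space"
      by (rule measurable_sets[OF coord[OF that]]) simp
    moreover have "(\<lambda>f. f t) -` {k. P k} \<inter> space counting_space = {f\<in>space counting_space. P (f t)}" by blast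
    ultimately show ?thesis by (simp only:)
  qed
  have one: "{f\<in>space counting_space. (f s < f t) = c} \<in> sets counting_space" if "0 \<le> s" "0 \<le> t" for s t c
  proof -
    have "{f\<in>space counting_space. (f s < f t) = c} =
        (\<Union>k. {f\<in>space counting_space. f s = k} \<inter> {f\<in>space counting_space. (k < f t) = c})" by blast
    moreover have "(\<Union>k. {f\<in>space counting_space. f s = k} \<inter> {f\<in>space counting_space. (k < f t) = c}) \<in> sets counting_space"
      by (intro sets.countable_UN subsetI, elim imageE, simp only:) (intro sets.Int level that)
    ultimately show ?thesis by (simp only:)
  qed
  show ?thesis
    unfolding ring_paths_def by (rule sets.sets_Collect_finite_All[OF _ assms]) (rule one, simp_all)
qed

lemma counting_path_space: "counting_path S \<in> space counting_space"
  unfolding counting_path_def space_PiM by simp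

lemma ring_paths_iff:
  assumes "\<omega> \<in> space M"
  shows "counting_path (T x \<omega>) \<in> ring_paths m I b \<longleftrightarrow> (\<forall>i\<in>I. (T x \<omega> \<inter> cell m i \<noteq> {}) = b i)"
  unfolding ring_paths_def ring_counting_path[OF assms] mem_Collect_eq using counting_path_space by (simp only: simp_thms)

lemma ring_paths_vimage:
  "(\<lambda>\<omega>. counting_path (T x \<omega>)) -` ring_paths m I b \<inter> space M = {\<omega>\<in>space M. \<forall>i\<in>I. (T x \<omega> \<inter> cell m i \<noteq> {}) = b i}"
  by (rule set_eqI) (simp only: vimage_eq Int_iff mem_Collect_eq ring_paths_iff conj_commute cong: conj_cong)

lemma rings_event_prob:
  assumes m: "0 < m" and X: "finite X" and I: "\<And>x. finite (I x)"
  shows "prob (rings_event m X I b) = (\<Prod>x\<in>X. \<Prod>i\<in>I x. if b x i then ring_probability m else 1 - ring_probability m)"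
proof (cases "X = {}")
  case True then show ?thesis unfolding rings_event_def using prob_space by simp
next
  case False
  have "prob (\<Inter>x\<in>X. (\<lambda>\<omega>. counting_path (T x \<omega>)) -` ring_paths m (I x) (b x) \<inter> space M)
    = (\<Prod>x\<in>X. prob ((\<lambda>\<omega>. counting_path (T x \<omega>)) -` ring_paths m (I x) (b x) \<inter> space M))"
    by (rule indep_varsD[OF clocks_indep False X subset_UNIV]) (rule ring_paths_sets[OF I])
  also have "(\<Inter>x\<in>X. (\<lambda>\<omega>. counting_path (T x \<omega>)) -` ring_paths m (I x) (b x) \<inter> space M) = rings_event m X I b"
    unfolding ring_paths_vimage rings_event_def using False by auto
  finally show ?thesis unfolding ring_paths_vimage rings_prob[OF m I] ring_probability_def .
qed

lemma init_rings_indep: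
  assumes m: "0 < m" and X: "finite X" and I: "\<And>x. finite (I x)" and Y: "finite Y"
  shows "{\<omega>\<in>space M. \<forall>x\<in>Y. \<eta> 0 x \<omega> = c x} \<in> events" "rings_event m X I b \<in> events"
    "prob ({\<omega>\<in>space M. \<forall>x\<in>Y. \<eta> 0 x \<omega> = c x} \<inter> rings_event m X I b)
    = prob {\<omega>\<in>space M. \<forall>x\<in>Y. \<eta> 0 x \<omega> = c x} * prob (rings_event m X I b)"
proof -
  let ?V1 = "vimage_algebra (space M) (\<lambda>\<omega> x. \<eta> 0 x \<omega>) (\<Pi>\<^sub>M x\<in>UNIV. count_space UNIV)"
  let ?V2 = "vimage_algebra (space M) (\<lambda>\<omega> x. counting_path (T x \<omega>)) (\<Pi>\<^sub>M x\<in>(UNIV::int set). counting_space)"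
  let ?A1 = "{f\<in>space (\<Pi>\<^sub>M x\<in>(UNIV::int set). count_space (UNIV::bool set)). \<forall>x\<in>Y. f x = c x}"
  let ?A2 = "{F\<in>space (\<Pi>\<^sub>M x\<in>(UNIV::int set). counting_space). \<forall>x\<in>X. F x \<in> ring_paths m (I x) (b x)}"
  have "?A1 \<in> sets (\<Pi>\<^sub>M x\<in>(UNIV::int set). count_space (UNIV::bool set))"
    by (rule sets.sets_Collect_finite_All[OF _ Y]) measurable
  then have "(\<lambda>\<omega> x. \<eta> 0 x \<omega>) -` ?A1 \<inter> space M \<in> sets ?V1" by (rule in_vimage_algebra)
  moreover have "(\<lambda>\<omega> x. \<eta> 0 x \<omega>) -` ?A1 \<inter> space M = {\<omega>\<in>space M. \<forall>x\<in>Y. \<eta> 0 x \<omega> = c x}"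
    by (auto simp: space_PiM)
  ultimately have 1: "{\<omega>\<in>space M. \<forall>x\<in>Y. \<eta> 0 x \<omega> = c x} \<in> sets ?V1" by simp
  have "?A2 \<in> sets (\<Pi>\<^sub>M x\<in>(UNIV::int set). counting_space)"
  proof (rule sets.sets_Collect_finite_All[OF _ X])
    fix x
    have coord: "(\<lambda>F. F x) \<in> measurable (\<Pi>\<^sub>M x\<in>(UNIV::int set). counting_space) counting_space"
      by (rule measurable_component_singleton) simp
    have "(\<lambda>F. F x) -` ring_paths m (I x) (b x) \<inter> space (\<Pi>\<^sub>M x\<in>(UNIV::int set). counting_space) \<in> sets (\<Pi>\<^sub>M x\<in>(UNIV::int set). counting_space)"
      by (rule measurable_sets[OF coord ring_paths_sets[OF I]])
    moreover have "(\<lambda>F. F x) -` ring_paths m (I x) (b x) \<inter> space (\<Pi>\<^sub>M x\<in>(UNIV::int set). counting_space)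
      = {F\<in>space (\<Pi>\<^sub>M x\<in>(UNIV::int set). counting_space). F x \<in> ring_paths m (I x) (b x)}" by blast
    ultimately show "{F\<in>space (\<Pi>\<^sub>M x\<in>(UNIV::int set). counting_space). F x \<in> ring_paths m (I x) (b x)} \<in> sets (\<Pi>\<^sub>M x\<in>(UNIV::int set). counting_space)"
      by (simp only:)
  qed
  then have "(\<lambda>\<omega> x. counting_path (T x \<omega>)) -` ?A2 \<inter> space M \<in> sets ?V2" by (rule in_vimage_algebra)
  moreover have "(\<lambda>\<omega> x. counting_path (T x \<omega>)) -` ?A2 \<inter> space M = rings_event m X I b"
  proof -
    have sp: "(\<lambda>x. counting_path (T x \<omega>)) \<in> space (\<Pi>\<^sub>M x\<in>(UNIV::int set). counting_space)" for \<omega>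
      unfolding counting_path_def space_PiM by (simp add: PiE_UNIV_domain)
    show ?thesis unfolding rings_event_def
      by (rule set_eqI) (simp only: vimage_eq Int_iff mem_Collect_eq ring_paths_iff sp simp_thms conj_commute cong: conj_cong)
  qed
  ultimately have 2: "rings_event m X I b \<in> sets ?V2" by simp
  have ind: "indep_set (sets ?V1) (sets ?V2)" by (rule initial_clocks_indep)
  show "prob ({\<omega>\<in>space M. \<forall>x\<in>Y. \<eta> 0 x \<omega> = c x} \<inter> rings_event m X I b)
    = prob {\<omega>\<in>space M. \<forall>x\<in>Y. \<eta> 0 x \<omega> = c x} * prob (rings_event m X I b)"
    by (rule indep_setD[OF ind 1 2])
  show "{\<omega>\<in>space M. \<forall>x\<in>Y. \<eta> 0 x \<omega> = c x} \<in> events" "rings_event m X I b \<in> events"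
    using indep_setD_ev1[OF ind] indep_setD_ev2[OF ind] 1 2 by auto
qed

text \<open>
  The weights are those of \<open>product_model\<close>, with its parameter \<open>p\<close> for the coins left open.
\<close>

lemma field_family:
  assumes m: "0 < m"
  shows "bernoulli_family M {i. environment_coord i} (field m)
    (\<lambda>i. case i of Init x \<Rightarrow> \<rho> | Clock j x \<Rightarrow> ring_probability m | Coin n x \<Rightarrow> p)"
  unfolding bernoulli_family_def
proof (intro allI impI)
  fix J :: "coord set" and v assume J: "finite J" "J \<subseteq> {i. environment_coord i}"
  let ?w = "\<lambda>i. case i of Init x \<Rightarrow> \<rho> | Clock j x \<Rightarrow> ring_probability m | Coin n x \<Rightarrow> p"
  define Y where "Y = {x. Init x \<in> J}"
  define X where "X = {x. \<exists>i. Clock i x \<in> J}"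
  define I where "I x = {i. Clock i x \<in> J}" for x
  have "Y = Init -` J" unfolding Y_def by auto
  then have Y: "finite Y" using J by (simp add: finite_vimageI inj_def)
  have "I x = (\<lambda>i. Clock i x) -` J" for x unfolding I_def by auto
  then have I: "finite (I x)" for x using J by (simp add: finite_vimageI inj_def)
  have "X \<subseteq> (\<lambda>k. case k of Clock i x \<Rightarrow> x) ` J" unfolding X_def by (force simp: image_iff)
  then have X: "finite X" using J finite_surj by blast
  let ?A = "{\<omega>\<in>space M. \<forall>x\<in>Y. \<eta> 0 x \<omega> = v (Init x)}" and ?R = "rings_event m X I (\<lambda>x i. v (Clock i x))"
  have J_eq: "J = Init ` Y \<union> (\<lambda>(x, i). Clock i x) ` Sigma X I"
  proof (rule set_eqI)
    fix k
    show "k \<in> J \<longleftrightarrow> k \<in> Init ` Y \<union> (\<lambda>(x, i). Clock i x) ` Sigma X I"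
      using J(2) by (cases k) (auto simp: Y_def X_def I_def image_iff)
  qed
  have eq: "{\<omega>\<in>space M. \<forall>i\<in>J. field m i \<omega> = v i} = ?A \<inter> ?R"
  proof (rule set_eqI)
    fix \<omega>
    have "(\<forall>i\<in>J. field m i \<omega> = v i) \<longleftrightarrow> (\<forall>x\<in>Y. \<eta> 0 x \<omega> = v (Init x)) \<and> (\<forall>x\<in>X. \<forall>i\<in>I x. (T x \<omega> \<inter> cell m i \<noteq> {}) = v (Clock i x))"
      unfolding J_eq by (auto simp: ball_Un)
    then show "\<omega> \<in> {\<omega>\<in>space M. \<forall>i\<in>J. field m i \<omega> = v i} \<longleftrightarrow> \<omega> \<in> ?A \<inter> ?R"
      unfolding rings_event_def by blast
  qed
  note ind = init_rings_indep[OF m X I Y]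
  have "prob (?A \<inter> ?R) = prob ?A * prob ?R" by (rule ind(3))
  also have "\<dots> = (\<Prod>x\<in>Y. if v (Init x) then \<rho> else 1 - \<rho>) * (\<Prod>x\<in>X. \<Prod>i\<in>I x. if v (Clock i x) then ring_probability m else 1 - ring_probability m)"
    unfolding rings_event_prob[OF m X I] inits_prob[OF Y] ..
  also have "(\<Prod>x\<in>X. \<Prod>i\<in>I x. if v (Clock i x) then ring_probability m else 1 - ring_probability m)
      = (\<Prod>k\<in>(\<lambda>(x, i). Clock i x) ` Sigma X I. if v k then ?w k else 1 - ?w k)"
  proof -
    have "inj_on (\<lambda>(x, i). Clock i x) (Sigma X I)" by (auto simp: inj_on_def)
    then show ?thesis using X I by (simp add: prod.reindex prod.Sigma case_prod_unfold cong: if_cong)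
  qed
  also have "(\<Prod>x\<in>Y. if v (Init x) then \<rho> else 1 - \<rho>) = (\<Prod>k\<in>Init ` Y. if v k then ?w k else 1 - ?w k)"
    by (simp add: prod.reindex inj_on_def cong: if_cong)
  also have "(\<Prod>k\<in>Init ` Y. if v k then ?w k else 1 - ?w k) * (\<Prod>k\<in>(\<lambda>(x, i). Clock i x) ` Sigma X I. if v k then ?w k else 1 - ?w k)
      = (\<Prod>i\<in>J. if v i then ?w i else 1 - ?w i)"
    unfolding J_eq using X Y I by (intro prod.union_disjoint[symmetric]) auto
  finally have P: "prob (?A \<inter> ?R) = (\<Prod>i\<in>J. if v i then ?w i else 1 - ?w i)" .
  have "?A \<in> events" by (rule ind(1))
  moreover have "?R \<in> events" by (rule init_rings_indep(2)[OF m X I Y])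
  ultimately have "?A \<inter> ?R \<in> events" by (rule sets.Int)
  then show "{\<omega>\<in>space M. \<forall>i\<in>J. field m i \<omega> = v i} \<in> events \<and>
    prob {\<omega>\<in>space M. \<forall>i\<in>J. field m i \<omega> = v i} = (\<Prod>i\<in>J. if v i then ?w i else 1 - ?w i)"
    unfolding eq using P by (intro conjI)
qed

lemma ring_probability_bounds: "0 \<le> ring_probability m" "ring_probability m \<le> 1" "ring_probability m \<le> \<gamma> / real m"
proof -
  have "0 \<le> \<gamma> / real m" using rate by simp
  then show "0 \<le> ring_probability m" "ring_probability m \<le> 1" unfolding ring_probability_def by simp_all
  show "ring_probability m \<le> \<gamma> / real m" unfolding ring_probability_def using exp_ge_add_one_self[of "- (\<gamma> / real m)"] by simp
qed

lemma double_ring_prob: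
  assumes m: "0 < m"
  shows "{\<omega>\<in>space M. 2 \<le> card (T e \<omega> \<inter> cell m i)} \<in> events"
    "prob {\<omega>\<in>space M. 2 \<le> card (T e \<omega> \<inter> cell m i)} \<le> (\<gamma> / real m)\<^sup>2"
proof -
  let ?N = "\<lambda>\<omega>. card (T e \<omega> \<inter> cell m i)" and ?y = "\<gamma> / real m"
  have y: "0 \<le> ?y" using rate by simp
  note [measurable] = count_measurable[OF m]
  have ev: "{\<omega>\<in>space M. P (?N \<omega>)} \<in> events" for P by measurable
  show "{\<omega>\<in>space M. 2 \<le> ?N \<omega>} \<in> events" by (rule ev)
  have "{\<omega>\<in>space M. 2 \<le> ?N \<omega>} = space M - ({\<omega>\<in>space M. ?N \<omega> = 0} \<union> {\<omega>\<in>space M. ?N \<omega> = 1})"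
    by (auto simp: not_le)
  then have "prob {\<omega>\<in>space M. 2 \<le> ?N \<omega>} = 1 - prob ({\<omega>\<in>space M. ?N \<omega> = 0} \<union> {\<omega>\<in>space M. ?N \<omega> = 1})"
    using prob_compl[OF sets.Un[OF ev[of "\<lambda>k. k = 0"] ev[of "\<lambda>k. k = 1"]]] by simp
  also have "prob ({\<omega>\<in>space M. ?N \<omega> = 0} \<union> {\<omega>\<in>space M. ?N \<omega> = 1}) = prob {\<omega>\<in>space M. ?N \<omega> = 0} + prob {\<omega>\<in>space M. ?N \<omega> = 1}"
    by (rule finite_measure_Union[OF ev ev]) auto
  also have "\<dots> = exp (- ?y) * (1 + ?y)" unfolding count_prob[OF m] by (simp add: algebra_simps)
  finally have "prob {\<omega>\<in>space M. 2 \<le> ?N \<omega>} = 1 - exp (- ?y) * (1 + ?y)" .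
  moreover have "(1 - ?y) * (1 + ?y) \<le> exp (- ?y) * (1 + ?y)"
    using y exp_ge_add_one_self[of "- ?y"] by (intro mult_right_mono) auto
  moreover have "(1 - ?y) * (1 + ?y) = 1 - ?y\<^sup>2" by (simp add: power2_eq_square algebra_simps)
  ultimately show "prob {\<omega>\<in>space M. 2 \<le> ?N \<omega>} \<le> ?y\<^sup>2" by linarith
qed

text \<open>
  There are of order \<open>m\<close> cells per unit of time, so a bound of order \<open>1 / m\<^sup>2\<close> for each of them suffices.
\<close>

lemma crowded_prob:
  assumes m: "0 < m"
  shows "{\<omega>\<in>space M. crowded (\<lambda>x. T x \<omega>) m i e} \<in> events"
    "prob {\<omega>\<in>space M. crowded (\<lambda>x. T x \<omega>) m i e} \<le> 2 * (\<gamma> / real m)\<^sup>2"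
proof -
  let ?D = "{\<omega>\<in>space M. 2 \<le> card (T e \<omega> \<inter> cell m i)}"
  let ?B = "rings_event m {e, e + 1} (\<lambda>_. {i}) (\<lambda>_ _. True)"
  have eq: "{\<omega>\<in>space M. crowded (\<lambda>x. T x \<omega>) m i e} = ?D \<union> ?B"
    unfolding crowded_def rings_event_def by auto
  have B: "?B \<in> events" by (rule init_rings_indep(2)[OF m, of _ _ "{}"]) simp_all
  show "{\<omega>\<in>space M. crowded (\<lambda>x. T x \<omega>) m i e} \<in> events" unfolding eq using double_ring_prob(1)[OF m] B by blast
  have "prob ?B = ring_probability m * ring_probability m" by (subst rings_event_prob[OF m]) simp_all
  also have "\<dots> \<le> (\<gamma> / real m) * (\<gamma> / real m)" using ring_probability_bounds[of m] by (intro mult_mono) auto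
  finally have "prob ?B \<le> (\<gamma> / real m)\<^sup>2" by (simp add: power2_eq_square)
  moreover have "prob (?D \<union> ?B) \<le> prob ?D + prob ?B" by (rule measure_Un_le[OF double_ring_prob(1)[OF m] B])
  ultimately show "prob {\<omega>\<in>space M. crowded (\<lambda>x. T x \<omega>) m i e} \<le> 2 * (\<gamma> / real m)\<^sup>2"
    unfolding eq using double_ring_prob(2)[OF m, of e i] by linarith
qed

end

section \<open>Convergence of the environment\<close>

context ssep begin

abbreviation occupied_along :: "nat \<Rightarrow> (nat \<Rightarrow> int) \<Rightarrow> (nat \<Rightarrow> bool) \<Rightarrow> 'a \<Rightarrow> bool" where
  "occupied_along n \<pi> v \<omega> \<equiv> \<forall>k<n. \<eta> (real k) (\<pi> k) \<omega> = v k"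

abbreviation grid_model :: "nat \<Rightarrow> real \<Rightarrow> (coord \<Rightarrow> bool) measure" where
  "grid_model m p \<equiv> product_model.\<Omega> (ring_probability m) p"

lemma environment_events: "{\<omega>\<in>space M. occupied_along n \<pi> v \<omega>} \<in> events"
proof -
  have [measurable]: "\<eta> (real k) x \<in> measurable M (count_space UNIV)" for k x
    by (rule measurable_eta) simp
  show ?thesis by measurable
qed

text \<open>
  The first error term accounts for origins at distance \<open>R\<close> or more and is small for large \<open>R\<close>, uniformly
  in \<open>m\<close>. The second one accounts for crowded cells within that distance; for fixed \<open>R\<close> it
  vanishes as \<open>m\<close> grows. Otherwise the exchange dynamics and stirring agree at the points
  considered.
\<close>

lemma environment_approximation:
  fixes \<pi> :: "nat \<Rightarrow> int" and v :: "nat \<Rightarrow> bool" and n m R :: nat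
  assumes half: "\<rho> = 1 / 2" and p: "0 \<le> p" "p \<le> 1" and m: "0 < m" and \<pi>: "\<And>k. k < n \<Longrightarrow> \<bar>\<pi> k\<bar> \<le> int n"
  shows "\<bar>prob {\<omega>\<in>space M. occupied_along n \<pi> v \<omega>}
      - measure (grid_model m p) {a. reads m n \<pi> v a}\<bar>
    \<le> real n * (2 * exp (2 * \<gamma> * real n - real R)) + real n * real (2 * (n + R + 1) + 1) * (2 * \<gamma>\<^sup>2) / real m"
proof -
  interpret pm: product_model "ring_probability m" p m
    using ring_probability_bounds p m by unfold_locales auto
  let ?f = "\<lambda>\<omega> i. field m i \<omega>"
  have weight: "pm.weight = (\<lambda>i. case i of Init x \<Rightarrow> \<rho> | Clock j x \<Rightarrow> ring_probability m | Coin n x \<Rightarrow> p)"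
  proof
    show "pm.weight i = (case i of Init x \<Rightarrow> \<rho> | Clock j x \<Rightarrow> ring_probability m | Coin n x \<Rightarrow> p)" for i
      using half by (cases i) simp_all
  qed
  have fam: "bernoulli_family M {i. environment_coord i} (field m) pm.weight"
    unfolding weight by (rule field_family[OF m])
  let ?E = "\<lambda>a. reads m n \<pi> v a"
  let ?J = "environment_window m n"
  have J: "finite ?J" "?J \<subseteq> {i. environment_coord i}"
    using finite_environment_window by (auto simp: environment_window_def clocks_near_iff)
  have dep: "depends_on ?J ?E" by (rule environment_depends[OF \<pi>])
  let ?A = "{\<omega>\<in>space M. occupied_along n \<pi> v \<omega>}" and ?B = "{\<omega>\<in>space M. ?E (?f \<omega>)}"
  let ?Esc = "\<lambda>k. {\<omega>\<in>space M. escapes (int R) (\<pi> k) (m * k) (\<pi> k) (?f \<omega>)}"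
  let ?Cr = "\<lambda>c. {\<omega>\<in>space M. crowded (\<lambda>x. T x \<omega>) m (fst c) (snd c)}"
  let ?C = "{..<m * n} \<times> {- int (n + R + 1)..int (n + R + 1)}"
  let ?Bad = "(\<Union>k<n. ?Esc k) \<union> (\<Union>c\<in>?C. ?Cr c)"
  have B: "?B \<in> events" by (rule bernoulli_family_event(1)[OF fam J dep])
  have PB: "prob ?B = pm.Pr ?E" by (rule pm.Pr_transfer[OF prob_space_axioms fam J dep])
  have near: "clocks_near c B j \<subseteq> {i. environment_coord i}" for c B j by (auto simp: clocks_near_iff)
  have Esc: "?Esc k \<in> events" for k
    by (rule bernoulli_family_event(1)[OF fam finite_clocks_near near escapes_depends])
  have Cr: "?Cr c \<in> events" for c by (rule crowded_prob(1)[OF m])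
  have A: "?A \<in> events" by (rule environment_events)
  have Bad: "?Bad \<in> events"
    by (intro sets.Un sets.finite_UN Esc Cr) simp_all
  have agree: "\<eta> (real k) (\<pi> k) \<omega> = ?f \<omega> (Init (origin (?f \<omega>) (m * k) (\<pi> k)))"
    if w: "\<omega> \<in> space M" and dyn: "exchange_dynamics (\<lambda>x. T x \<omega>) (\<lambda>t x. \<eta> t x \<omega>)" and good: "\<omega> \<notin> ?Bad" and k: "k < n" for \<omega> k
  proof -
    have "\<eta> (real (m * k) / real m) (\<pi> k) \<omega> = \<eta> 0 (origin (?f \<omega>) (m * k) (\<pi> k)) \<omega>"
    proof (rule exchange_origin[OF dyn m, where c="\<pi> k" and R="int R"])
      show "finite (T e \<omega> \<inter> {..t})" for e t by (rule clock_finite[OF w])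
      show "\<bar>frozen_origin (int R) (\<pi> k) (?f \<omega>) (m * k) (\<pi> k) - \<pi> k\<bar> < int R"
      proof -
        have "\<omega> \<notin> ?Esc k" using good k by blast
        then have "\<not> escapes (int R) (\<pi> k) (m * k) (\<pi> k) (?f \<omega>)" using w by blast
        then show ?thesis unfolding escapes_def by linarith
      qed
      fix i e assume i: "i < m * k" and e: "\<bar>e - \<pi> k\<bar> \<le> int R + 1"
      have "m * k \<le> m * n" using k by simp
      then have "i < m * n" using i by linarith
      moreover have "- int (n + R + 1) \<le> e" "e \<le> int (n + R + 1)" using e \<pi>[OF k] by linarith+
      ultimately have "(i, e) \<in> ?C" by simp
      then have "\<omega> \<notin> ?Cr (i, e)" using good by blast
      then show "\<not> crowded (\<lambda>x. T x \<omega>) m i e" using w by simp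
    qed simp
    moreover have "real (m * k) / real m = real k" using m by simp
    ultimately show ?thesis by simp
  qed
  have ae: "AE \<omega> in M. \<omega> \<notin> ?Bad \<longrightarrow> (\<omega> \<in> ?A \<longleftrightarrow> \<omega> \<in> ?B)"
    using dynamics
  proof eventually_elim
    case (elim \<omega>)
    show ?case
    proof
      assume nb: "\<omega> \<notin> ?Bad"
      show "\<omega> \<in> ?A \<longleftrightarrow> \<omega> \<in> ?B"
      proof (cases "\<omega> \<in> space M")
        case True
        then show ?thesis using agree[OF True elim nb] by simp
      qed simp
    qed
  qed
  have "prob ?A \<le> prob (?B \<union> ?Bad)"
  proof (rule finite_measure_mono_AE)
    show "AE \<omega> in M. \<omega> \<in> ?A \<longrightarrow> \<omega> \<in> ?B \<union> ?Bad" using ae by eventually_elim blast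
    show "?B \<union> ?Bad \<in> events" by (rule sets.Un[OF B Bad])
  qed
  also have "\<dots> \<le> prob ?B + prob ?Bad" by (rule measure_Un_le[OF B Bad])
  finally have AB: "prob ?A \<le> prob ?B + prob ?Bad" .
  have "prob ?B \<le> prob (?A \<union> ?Bad)"
  proof (rule finite_measure_mono_AE)
    show "AE \<omega> in M. \<omega> \<in> ?B \<longrightarrow> \<omega> \<in> ?A \<union> ?Bad" using ae by eventually_elim blast
    show "?A \<union> ?Bad \<in> events" by (rule sets.Un[OF A Bad])
  qed
  also have "\<dots> \<le> prob ?A + prob ?Bad" by (rule measure_Un_le[OF A Bad])
  finally have BA: "prob ?B \<le> prob ?A + prob ?Bad" .
  have esc: "prob (?Esc k) \<le> 2 * exp (2 * \<gamma> * real n - real R)" if "k < n" for k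
  proof -
    have "prob (?Esc k) = pm.Pr (escapes (int R) (\<pi> k) (m * k) (\<pi> k))"
      by (rule pm.Pr_transfer[OF prob_space_axioms fam finite_clocks_near near escapes_depends])
    also have "\<dots> \<le> 2 * exp (2 * \<gamma> * real k * 1\<^sup>2 - 1 * real_of_int (int R))"
      by (rule pm.Pr_escapes) (use ring_probability_bounds(3)[of m] m in \<open>simp_all add: field_simps\<close>)
    also have "\<dots> \<le> 2 * exp (2 * \<gamma> * real n - real R)" using that rate by simp
    finally show ?thesis .
  qed
  have "prob ?Bad \<le> prob (\<Union>k<n. ?Esc k) + prob (\<Union>c\<in>?C. ?Cr c)"
    by (rule measure_Un_le) (intro sets.finite_UN Esc Cr, simp_all)+
  also have "prob (\<Union>k<n. ?Esc k) \<le> (\<Sum>k<n. prob (?Esc k))"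
    by (rule finite_measure_subadditive_finite) (simp, rule image_subsetI, rule Esc)
  also have "\<dots> \<le> (\<Sum>k<n. 2 * exp (2 * \<gamma> * real n - real R))" by (rule sum_mono) (use esc in simp)
  also have "\<dots> = real n * (2 * exp (2 * \<gamma> * real n - real R))" by simp
  also have "prob (\<Union>c\<in>?C. ?Cr c) \<le> (\<Sum>c\<in>?C. prob (?Cr c))"
    by (rule finite_measure_subadditive_finite) (simp, rule image_subsetI, rule Cr)
  also have "\<dots> \<le> (\<Sum>c\<in>?C. 2 * (\<gamma> / real m)\<^sup>2)" by (rule sum_mono) (rule crowded_prob(2)[OF m])
  also have "\<dots> = real n * real (2 * (n + R + 1) + 1) * (2 * \<gamma>\<^sup>2) / real m"
  proof -
    have "card {- int W..int W} = 2 * W + 1" for W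
      unfolding card_atLeastAtMost_int by linarith
    then have "card ?C = m * n * (2 * (n + R + 1) + 1)" by (simp only: card_cartesian_product card_lessThan)
    then have "(\<Sum>c\<in>?C. 2 * (\<gamma> / real m)\<^sup>2) = real (m * n * (2 * (n + R + 1) + 1)) * (2 * (\<gamma> / real m)\<^sup>2)" by simp
    also have "\<dots> = real m * (real n * real (2 * (n + R + 1) + 1)) * (2 * (\<gamma> / real m)\<^sup>2)" by (simp only: of_nat_mult mult.assoc)
    also have "\<dots> = real n * real (2 * (n + R + 1) + 1) * (2 * \<gamma>\<^sup>2) / real m" using m by (simp add: power2_eq_square)
    finally show ?thesis .
  qed
  finally show ?thesis using AB BA unfolding PB by linarith
qed

lemma environment_limit:
  fixes \<pi> :: "nat \<Rightarrow> int" and v :: "nat \<Rightarrow> bool" and n :: nat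
  assumes half: "\<rho> = 1 / 2" and p: "0 \<le> p" "p \<le> 1" and \<pi>: "\<And>k. k < n \<Longrightarrow> \<bar>\<pi> k\<bar> \<le> int n"
  shows "(\<lambda>m. measure (grid_model (Suc m) p) {a. reads (Suc m) n \<pi> v a})
    \<longlonglongrightarrow> prob {\<omega>\<in>space M. occupied_along n \<pi> v \<omega>}"
proof (rule LIMSEQ_I)
  fix r :: real assume r: "0 < r"
  have "((\<lambda>R. real n * (2 * exp (2 * \<gamma> * real n) * exp (- real R))) \<longlongrightarrow> real n * (2 * exp (2 * \<gamma> * real n) * 0)) sequentially"
  proof (intro tendsto_mult_left)
    have "((\<lambda>R. exp (- real R)) \<longlongrightarrow> 0) sequentially"
      by (rule filterlim_compose[OF exp_at_bot]) (simp add: filterlim_uminus_at_bot filterlim_real_sequentially)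
    then show "((\<lambda>R. exp (- real R)) \<longlongrightarrow> 0) sequentially" .
  qed
  then have "eventually (\<lambda>R. real n * (2 * exp (2 * \<gamma> * real n) * exp (- real R)) < r / 2) sequentially"
    by (rule order_tendstoD) (use r in simp)
  then obtain R where "real n * (2 * exp (2 * \<gamma> * real n) * exp (- real R)) < r / 2"
    by (auto simp: eventually_sequentially)
  moreover have "exp (2 * \<gamma> * real n - real R) = exp (2 * \<gamma> * real n) * exp (- real R)"
    unfolding exp_add[symmetric] by simp
  ultimately have R: "real n * (2 * exp (2 * \<gamma> * real n - real R)) < r / 2"
    by (simp only: mult.assoc)
  define C where "C = real n * real (2 * (n + R + 1) + 1) * (2 * \<gamma>\<^sup>2)"
  have "(\<lambda>m. C * inverse (real (Suc m))) \<longlonglongrightarrow> C * 0"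
    by (intro tendsto_mult_left LIMSEQ_inverse_real_of_nat)
  then have "eventually (\<lambda>m. C * inverse (real (Suc m)) < r / 2) sequentially"
    by (rule order_tendstoD) (use r in simp)
  then obtain m0 where m0: "\<And>m. m0 \<le> m \<Longrightarrow> C * inverse (real (Suc m)) < r / 2"
    by (auto simp: eventually_sequentially)
  show "\<exists>m0. \<forall>m\<ge>m0. norm (measure (grid_model (Suc m) p) {a. reads (Suc m) n \<pi> v a}
      - prob {\<omega>\<in>space M. occupied_along n \<pi> v \<omega>}) < r"
  proof (intro exI[of _ m0] allI impI)
    fix m assume m: "m0 \<le> m"
    have "real n * (2 * exp (2 * \<gamma> * real n - real R)) + real n * real (2 * (n + R + 1) + 1) * (2 * \<gamma>\<^sup>2) / real (Suc m) < r"
    proof -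
      have "C / real (Suc m) < r / 2" using m0[OF m] unfolding divide_inverse[of C] .
      then show ?thesis using R unfolding C_def by linarith
    qed
    then show "norm (measure (grid_model (Suc m) p) {a. reads (Suc m) n \<pi> v a}
      - prob {\<omega>\<in>space M. occupied_along n \<pi> v \<omega>}) < r"
      unfolding real_norm_def
      using environment_approximation[where \<pi>=\<pi> and v=v and R=R, OF half p zero_less_Suc[of m] \<pi>] by linarith
  qed
qed

end

section \<open>The law of the path in the product model\<close>

lemma (in prob_space) prob_partition:
  assumes K: "finite K" and C: "\<And>\<kappa>. \<kappa> \<in> K \<Longrightarrow> {\<omega>\<in>space M. C \<kappa> \<omega>} \<in> events"
    and disj: "\<And>\<kappa> \<kappa>' \<omega>. \<kappa> \<in> K \<Longrightarrow> \<kappa>' \<in> K \<Longrightarrow> C \<kappa> \<omega> \<Longrightarrow> C \<kappa>' \<omega> \<Longrightarrow> \<kappa> = \<kappa>'"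
    and cover: "AE \<omega> in M. \<exists>\<kappa>\<in>K. C \<kappa> \<omega>"
    and E: "{\<omega>\<in>space M. E \<omega>} \<in> events"
    and D: "\<And>\<kappa> \<omega>. \<kappa> \<in> K \<Longrightarrow> C \<kappa> \<omega> \<Longrightarrow> E \<omega> = D \<kappa>"
  shows "prob {\<omega>\<in>space M. E \<omega>} = (\<Sum>\<kappa>\<in>{\<kappa>\<in>K. D \<kappa>}. prob {\<omega>\<in>space M. C \<kappa> \<omega>})"
proof -
  let ?K = "{\<kappa>\<in>K. D \<kappa>}"
  have fin: "finite ?K" using K by simp
  have U: "(\<Union>\<kappa>\<in>?K. {\<omega>\<in>space M. C \<kappa> \<omega>}) \<in> events"
    by (intro sets.finite_UN fin C) simp
  have "prob {\<omega>\<in>space M. E \<omega>} = prob (\<Union>\<kappa>\<in>?K. {\<omega>\<in>space M. C \<kappa> \<omega>})"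
  proof (rule finite_measure_eq_AE[OF _ E U])
    show "AE \<omega> in M. \<omega> \<in> {\<omega>\<in>space M. E \<omega>} \<longleftrightarrow> \<omega> \<in> (\<Union>\<kappa>\<in>?K. {\<omega>\<in>space M. C \<kappa> \<omega>})"
      using cover
    proof eventually_elim
      case (elim \<omega>)
      then obtain \<kappa> where k: "\<kappa> \<in> K" "C \<kappa> \<omega>" by blast
      have "E \<omega> = D \<kappa>" by (rule D[OF k])
      moreover have "\<omega> \<in> (\<Union>\<kappa>\<in>?K. {\<omega>\<in>space M. C \<kappa> \<omega>}) \<longleftrightarrow> \<omega> \<in> space M \<and> D \<kappa>"
      proof
        assume "\<omega> \<in> (\<Union>\<kappa>\<in>?K. {\<omega>\<in>space M. C \<kappa> \<omega>})"
        then obtain \<kappa>' where k': "\<kappa>' \<in> K" "D \<kappa>'" "\<omega> \<in> space M" "C \<kappa>' \<omega>" by blast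
        have "\<kappa>' = \<kappa>" by (rule disj[OF k'(1) k(1) k'(4) k(2)])
        with k' show "\<omega> \<in> space M \<and> D \<kappa>" by simp
      next
        assume "\<omega> \<in> space M \<and> D \<kappa>"
        then show "\<omega> \<in> (\<Union>\<kappa>\<in>?K. {\<omega>\<in>space M. C \<kappa> \<omega>})" by (intro UN_I[of \<kappa>]) (use k in simp_all)
      qed
      ultimately show ?case by simp
    qed
  qed
  also have "\<dots> = (\<Sum>\<kappa>\<in>?K. prob {\<omega>\<in>space M. C \<kappa> \<omega>})"
  proof (rule finite_measure_finite_Union[OF fin])
    show "(\<lambda>\<kappa>. {\<omega>\<in>space M. C \<kappa> \<omega>}) ` ?K \<subseteq> events" using C by auto
    show "disjoint_family_on (\<lambda>\<kappa>. {\<omega>\<in>space M. C \<kappa> \<omega>}) ?K"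
      unfolding disjoint_family_on_def using disj by blast
  qed
  finally show ?thesis .
qed

text \<open>
  A nearest-neighbour path, together with the occupations that the walk finds along it.
\<close>

type_synonym trace = "(nat \<Rightarrow> int) \<times> (nat \<Rightarrow> bool)"

definition histories :: "nat \<Rightarrow> trace set" where
  "histories n = {(\<pi>, v). \<pi> \<in> PiE {..n} (\<lambda>_. {- int n..int n}) \<and> v \<in> PiE {..<n} (\<lambda>_. UNIV) \<and> \<pi> 0 = 0 \<and>
     (\<forall>k<n. \<pi> (Suc k) = \<pi> k + 1 \<or> \<pi> (Suc k) = \<pi> k - 1)}"

definition follows :: "nat \<Rightarrow> (nat \<Rightarrow> int) \<Rightarrow> (nat \<Rightarrow> int \<Rightarrow> bool) \<Rightarrow> trace \<Rightarrow> bool" where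
  "follows n Y b \<kappa> \<longleftrightarrow> (\<forall>k\<le>n. Y k = fst \<kappa> k) \<and> (\<forall>k<n. b k (fst \<kappa> k) = snd \<kappa> k)"

definition path_weight :: "real \<Rightarrow> nat \<Rightarrow> trace \<Rightarrow> real" where
  "path_weight p n \<kappa> = (\<Prod>k<n. if snd \<kappa> k = (fst \<kappa> (Suc k) = fst \<kappa> k + 1) then p else 1 - p)"

lemma finite_histories: "finite (histories n)"
proof (rule finite_subset)
  show "histories n \<subseteq> PiE {..n} (\<lambda>_. {- int n..int n}) \<times> PiE {..<n} (\<lambda>_. UNIV)"
    unfolding histories_def by auto
  show "finite (PiE {..n} (\<lambda>_. {- int n..int n}) \<times> PiE {..<n} (\<lambda>_. (UNIV :: bool set)))"
    by (intro finite_cartesian_product finite_PiE) auto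
qed

lemma histories_bound: "\<kappa> \<in> histories n \<Longrightarrow> k \<le> n \<Longrightarrow> \<bar>fst \<kappa> k\<bar> \<le> int n"
  unfolding histories_def by (auto simp: PiE_iff abs_le_iff minus_le_iff)

lemma follows_unique:
  assumes "\<kappa> \<in> histories n" "\<kappa>' \<in> histories n" "follows n Y b \<kappa>" "follows n Y b \<kappa>'"
  shows "\<kappa> = \<kappa>'"
proof -
  obtain \<pi> v \<pi>' v' where [simp]: "\<kappa> = (\<pi>, v)" "\<kappa>' = (\<pi>', v')" by fastforce
  have P: "\<pi> \<in> PiE {..n} (\<lambda>_. {- int n..int n})" "\<pi>' \<in> PiE {..n} (\<lambda>_. {- int n..int n})"
    "v \<in> PiE {..<n} (\<lambda>_. UNIV)" "v' \<in> PiE {..<n} (\<lambda>_. UNIV)"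
    using assms(1,2) unfolding histories_def by auto
  have pi: "\<pi> k = \<pi>' k" if "k \<le> n" for k using assms(3,4) that unfolding follows_def by simp
  have "\<pi> = \<pi>'" by (rule PiE_ext[OF P(1,2)]) (use pi in simp)
  moreover have "v = v'"
  proof (rule PiE_ext[OF P(3,4)])
    fix k assume "k \<in> {..<n}"
    then show "v k = v' k" using assms(3,4) \<open>\<pi> = \<pi>'\<close> unfolding follows_def by simp
  qed
  ultimately show ?thesis by simp
qed

lemma follows_exists:
  assumes Y0: "Y 0 = (0 :: int)" and step: "\<And>k. k < n \<Longrightarrow> Y (Suc k) = Y k + 1 \<or> Y (Suc k) = Y k - 1"
  shows "\<exists>\<kappa>\<in>histories n. follows n Y b \<kappa>"
proof -
  have bound: "k \<le> n \<Longrightarrow> \<bar>Y k\<bar> \<le> int k" for k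
  proof (induction k)
    case (Suc k)
    then show ?case using step[of k] by auto
  qed (simp add: Y0)
  let ?\<kappa> = "(restrict Y {..n}, restrict (\<lambda>k. b k (Y k)) {..<n})"
  have "\<bar>Y k\<bar> \<le> int n" if "k \<le> n" for k using bound[OF that] that by linarith
  then have "restrict Y {..n} \<in> PiE {..n} (\<lambda>_. {- int n..int n})" by (simp add: abs_le_iff minus_le_iff)
  then have "?\<kappa> \<in> histories n" unfolding histories_def using step Y0 by simp
  moreover have "follows n Y b ?\<kappa>" unfolding follows_def by simp
  ultimately show ?thesis by blast
qed

context product_model begin

abbreviation model_follows :: "nat \<Rightarrow> trace \<Rightarrow> (coord \<Rightarrow> bool) \<Rightarrow> bool" where
  "model_follows n \<kappa> a \<equiv> follows n (walk (arrow m a) 0 0) (\<lambda>k x. a (Init (origin a (m * k) x))) \<kappa>"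

text \<open>
  The points of a path have different times, so the coins at these points are independent of each
  other, and they are independent of the environment. Given the environment, following the path
  means that each of these coins has a prescribed value.
\<close>

lemma follows_prob:
  assumes \<kappa>: "\<kappa> \<in> histories n"
  shows "Pr (\<lambda>a. model_follows n \<kappa> a)
    = path_weight p n \<kappa> * Pr (\<lambda>a. reads m n (fst \<kappa>) (snd \<kappa>) a)"
    "{a. model_follows n \<kappa> a} \<in> events"
proof -
  obtain \<pi> v where [simp]: "\<kappa> = (\<pi>, v)" by fastforce
  have \<pi>0: "\<pi> 0 = 0" and \<pi>S: "\<And>k. k < n \<Longrightarrow> \<pi> (Suc k) = \<pi> k + 1 \<or> \<pi> (Suc k) = \<pi> k - 1"
    using \<kappa> unfolding histories_def by auto
  have \<pi>n: "\<bar>\<pi> k\<bar> \<le> int n" if "k \<le> n" for k using histories_bound[OF \<kappa> that] by simp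
  let ?env = "\<lambda>a. reads m n \<pi> v a"
  let ?u = "\<lambda>k. v k = (\<pi> (Suc k) = \<pi> k + 1)"
  let ?coins = "\<lambda>a :: coord \<Rightarrow> bool. \<forall>k<n. a (Coin k (\<pi> k)) = ?u k"
  have iff: "model_follows n \<kappa> a \<longleftrightarrow> ?env a \<and> ?coins a" for a
  proof -
    have "(\<forall>k\<le>n. walk (arrow m a) 0 0 k = \<pi> k) \<longleftrightarrow> ?coins a" if env: "?env a"
    proof -
      have step: "arrow m a k (\<pi> k) = (a (Coin k (\<pi> k)) = v k)" if "k < n" for k
        using env that unfolding arrow_def by auto
      show ?thesis
      proof
        assume w: "\<forall>k\<le>n. walk (arrow m a) 0 0 k = \<pi> k"
        show "?coins a"
        proof (intro allI impI)
          fix k assume k: "k < n"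
          then have "\<pi> (Suc k) = \<pi> k + (if arrow m a k (\<pi> k) then 1 else - 1)"
            using w[rule_format, of "Suc k"] w[rule_format, of k] by simp
          then show "a (Coin k (\<pi> k)) = ?u k" using step[OF k] by (auto split: if_splits)
        qed
      next
        assume c: "?coins a"
        have "k \<le> n \<longrightarrow> walk (arrow m a) 0 0 k = \<pi> k" for k
        proof (induction k)
          case (Suc k)
          show ?case
          proof
            assume k: "Suc k \<le> n"
            then have "arrow m a k (\<pi> k) = (\<pi> (Suc k) = \<pi> k + 1)" using step[of k] c by auto
            then show "walk (arrow m a) 0 0 (Suc k) = \<pi> (Suc k)" using Suc k \<pi>S[of k] by auto
          qed
        qed (simp add: \<pi>0)
        then show "\<forall>k\<le>n. walk (arrow m a) 0 0 k = \<pi> k" by blast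
      qed
    qed
    then show ?thesis unfolding follows_def by auto
  qed
  let ?J = "environment_window m n"
  let ?J' = "(\<lambda>k. Coin k (\<pi> k)) ` {..<n}"
  have dep: "depends_on ?J ?env" by (rule environment_depends) (simp add: \<pi>n)
  have dep': "depends_on ?J' ?coins" by (rule depends_onI) simp
  have fin: "finite ?J" "finite ?J'" using finite_environment_window by auto
  have "Pr (\<lambda>a. ?env a \<and> ?coins a) = Pr ?env * Pr ?coins"
    by (rule Pr_indep[OF fin _ dep dep']) (auto simp: environment_window_def clocks_near_iff)
  moreover have "Pr ?coins = path_weight p n \<kappa>"
  proof -
    let ?c = "\<lambda>k. Coin k (\<pi> k)"
    let ?w = "\<lambda>i. case i of Coin k x \<Rightarrow> ?u k | _ \<Rightarrow> False"
    have "?coins a \<longleftrightarrow> (\<forall>i\<in>?J'. a (id i) = ?w i)" for a by auto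
    then have "Pr ?coins = Pr (\<lambda>a. \<forall>i\<in>?J'. a (id i) = ?w i)" by (simp only:)
    also have "\<dots> = (\<Prod>i\<in>?J'. if ?w i then weight i else 1 - weight i)"
      by (rule Pr_reindex) simp_all
    also have "\<dots> = (\<Prod>k<n. if ?u k then p else 1 - p)"
      by (subst prod.reindex) (simp_all add: inj_on_def cong: if_cong)
    finally show ?thesis unfolding path_weight_def by simp
  qed
  ultimately show "Pr (\<lambda>a. model_follows n \<kappa> a)
    = path_weight p n \<kappa> * Pr (\<lambda>a. reads m n (fst \<kappa>) (snd \<kappa>) a)"
    unfolding iff by simp
  have "depends_on (?J \<union> ?J') (\<lambda>a. ?env a \<and> ?coins a)"
    by (rule depends_on_conj[OF depends_on_mono[OF dep] depends_on_mono[OF dep']]) auto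
  then show "{a. model_follows n \<kappa> a} \<in> events"
    unfolding iff using fin by (intro depends_on_events) auto
qed

lemma walk_path_law:
  assumes S: "\<And>f g. (\<And>l. l \<le> n \<Longrightarrow> f l = g l) \<Longrightarrow> S f = S g"
  shows "Pr (\<lambda>a. S (walk (arrow m a) 0 0)) = (\<Sum>\<kappa>\<in>{\<kappa>\<in>histories n. S (fst \<kappa>)}.
    path_weight p n \<kappa> * Pr (\<lambda>a. reads m n (fst \<kappa>) (snd \<kappa>) a))"
proof -
  let ?C = "\<lambda>\<kappa> a. model_follows n \<kappa> a"
  have "prob {a\<in>space \<Omega>. S (walk (arrow m a) 0 0)} = (\<Sum>\<kappa>\<in>{\<kappa>\<in>histories n. S (fst \<kappa>)}. prob {a\<in>space \<Omega>. ?C \<kappa> a})"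
  proof (rule prob_partition[OF finite_histories, where C="?C" and E="\<lambda>a. S (walk (arrow m a) 0 0)" and D="\<lambda>\<kappa>. S (fst \<kappa>)"])
    show "{a\<in>space \<Omega>. ?C \<kappa> a} \<in> events" if "\<kappa> \<in> histories n" for \<kappa>
      using follows_prob(2)[OF that] by simp
    show "AE a in \<Omega>. \<exists>\<kappa>\<in>histories n. ?C \<kappa> a"
    proof (rule AE_I2)
      show "\<exists>\<kappa>\<in>histories n. ?C \<kappa> a" for a by (rule follows_exists) auto
    qed
    show "{a\<in>space \<Omega>. S (walk (arrow m a) 0 0)} \<in> events"
      using depends_on_events[OF finite_coords_near walk_path_depends[where k=n and P=S and y=0, OF S]] by simp
    show "S (walk (arrow m a) 0 0) = S (fst \<kappa>)" if "?C \<kappa> a" for \<kappa> a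
    proof (rule S)
      show "walk (arrow m a) 0 0 l = fst \<kappa> l" if "l \<le> n" for l
        using \<open>?C \<kappa> a\<close> that unfolding follows_def by blast
    qed
  qed (rule follows_unique)
  also have "\<dots> = (\<Sum>\<kappa>\<in>{\<kappa>\<in>histories n. S (fst \<kappa>)}.
    path_weight p n \<kappa> * Pr (\<lambda>a. reads m n (fst \<kappa>) (snd \<kappa>) a))"
    by (intro sum.cong refl) (use follows_prob(1) in simp)
  finally show ?thesis by simp
qed

end

section \<open>The law of the walk on the exclusion process\<close>

context walk_on_ssep begin

lemma history_measurable:
  "(\<lambda>\<omega>. (\<lambda>(t, x)\<in>{0..} \<times> UNIV. \<eta> t x \<omega>, \<lambda>k\<in>{..n}. X k \<omega>)) \<in>
    measurable M ((\<Pi>\<^sub>M i\<in>{0..} \<times> UNIV. count_space UNIV) \<Otimes>\<^sub>M (\<Pi>\<^sub>M k\<in>{..n}. count_space UNIV))"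
proof (rule measurable_Pair)
  show "(\<lambda>\<omega>. \<lambda>(t, x)\<in>{0..} \<times> UNIV. \<eta> t x \<omega>) \<in> measurable M (\<Pi>\<^sub>M i\<in>{0..} \<times> UNIV. count_space UNIV)"
  proof (rule measurable_restrict)
    fix i :: "real \<times> int" assume "i \<in> {0..} \<times> UNIV"
    then obtain t x where "i = (t, x)" "0 \<le> t" by auto
    then show "(\<lambda>\<omega>. case i of (t, x) \<Rightarrow> \<eta> t x \<omega>) \<in> measurable M (count_space UNIV)"
      using measurable_eta[of t x] by simp
  qed
  show "(\<lambda>\<omega>. \<lambda>k\<in>{..n}. X k \<omega>) \<in> measurable M (\<Pi>\<^sub>M k\<in>{..n}. count_space UNIV)"
    by (rule measurable_restrict) (rule measurable_X)
qed

lemma history_sub: "finite_measure_subalgebra M (history X n)"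
proof
  let ?N = "(\<Pi>\<^sub>M i\<in>{0..} \<times> UNIV. count_space UNIV) \<Otimes>\<^sub>M (\<Pi>\<^sub>M k\<in>{..n}. count_space UNIV)"
  let ?g = "\<lambda>\<omega>. (\<lambda>(t, x)\<in>{0..} \<times> UNIV. \<eta> t x \<omega>, \<lambda>k\<in>{..n}. X k \<omega>)"
  have g: "?g \<in> space M \<rightarrow> space ?N" using measurable_space[OF history_measurable] by blast
  have "sets (history X n) \<subseteq> sets M"
    unfolding history_def sets_vimage_algebra2[OF g] using measurable_sets[OF history_measurable] by blast
  then show "subalgebra M (history X n)" unfolding subalgebra_def history_def by simp
qed

text \<open>
  The occupations are prescribed along the whole path, the positions of the walk only up to time \<open>j\<close>. This
  event belongs to \<open>history X j\<close>, which contains the environment at all times.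
\<close>

definition past :: "nat \<Rightarrow> nat \<Rightarrow> trace \<Rightarrow> 'a set" where
  "past n j \<kappa> = {\<omega>\<in>space M. (\<forall>k\<le>j. X k \<omega> = fst \<kappa> k) \<and> (occupied_along n (fst \<kappa>) (snd \<kappa>) \<omega>)}"

lemma past_history: "past n j \<kappa> \<in> sets (history X j)"
proof -
  let ?N1 = "\<Pi>\<^sub>M i\<in>{0..} \<times> (UNIV :: int set). count_space (UNIV :: bool set)"
  let ?N2 = "\<Pi>\<^sub>M k\<in>{..j}. count_space (UNIV :: int set)"
  let ?g = "\<lambda>\<omega>. (\<lambda>(t, x)\<in>{0..} \<times> UNIV. \<eta> t x \<omega>, \<lambda>k\<in>{..j}. X k \<omega>)"
  let ?A = "{z\<in>space (?N1 \<Otimes>\<^sub>M ?N2). (\<forall>k\<in>{..j}. snd z k = fst \<kappa> k) \<and>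
    (\<forall>k\<in>{..<n}. fst z (real k, fst \<kappa> k) = snd \<kappa> k)}"
  have "Measurable.pred (?N1 \<Otimes>\<^sub>M ?N2) (\<lambda>z. snd z k = fst \<kappa> k)" if "k \<in> {..j}" for k
    using that by measurable
  moreover have "Measurable.pred (?N1 \<Otimes>\<^sub>M ?N2) (\<lambda>z. fst z (real k, fst \<kappa> k) = snd \<kappa> k)" for k
    by measurable
  ultimately have "?A \<in> sets (?N1 \<Otimes>\<^sub>M ?N2)"
    by (intro pred_intros_logic pred_intros_finite predE) auto
  then have "?g -` ?A \<inter> space M \<in> sets (history X j)" unfolding history_def by (rule in_vimage_algebra)
  moreover have "?g -` ?A \<inter> space M = past n j \<kappa>"
  proof (rule set_eqI)
    fix \<omega>
    have "\<omega> \<in> space M \<Longrightarrow> ?g \<omega> \<in> space (?N1 \<Otimes>\<^sub>M ?N2)" by (rule measurable_space[OF history_measurable])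
    then show "\<omega> \<in> ?g -` ?A \<inter> space M \<longleftrightarrow> \<omega> \<in> past n j \<kappa>"
      unfolding past_def by (cases "\<omega> \<in> space M") (simp_all add: Ball_def)
  qed
  ultimately show ?thesis by simp
qed

lemma past_events: "past n j \<kappa> \<in> events"
  using past_history history_sub unfolding finite_measure_subalgebra_def finite_measure_subalgebra_axioms_def subalgebra_def by blast

lemma step_events: "{\<omega>\<in>space M. X (Suc j) \<omega> = X j \<omega> + d} \<in> events"
proof -
  have [measurable]: "X j \<in> measurable M (count_space UNIV)" for j by (rule measurable_X)
  show ?thesis by measurable
qed

lemma integrable_event: "A \<in> events \<Longrightarrow> integrable M (indicator A :: 'a \<Rightarrow> real)"
  by (rule integrable_real_indicator) (simp_all add: emeasure_eq_measure)

lemma conditional_step: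
  assumes A: "A \<in> sets (history X j)" and D: "D \<in> events"
    and h: "AE \<omega> in M. real_cond_exp M (history X j) (indicator D) \<omega> = h \<omega>"
    and c: "\<And>\<omega>. \<omega> \<in> A \<Longrightarrow> h \<omega> = c"
  shows "prob (A \<inter> D) = c * prob A"
proof -
  interpret sub: finite_measure_subalgebra M "history X j" by (rule history_sub)
  have A': "A \<in> events" using A sub.subalg unfolding subalgebra_def by blast
  have "prob (A \<inter> D) = (\<integral>\<omega>. indicator A \<omega> * indicator D \<omega> \<partial>M)"
    using A' D by (simp flip: indicator_inter_arith)
  also have "\<dots> = (\<integral>\<omega>. indicator A \<omega> * real_cond_exp M (history X j) (indicator D) \<omega> \<partial>M)"
  proof (rule sub.real_cond_exp_intg(2)[symmetric])
    show "integrable M (\<lambda>\<omega>. indicator A \<omega> * indicator D \<omega> :: real)"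
      unfolding indicator_inter_arith[symmetric] by (rule integrable_event[OF sets.Int[OF A' D]])
  qed (use A D in simp_all)
  also have "\<dots> = (\<integral>\<omega>. c * indicator A \<omega> \<partial>M)"
  proof (rule integral_cong_AE)
    show "(\<lambda>\<omega>. indicator A \<omega> * real_cond_exp M (history X j) (indicator D) \<omega>) \<in> borel_measurable M"
      using A' by simp
    show "(\<lambda>\<omega>. c * indicator A \<omega>) \<in> borel_measurable M" using A' by simp
    show "AE \<omega> in M. indicator A \<omega> * real_cond_exp M (history X j) (indicator D) \<omega> = c * indicator A \<omega>"
      using h
    proof eventually_elim
      case (elim \<omega>)
      then show ?case using c[of \<omega>] by (cases "\<omega> \<in> A") simp_all
    qed
  qed
  also have "\<dots> = c * prob A" using A' by simp
  finally show ?thesis .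
qed

text \<open>
  The conditional probabilities of the two steps add up to \<open>1\<close>.
\<close>

lemma nearest_neighbour:
  assumes p: "p_bullet = 1 - p_circ"
  shows "AE \<omega> in M. X (Suc j) \<omega> = X j \<omega> + 1 \<or> X (Suc j) \<omega> = X j \<omega> - 1"
proof -
  interpret sub: finite_measure_subalgebra M "history X j" by (rule history_sub)
  let ?R = "{\<omega>\<in>space M. X (Suc j) \<omega> = X j \<omega> + 1}" and ?L = "{\<omega>\<in>space M. X (Suc j) \<omega> = X j \<omega> - 1}"
  have R: "?R \<in> events" and L: "?L \<in> events" using step_events[of j 1] step_events[of j "- 1"] by simp_all
  have iR: "integrable M (indicator ?R :: 'a \<Rightarrow> real)" and iL: "integrable M (indicator ?L :: 'a \<Rightarrow> real)"
    by (rule integrable_event[OF R], rule integrable_event[OF L])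
  have "prob (?R \<union> ?L) = prob ?R + prob ?L" by (rule finite_measure_Union[OF R L]) auto
  also have "\<dots> = (\<integral>\<omega>. indicator ?R \<omega> \<partial>M) + (\<integral>\<omega>. indicator ?L \<omega> \<partial>M)" using R L by simp
  also have "\<dots> = (\<integral>\<omega>. real_cond_exp M (history X j) (indicator ?R) \<omega> \<partial>M) + (\<integral>\<omega>. real_cond_exp M (history X j) (indicator ?L) \<omega> \<partial>M)"
    using sub.real_cond_exp_int(2)[OF iR] sub.real_cond_exp_int(2)[OF iL] by simp
  also have "\<dots> = (\<integral>\<omega>. real_cond_exp M (history X j) (indicator ?R) \<omega> + real_cond_exp M (history X j) (indicator ?L) \<omega> \<partial>M)"
    by (rule Bochner_Integration.integral_add[symmetric]) (rule sub.real_cond_exp_int(1)[OF iR] sub.real_cond_exp_int(1)[OF iL])+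
  also have "\<dots> = (\<integral>\<omega>. 1 \<partial>M)"
  proof (rule integral_cong_AE)
    show "AE \<omega> in M. real_cond_exp M (history X j) (indicator ?R) \<omega> + real_cond_exp M (history X j) (indicator ?L) \<omega> = 1"
      using step_right[of j] step_left[of j] by eventually_elim simp
  qed simp_all
  finally have "prob (?R \<union> ?L) = 1" using prob_space by simp
  then have "AE \<omega> in M. \<omega> \<in> ?R \<union> ?L" using prob_eq_1[of "?R \<union> ?L"] R L by blast
  then show ?thesis by eventually_elim auto
qed

text \<open>
  On \<open>past n j \<kappa>\<close> the conditional probability of the next step is the constant by which
  \<open>path_weight\<close> grows.
\<close>

lemma past_prob:
  assumes sym: "p_bullet = 1 - p_circ" and \<kappa>: "\<kappa> \<in> histories n"
  shows "j \<le> n \<Longrightarrow> prob (past n j \<kappa>) = path_weight p_bullet j \<kappa> * prob {\<omega>\<in>space M. occupied_along n (fst \<kappa>) (snd \<kappa>) \<omega>}"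
proof (induction j)
  case 0
  have "AE \<omega> in M. \<omega> \<in> past n 0 \<kappa> \<longleftrightarrow> \<omega> \<in> {\<omega>\<in>space M. occupied_along n (fst \<kappa>) (snd \<kappa>) \<omega>}"
    using start
  proof eventually_elim
    case (elim \<omega>)
    have "fst \<kappa> 0 = 0" using \<kappa> unfolding histories_def by auto
    then show ?case using elim unfolding past_def by simp
  qed
  moreover note environment_events[of n "fst \<kappa>" "snd \<kappa>"]
  ultimately have "prob (past n 0 \<kappa>) = prob {\<omega>\<in>space M. occupied_along n (fst \<kappa>) (snd \<kappa>) \<omega>}"
    by (intro finite_measure_eq_AE past_events)
  then show ?case unfolding path_weight_def by simp
next
  case (Suc j)
  let ?up = "fst \<kappa> (Suc j) = fst \<kappa> j + 1"
  have j: "j < n" using Suc.prems by simp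
  have nn: "?up \<or> fst \<kappa> (Suc j) = fst \<kappa> j - 1" using \<kappa> j unfolding histories_def by auto
  define c where "c = (if snd \<kappa> j = ?up then p_bullet else 1 - p_bullet)"
  define D where "D = {\<omega>\<in>space M. X (Suc j) \<omega> = X j \<omega> + (if ?up then 1 else - 1)}"
  have "past n (Suc j) \<kappa> = past n j \<kappa> \<inter> D"
    unfolding past_def D_def using nn by (auto simp: le_Suc_eq)
  moreover have "prob (past n j \<kappa> \<inter> D) = c * prob (past n j \<kappa>)"
  proof (rule conditional_step[OF past_history])
    show "D \<in> events" unfolding D_def by (rule step_events)
    show "AE \<omega> in M. real_cond_exp M (history X j) (indicator D) \<omega> =
      (if \<eta> (real j) (X j \<omega>) \<omega> = ?up then p_bullet else 1 - p_bullet)"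
    proof (cases ?up)
      case True
      then have "D = {\<omega>\<in>space M. X (Suc j) \<omega> = X j \<omega> + 1}" unfolding D_def by simp
      then have "AE \<omega> in M. real_cond_exp M (history X j) (indicator D) \<omega> =
        (if \<eta> (real j) (X j \<omega>) \<omega> then p_bullet else p_circ)" using step_right[of j] by simp
      then show ?thesis by eventually_elim (use True sym in simp)
    next
      case False
      then have "D = {\<omega>\<in>space M. X (Suc j) \<omega> = X j \<omega> - 1}" unfolding D_def by simp
      then have "AE \<omega> in M. real_cond_exp M (history X j) (indicator D) \<omega> =
        (if \<eta> (real j) (X j \<omega>) \<omega> then 1 - p_bullet else 1 - p_circ)" using step_left[of j] by simp
      then show ?thesis by eventually_elim (use False sym in simp)
    qed
    show "(if \<eta> (real j) (X j \<omega>) \<omega> = ?up then p_bullet else 1 - p_bullet) = c" if "\<omega> \<in> past n j \<kappa>" for \<omega>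
    proof -
      have "X j \<omega> = fst \<kappa> j" "\<eta> (real j) (fst \<kappa> j) \<omega> = snd \<kappa> j" using that j unfolding past_def by auto
      then show ?thesis unfolding c_def by simp
    qed
  qed
  ultimately have "prob (past n (Suc j) \<kappa>) = c * prob (past n j \<kappa>)" by simp
  then show ?case using Suc j unfolding path_weight_def c_def by simp
qed

lemma path_law:
  assumes sym: "p_bullet = 1 - p_circ" and S: "\<And>f g. (\<And>l. l \<le> n \<Longrightarrow> f l = g l) \<Longrightarrow> S f = S g"
    and ev: "{\<omega>\<in>space M. S (\<lambda>k. X k \<omega>)} \<in> events"
  shows "prob {\<omega>\<in>space M. S (\<lambda>k. X k \<omega>)} = (\<Sum>\<kappa>\<in>{\<kappa>\<in>histories n. S (fst \<kappa>)}.
    path_weight p_bullet n \<kappa> * prob {\<omega>\<in>space M. occupied_along n (fst \<kappa>) (snd \<kappa>) \<omega>})"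
proof -
  let ?C = "\<lambda>\<kappa> \<omega>. follows n (\<lambda>k. X k \<omega>) (\<lambda>k x. \<eta> (real k) x \<omega>) \<kappa>"
  have C: "{\<omega>\<in>space M. ?C \<kappa> \<omega>} = past n n \<kappa>" for \<kappa> unfolding follows_def past_def by simp
  have "prob {\<omega>\<in>space M. S (\<lambda>k. X k \<omega>)} = (\<Sum>\<kappa>\<in>{\<kappa>\<in>histories n. S (fst \<kappa>)}. prob {\<omega>\<in>space M. ?C \<kappa> \<omega>})"
  proof (rule prob_partition[OF finite_histories, where C="?C" and E="\<lambda>\<omega>. S (\<lambda>k. X k \<omega>)" and D="\<lambda>\<kappa>. S (fst \<kappa>)"])
    show "{\<omega>\<in>space M. ?C \<kappa> \<omega>} \<in> events" for \<kappa> unfolding C by (rule past_events)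
    have "AE \<omega> in M. \<forall>j. X (Suc j) \<omega> = X j \<omega> + 1 \<or> X (Suc j) \<omega> = X j \<omega> - 1"
      unfolding AE_all_countable using nearest_neighbour[OF sym] by blast
    then show "AE \<omega> in M. \<exists>\<kappa>\<in>histories n. ?C \<kappa> \<omega>"
      using start
    proof eventually_elim
      case (elim \<omega>)
      show ?case by (rule follows_exists) (use elim in auto)
    qed
    show "{\<omega>\<in>space M. S (\<lambda>k. X k \<omega>)} \<in> events" by (rule ev)
    show "S (\<lambda>k. X k \<omega>) = S (fst \<kappa>)" if "?C \<kappa> \<omega>" for \<kappa> \<omega>
    proof (rule S)
      show "X l \<omega> = fst \<kappa> l" if "l \<le> n" for l
        using \<open>?C \<kappa> \<omega>\<close> that unfolding follows_def by blast
    qed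
  qed (rule follows_unique)
  also have "\<dots> = (\<Sum>\<kappa>\<in>{\<kappa>\<in>histories n. S (fst \<kappa>)}.
    path_weight p_bullet n \<kappa> * prob {\<omega>\<in>space M. occupied_along n (fst \<kappa>) (snd \<kappa>) \<omega>})"
    unfolding C by (intro sum.cong refl past_prob[OF sym]) auto
  finally show ?thesis .
qed

text \<open>
  In both models the probability is the same finite combination of probabilities of environment events,
  and these converge.
\<close>

lemma path_limit:
  assumes sym: "p_bullet = 1 - p_circ" and half: "\<rho> = 1 / 2" and p: "0 \<le> p_bullet" "p_bullet \<le> 1"
    and S: "\<And>f g. (\<And>l. l \<le> n \<Longrightarrow> f l = g l) \<Longrightarrow> S f = S g"
    and ev: "{\<omega>\<in>space M. S (\<lambda>k. X k \<omega>)} \<in> events"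
  shows "(\<lambda>m. measure (grid_model (Suc m) p_bullet) {a. S (walk (arrow (Suc m) a) 0 0)})
    \<longlonglongrightarrow> prob {\<omega>\<in>space M. S (\<lambda>k. X k \<omega>)}"
proof -
  have "measure (grid_model (Suc m) p_bullet) {a. S (walk (arrow (Suc m) a) 0 0)} =
    (\<Sum>\<kappa>\<in>{\<kappa>\<in>histories n. S (fst \<kappa>)}. path_weight p_bullet n \<kappa> *
      measure (grid_model (Suc m) p_bullet) {a. reads (Suc m) n (fst \<kappa>) (snd \<kappa>) a})" for m
  proof -
    interpret pm: product_model "ring_probability (Suc m)" p_bullet "Suc m"
      using ring_probability_bounds p by unfold_locales auto
    show ?thesis by (rule pm.walk_path_law) (rule S)
  qed
  moreover have "(\<lambda>m. \<Sum>\<kappa>\<in>{\<kappa>\<in>histories n. S (fst \<kappa>)}. path_weight p_bullet n \<kappa> *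
      measure (grid_model (Suc m) p_bullet) {a. reads (Suc m) n (fst \<kappa>) (snd \<kappa>) a})
    \<longlonglongrightarrow> (\<Sum>\<kappa>\<in>{\<kappa>\<in>histories n. S (fst \<kappa>)}.
      path_weight p_bullet n \<kappa> * prob {\<omega>\<in>space M. occupied_along n (fst \<kappa>) (snd \<kappa>) \<omega>})"
  proof (intro tendsto_sum tendsto_mult_left)
    fix \<kappa> assume "\<kappa> \<in> {\<kappa>\<in>histories n. S (fst \<kappa>)}"
    then have "\<bar>fst \<kappa> k\<bar> \<le> int n" if "k < n" for k using histories_bound[of \<kappa> n k] that by simp
    then show "(\<lambda>m. measure (grid_model (Suc m) p_bullet) {a. reads (Suc m) n (fst \<kappa>) (snd \<kappa>) a})
      \<longlonglongrightarrow> prob {\<omega>\<in>space M. occupied_along n (fst \<kappa>) (snd \<kappa>) \<omega>}"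
      by (rule environment_limit[OF half p])
  qed
  moreover have "prob {\<omega>\<in>space M. S (\<lambda>k. X k \<omega>)} = (\<Sum>\<kappa>\<in>{\<kappa>\<in>histories n. S (fst \<kappa>)}.
    path_weight p_bullet n \<kappa> * prob {\<omega>\<in>space M. occupied_along n (fst \<kappa>) (snd \<kappa>) \<omega>})"
    by (rule path_law[OF sym _ ev]) (rule S)
  ultimately show ?thesis by (simp only:)
qed

end

section \<open>The law of large numbers\<close>

lemma block_scale_pos: "0 < K \<Longrightarrow> 0 < block_scale K k"
  by (induction k) simp_all

lemma block_scale_less:
  assumes "2 \<le> K"
  shows "block_scale K k < block_scale K (Suc k)"
proof -
  have "2 * 1 \<le> K * 2 ^ k" using assms by (intro mult_le_mono) simp_all
  then have "2 * block_scale K k \<le> 2 ^ k * K * block_scale K k" by (intro mult_le_mono1) (simp add: mult.commute)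
  then show ?thesis using block_scale_pos[of K k] assms by simp
qed

lemma between_consecutive:
  fixes f :: "nat \<Rightarrow> nat"
  assumes f: "\<And>k. f k < f (Suc k)" and N: "f k0 \<le> N"
  shows "\<exists>k\<ge>k0. f k \<le> N \<and> N < f (Suc k)"
proof -
  have fk: "k \<le> f k" for k
  proof (induction k)
    case (Suc k) then show ?case using f[of k] by linarith
  qed simp
  have fin: "finite {k. f k \<le> N}" by (rule finite_subset[of _ "{..N}"]) (use fk in \<open>auto intro: le_trans\<close>)
  define k where "k = Max {k. f k \<le> N}"
  have "k \<in> {k. f k \<le> N}" unfolding k_def by (rule Max_in[OF fin]) (use N in auto)
  moreover have "k0 \<le> k" unfolding k_def by (rule Max_ge[OF fin]) (use N in simp)
  moreover have "\<not> f (Suc k) \<le> N"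
  proof
    assume "f (Suc k) \<le> N"
    then have "Suc k \<le> k" unfolding k_def by (intro Max_ge[OF fin]) simp
    then show False by simp
  qed
  ultimately show ?thesis by (intro exI[of _ k]) simp
qed

context walk_on_ssep begin

text \<open>
  The bounds on excursions do not depend on \<open>m\<close>, so they pass to the limit; being geometric in the
  scale they are summable.
\<close>

lemma eventually_slower_than:
  assumes sym: "p_bullet = 1 - p_circ" and half: "\<rho> = 1 / 2" and p: "0 \<le> p_bullet" "p_bullet \<le> 1"
    and w: "0 < w" "w \<le> 2"
  shows "AE \<omega> in M. \<forall>\<^sub>F N in sequentially. \<bar>real_of_int (X N \<omega>)\<bar> \<le> 3 * w * real N"
proof -
  have g0: "0 \<le> \<gamma>" using rate by simp
  obtain K0 where K0: "\<And>K. K0 \<le> K \<Longrightarrow> large_ratio \<gamma> w K" using eventually_large_ratio[OF g0 w(1)] by blast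
  define K where "K = K0 + 2"
  have K: "large_ratio \<gamma> w K'" if "K \<le> K'" for K' using K0 that unfolding K_def by simp
  let ?A = "\<lambda>k. {block_scale K (Suc k)..<block_scale K (Suc (Suc k))}"
  let ?S = "\<lambda>k f. \<exists>N\<in>?A k. \<bar>real_of_int (f N)\<bar> > 3 * w * real N"
  let ?F = "\<lambda>k. {\<omega>\<in>space M. ?S k (\<lambda>j. X j \<omega>)}"
  have [measurable]: "X j \<in> measurable M (count_space UNIV)" for j by (rule measurable_X)
  have ev: "?F k \<in> events" for k
  proof -
    have "?F k = (\<Union>N\<in>?A k. X N -` {x. \<bar>real_of_int x\<bar> > 3 * w * real N} \<inter> space M)" by blast
    moreover have "(\<Union>N\<in>?A k. X N -` {x. \<bar>real_of_int x\<bar> > 3 * w * real N} \<inter> space M) \<in> events"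
      by (intro sets.finite_UN measurable_sets[OF measurable_X]) simp_all
    ultimately show ?thesis by (simp only:)
  qed
  have bound: "prob (?F k) \<le> 36 * (1 / 2) ^ k" for k
  proof (rule LIMSEQ_le_const2)
    show "(\<lambda>m. measure (grid_model (Suc m) p_bullet) {a. ?S k (walk (arrow (Suc m) a) 0 0)})
      \<longlonglongrightarrow> prob (?F k)"
      by (rule path_limit[OF sym half p _ ev, where n="block_scale K (Suc (Suc k))"]) auto
    show "\<exists>N. \<forall>m\<ge>N. measure (grid_model (Suc m) p_bullet) {a. ?S k (walk (arrow (Suc m) a) 0 0)} \<le> 36 * (1 / 2) ^ k"
    proof (intro exI[of _ 0] allI impI)
      fix m
      interpret pm: product_model "ring_probability (Suc m)" p_bullet "Suc m"
        using ring_probability_bounds p by unfold_locales auto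
      have "ring_probability (Suc m) * real (Suc m) \<le> \<gamma>"
        using ring_probability_bounds(3)[of "Suc m"] by (simp add: pos_le_divide_eq)
      then show "measure (grid_model (Suc m) p_bullet) {a. ?S k (walk (arrow (Suc m) a) 0 0)} \<le> 36 * (1 / 2) ^ k"
        by (rule pm.Pr_excursion[OF _ g0 w]) (rule K)
    qed
  qed
  have "summable (\<lambda>k. 36 * (1 / 2 :: real) ^ k)" by (intro summable_mult summable_geometric) simp
  then have "summable (\<lambda>k. prob (?F k))"
    by (rule summable_comparison_test'[where N=0]) (use bound in simp)
  then have "AE \<omega> in M. eventually (\<lambda>k. \<omega> \<in> space M - ?F k) sequentially"
    by (intro borel_cantelli_AE1 ev) (simp_all add: emeasure_eq_measure)
  then show ?thesis
  proof eventually_elim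
    case (elim \<omega>)
    then obtain k0 where k0: "\<And>k. k0 \<le> k \<Longrightarrow> \<omega> \<in> space M - ?F k" unfolding eventually_sequentially by blast
    show ?case
      unfolding eventually_sequentially
    proof (intro exI allI impI)
      fix N assume N: "block_scale K (Suc k0) \<le> N"
      obtain k where k: "k0 \<le> k" "block_scale K (Suc k) \<le> N" "N < block_scale K (Suc (Suc k))"
        using between_consecutive[of "\<lambda>k. block_scale K (Suc k)", OF block_scale_less N] unfolding K_def by auto
      have "\<not> ?S k (\<lambda>j. X j \<omega>)" using k0[OF k(1)] by blast
      then have "\<not> \<bar>real_of_int (X N \<omega>)\<bar> > 3 * w * real N" using k by auto
      then show "\<bar>real_of_int (X N \<omega>)\<bar> \<le> 3 * w * real N" by simp
    qed
  qed
qed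

end

theorem theorem2p2:
  fixes M :: "'a measure"
    and \<rho> \<gamma> p_bullet p_circ :: real
    and T :: "int \<Rightarrow> 'a \<Rightarrow> real set"
    and \<eta> :: "real \<Rightarrow> int \<Rightarrow> 'a \<Rightarrow> bool"
    and X :: "nat \<Rightarrow> 'a \<Rightarrow> int"
  assumes walk: "walk_on_ssep M \<rho> \<gamma> T \<eta> p_bullet p_circ X"
    and p_bullet: "0 < p_bullet" "p_bullet < 1"
    and p_circ: "0 < p_circ" "p_circ < 1"
    and symmetric: "p_bullet = 1 - p_circ"
    and half: "\<rho> = 1 / 2"
  shows "AE \<omega> in M. (\<lambda>n. real_of_int (X n \<omega>) / real n) \<longlonglongrightarrow> 0"
proof -
  interpret walk_on_ssep M \<rho> \<gamma> T \<eta> p_bullet p_circ X by (rule walk)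
  have "AE \<omega> in M. \<forall>j. \<forall>\<^sub>F N in sequentially. \<bar>real_of_int (X N \<omega>)\<bar> \<le> 3 * (1 / real (Suc j)) * real N"
    unfolding AE_all_countable
  proof
    fix j
    have "1 / real (Suc j) \<le> 2" by (simp add: divide_le_eq)
    then show "AE \<omega> in M. \<forall>\<^sub>F N in sequentially. \<bar>real_of_int (X N \<omega>)\<bar> \<le> 3 * (1 / real (Suc j)) * real N"
      using p_bullet by (intro eventually_slower_than[OF symmetric half]) simp_all
  qed
  then show ?thesis
  proof eventually_elim
    case (elim \<omega>)
    show ?case
    proof (rule LIMSEQ_I)
      fix r :: real assume "0 < r"
      then obtain j where j: "inverse (real (Suc j)) < r / 3" using reals_Archimedean[of "r / 3"] by auto
      obtain N0 where N0: "\<And>N. N0 \<le> N \<Longrightarrow> \<bar>real_of_int (X N \<omega>)\<bar> \<le> 3 * (1 / real (Suc j)) * real N"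
        using elim unfolding eventually_sequentially by blast
      show "\<exists>N0. \<forall>N\<ge>N0. norm (real_of_int (X N \<omega>) / real N - 0) < r"
      proof (intro exI[of _ "max N0 1"] allI impI)
        fix N assume N: "max N0 1 \<le> N"
        then have "\<bar>real_of_int (X N \<omega>)\<bar> / real N \<le> 3 * (1 / real (Suc j))"
          using N0[of N] by (simp only: pos_divide_le_eq of_nat_0_less_iff)
        also have "\<dots> < r" using j by (simp add: inverse_eq_divide)
        finally show "norm (real_of_int (X N \<omega>) / real N - 0) < r" by simp
      qed
    qed
  qed
qed

end
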